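(* Let $(C,\mathcal{E})$ be a non-singular real tropical curve of strict even degree in $\mathbb{T}\mathbb{P}_\Sigma$. Assume that every edge in the set of twisted edges $T$ on $C$ is non-exposed. Then all the connected components of the real part $\mathbb{R}C_{\mathcal{E}}$ are ovals.
   Context: **Tropical curves.** A tropical polynomial is $P(x,y)=\max_{(i,j)\in A}(a_{i,j}+ix+jy)$ with $A\subset(\mathbb{Z}_{\ge 0})^2$ finite; its tropical curve in $\mathbb{R}^2$ is the locus where the maximum is attained at least twice, $\Delta=\mathrm{Conv}\{(i,j): a_{i,j}\neq-\infty\}$ is its Newton polygon, and the dual subdivision $\Delta_C$ of $\Delta$ has faces $F^\vee=\mathrm{Conv}\{(i,j): P(x_0,y_0)=a_{i,j}+ix_0+jy_0\}$ for $F$ a cell of the decomposition of $\mathbb{R}^2$ induced by the curve, $(x_0,y_0)$ in its relative interior. The curve is non-singular if $\Delta_C$ is a triangulation with all triangles of area $1/2$. $\Sigma$ is the fan dual to $\Delta$, assumed complete and unimodular; $\mathbb{T}\mathbb{P}_\Sigma$ is the corresponding tropical toric surface, a compactification of $\mathbb{R}^2$ whose strata correspond to faces of $\Delta$. A non-singular tropical curve $C$ in $\mathbb{T}\mathbb{P}_\Sigma$ is the compactification of such a curve, each unbounded edge receiving a 1-valent vertex on the boundary. Bounded edges are those bounded in $\mathbb{R}^2$. An edge is exposed if it lies on the boundary of an unbounded component of the complement of the curve in $\mathbb{R}^2$, non-exposed otherwise. $C$ is of strict even degree if every edge of $\Delta$ has even lattice length. **Real structure.** Identify the group $\mathcal{R}^2$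 generated by coordinate reflections with $\mathbb{Z}_2^2$. A distribution of signs $\delta:\Delta_C\cap\mathbb{Z}^2\to\{\pm1\}$ is extended to symmetric copies by $\delta(\varepsilon(v))=(-1)^{\varepsilon_1v_1+\varepsilon_2v_2}\delta(v)$. The associated real phase structure is $\mathcal{E}=\{\mathcal{E}_e\}_e$, $\mathcal{E}_e$ being the set of $\varepsilon$ such that the endpoints of $\varepsilon(e^\vee)$ have opposite signs; $(C,\mathcal{E})$ is a real tropical curve. $\mathbb{R}\mathbb{P}_\Sigma$ is the quotient of the disjoint union $\bigsqcup_{\varepsilon}\varepsilon(\mathbb{T}\mathbb{P}_\Sigma)$ where, for each face $\Gamma$ of $\Delta$ and each integer vector $\alpha$ orthogonal to $\Gamma$, the copies of the stratum of $\Gamma$ differing by $\alpha\bmod2$ are identified. The real part is $\mathbb{R}C_{\mathcal{E}}=\overline{\bigcup_e\bigcup_{\varepsilon\in\mathcal{E}_e}\varepsilon(e)}\subset\mathbb{R}\mathbb{P}_\Sigma$. A connected component of $\mathbb{R}C_{\mathcal{E}}$ is an oval if it divides $\mathbb{R}\mathbb{P}_\Sigma$ into two connected components. **Twists.** A bounded edge $e$ is twisted if for any $\varepsilon\in\mathcal{E}_e$ the two edges $e_1,e_2$ adjacent to $e$ (one at each endpoint) with $\varepsilon\in\mathcal{E}_{e_1}\cap\mathcal{E}_{e_2}$ lie on distinct sides of the affine line containing $e$; $T$ is the set of all twisted edges of $(C,\mathcal{E})$. *)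

theory Defs
  imports "HOL-Analysis.Analysis" "HOL-Library.Z2"
begin

section \<open>Tropical curves in the plane\<close>

text \<open>A tropical polynomial is given by its finite support \<open>A\<close>, i.e. the set of exponents whose
  coefficient is not \<open>-\<infinity>\<close>, together with the real coefficients \<open>a v\<close> for \<open>v \<in> A\<close>.\<close>

definition pt :: "int^2 \<Rightarrow> real^2" where
  "pt v = (\<chi> i. real_of_int (v $ i))"

definition trop_poly :: "(int^2) set \<Rightarrow> (int^2 \<Rightarrow> real) \<Rightarrow> real^2 \<Rightarrow> real" where
  "trop_poly A a x = (MAX v\<in>A. a v + pt v \<bullet> x)"

definition max_terms :: "(int^2) set \<Rightarrow> (int^2 \<Rightarrow> real) \<Rightarrow> real^2 \<Rightarrow> (int^2) set" where
  "max_terms A a x = {v \<in> A. trop_poly A a x = a v + pt v \<bullet> x}"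

definition trop_curve :: "(int^2) set \<Rightarrow> (int^2 \<Rightarrow> real) \<Rightarrow> (real^2) set" where
  "trop_curve A a = {x. card (max_terms A a x) \<ge> 2}"

definition newton_polygon :: "(int^2) set \<Rightarrow> (real^2) set" where
  "newton_polygon A = convex hull (pt ` A)"

text \<open>The closed cells of the polyhedral decomposition of the plane induced by the curve:
  \<open>cell A a x\<close> is the unique cell containing \<open>x\<close> in its relative interior.\<close>

definition cell :: "(int^2) set \<Rightarrow> (int^2 \<Rightarrow> real) \<Rightarrow> real^2 \<Rightarrow> (real^2) set" where
  "cell A a x = {y. max_terms A a x \<subseteq> max_terms A a y}"

definition cells :: "(int^2) set \<Rightarrow> (int^2 \<Rightarrow> real) \<Rightarrow> (real^2) set set" where
  "cells A a = range (cell A a)"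

definition edges :: "(int^2) set \<Rightarrow> (int^2 \<Rightarrow> real) \<Rightarrow> (real^2) set set" where
  "edges A a = {e \<in> cells A a. aff_dim e = 1}"

definition dual_face :: "(int^2) set \<Rightarrow> (int^2 \<Rightarrow> real) \<Rightarrow> (real^2) set \<Rightarrow> (real^2) set" where
  "dual_face A a F = convex hull (pt ` max_terms A a (SOME x. x \<in> rel_interior F))"

definition dual_subdivision :: "(int^2) set \<Rightarrow> (int^2 \<Rightarrow> real) \<Rightarrow> (real^2) set set" where
  "dual_subdivision A a = dual_face A a ` cells A a"

definition nonsingular_curve :: "(int^2) set \<Rightarrow> (int^2 \<Rightarrow> real) \<Rightarrow> bool" where
  "nonsingular_curve A a \<longleftrightarrow>
     (\<forall>F\<in>dual_subdivision A a. aff_dim F = 2 \<longrightarrow> 2 simplex F \<and> measure lborel F = 1/2)"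

text \<open>Exposedness refers to the complement of the curve in the plane, not in its compactification.\<close>

definition exposed_edge :: "(int^2) set \<Rightarrow> (int^2 \<Rightarrow> real) \<Rightarrow> (real^2) set \<Rightarrow> bool" where
  "exposed_edge A a e \<longleftrightarrow>
     (\<exists>U\<in>components (- trop_curve A a). \<not> bounded U \<and> e \<subseteq> frontier U)"

definition lattice_length :: "(real^2) set \<Rightarrow> nat" where
  "lattice_length \<Gamma> = card {v. pt v \<in> \<Gamma>} - 1"

definition strict_even_degree :: "(int^2) set \<Rightarrow> bool" where
  "strict_even_degree A \<longleftrightarrow> (\<forall>\<Gamma>. \<Gamma> edge_of newton_polygon A \<longrightarrow> even (lattice_length \<Gamma>))"


section \<open>The dual fan and the tropical toric surface\<close>

text \<open>Since tropical addition is the maximum, the dual fan is the outer normal fan.\<close>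

definition dual_cone :: "(real^2) set \<Rightarrow> (real^2) set \<Rightarrow> (real^2) set" where
  "dual_cone \<Delta> \<Gamma> = {w. \<forall>p\<in>\<Gamma>. \<forall>q\<in>\<Delta>. w \<bullet> q \<le> w \<bullet> p}"

definition dual_fan :: "(real^2) set \<Rightarrow> (real^2) set set" where
  "dual_fan \<Delta> = dual_cone \<Delta> ` {\<Gamma>. \<Gamma> face_of \<Delta> \<and> \<Gamma> \<noteq> {}}"

definition complete_fan :: "(real^2) set set \<Rightarrow> bool" where
  "complete_fan \<Sigma> \<longleftrightarrow> \<Union>\<Sigma> = UNIV"

definition unimodular_fan :: "(real^2) set set \<Rightarrow> bool" where
  "unimodular_fan \<Sigma> \<longleftrightarrow>
     (\<forall>\<sigma>\<in>\<Sigma>. \<exists>u v :: int^2. \<bar>u $ 1 * v $ 2 - u $ 2 * v $ 1\<bar> = 1 \<and>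
        (\<exists>B\<subseteq>{u, v}. \<sigma> = convex_cone hull (pt ` B)))"

text \<open>A point of the tropical toric surface is a pair \<open>(\<sigma>, x + span \<sigma>)\<close>: a cone of the fan and an
  element of the stratum \<open>\<real>\<^sup>2 / span \<sigma>\<close>.\<close>

type_synonym toric_point = "(real^2) set \<times> (real^2) set"

definition stratum :: "(real^2) set \<Rightarrow> toric_point set" where
  "stratum \<sigma> = {(\<sigma>, (+) x ` span \<sigma>) | x. True}"

definition toric_points :: "(real^2) set set \<Rightarrow> toric_point set" where
  "toric_points \<Sigma> = (\<Union>\<sigma>\<in>\<Sigma>. stratum \<sigma>)"

text \<open>The affine chart of \<open>\<sigma>\<close> is the set of semigroup homomorphisms from
  \<open>S = {m \<in> \<int>\<^sup>2. m \<le> 0 on \<sigma>}\<close> to the tropical numbers \<open>\<real> \<union> {-\<infinity>}\<close>, with the topology of pointwise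
  convergence. The point \<open>(\<tau>, x + span \<tau>)\<close>, for \<open>\<tau>\<close> a face of \<open>\<sigma>\<close>, is the homomorphism sending
  \<open>m\<close> to \<open>m \<bullet> x\<close> if \<open>m\<close> vanishes on \<open>\<tau>\<close> and to \<open>-\<infinity>\<close> otherwise.\<close>

definition chart_monomials :: "(real^2) set \<Rightarrow> (int^2) set" where
  "chart_monomials \<sigma> = {m. \<forall>w\<in>\<sigma>. pt m \<bullet> w \<le> 0}"

definition chart_points :: "(real^2) set set \<Rightarrow> (real^2) set \<Rightarrow> toric_point set" where
  "chart_points \<Sigma> \<sigma> = (\<Union>\<tau>\<in>{\<tau>\<in>\<Sigma>. \<tau> face_of \<sigma>}. stratum \<tau>)"

definition toric_eval :: "toric_point \<Rightarrow> int^2 \<Rightarrow> ereal" where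
  "toric_eval p m =
     (if \<forall>w\<in>fst p. pt m \<bullet> w = 0 then ereal (pt m \<bullet> (SOME x. x \<in> snd p)) else -\<infinity>)"

definition chart_topology :: "(real^2) set set \<Rightarrow> (real^2) set \<Rightarrow> toric_point topology" where
  "chart_topology \<Sigma> \<sigma> =
     pullback_topology (chart_points \<Sigma> \<sigma>) (\<lambda>p. restrict (toric_eval p) (chart_monomials \<sigma>))
       (product_topology (\<lambda>m. euclidean) (chart_monomials \<sigma>))"

definition trop_toric :: "(real^2) set set \<Rightarrow> toric_point topology" where
  "trop_toric \<Sigma> = topology (\<lambda>U. U \<subseteq> toric_points \<Sigma> \<and>
     (\<forall>\<sigma>\<in>\<Sigma>. openin (chart_topology \<Sigma> \<sigma>) (U \<inter> chart_points \<Sigma> \<sigma>)))"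

text \<open>The plane is the open stratum of the cone \<open>{0}\<close>.\<close>

definition toric_incl :: "real^2 \<Rightarrow> toric_point" where
  "toric_incl x = ({0}, {x})"


section \<open>The real toric surface\<close>

definition quotient_topology :: "'a topology \<Rightarrow> ('a \<times> 'a) set \<Rightarrow> 'a set topology" where
  "quotient_topology X R = topology (\<lambda>\<U>. \<U> \<subseteq> topspace X // R \<and> openin X (\<Union>\<U>))"

text \<open>A reflection is encoded in \<open>bit^2\<close>: coordinate \<open>i\<close> is \<open>1\<close> iff the \<open>i\<close>-th
  coordinate changes sign. The pair \<open>(\<epsilon>, p)\<close> stands for the point \<open>\<epsilon>(p)\<close> of the copy
  \<open>\<epsilon>(TP\<^sub>\<Sigma>)\<close>.\<close>

type_synonym reflection = "bit^2"

definition mod2 :: "int^2 \<Rightarrow> reflection" where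
  "mod2 \<alpha> = (\<chi> i. of_int (\<alpha> $ i))"

definition toric_copies :: "(real^2) set \<Rightarrow> (reflection \<times> toric_point) topology" where
  "toric_copies \<Delta> = sum_topology (\<lambda>\<epsilon>. trop_toric (dual_fan \<Delta>)) UNIV"

definition copy_gluing :: "(real^2) set \<Rightarrow> ((reflection \<times> toric_point) \<times> (reflection \<times> toric_point)) set" where
  "copy_gluing \<Delta> = {((\<epsilon>, p), (\<epsilon> + mod2 \<alpha>, p)) | \<epsilon> p \<alpha>.
     \<exists>\<Gamma>. \<Gamma> face_of \<Delta> \<and> \<Gamma> \<noteq> {} \<and> (\<forall>x\<in>\<Gamma>. \<forall>y\<in>\<Gamma>. pt \<alpha> \<bullet> (x - y) = 0) \<and>
       p \<in> stratum (dual_cone \<Delta> \<Gamma>)}"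

definition real_toric :: "(real^2) set \<Rightarrow> (reflection \<times> toric_point) set topology" where
  "real_toric \<Delta> = quotient_topology (toric_copies \<Delta>) (copy_gluing \<Delta>)"


section \<open>Real structures\<close>

text \<open>\<open>copy_sign \<delta> \<epsilon> v\<close> is the value at \<open>\<epsilon>(v)\<close> of the extension of the sign distribution \<open>\<delta>\<close>.\<close>

definition copy_sign :: "(int^2 \<Rightarrow> int) \<Rightarrow> reflection \<Rightarrow> int^2 \<Rightarrow> int" where
  "copy_sign \<delta> \<epsilon> v = (if (\<Sum>i\<in>UNIV. \<epsilon> $ i * mod2 v $ i) = 0 then \<delta> v else - \<delta> v)"

definition sign_distribution :: "(int^2) set \<Rightarrow> (int^2 \<Rightarrow> int) \<Rightarrow> bool" where
  "sign_distribution A \<delta> \<longleftrightarrow> (\<forall>v. pt v \<in> newton_polygon A \<longrightarrow> \<delta> v \<in> {-1, 1})"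

definition phase ::
  "(int^2) set \<Rightarrow> (int^2 \<Rightarrow> real) \<Rightarrow> (int^2 \<Rightarrow> int) \<Rightarrow> (real^2) set \<Rightarrow> reflection set" where
  "phase A a \<delta> e = {\<epsilon>. \<exists>u v. dual_face A a e = closed_segment (pt u) (pt v) \<and>
                             copy_sign \<delta> \<epsilon> u = - copy_sign \<delta> \<epsilon> v}"

text \<open>Taking the closure adds, for each unbounded edge, its boundary vertex.\<close>

definition real_part ::
  "(int^2) set \<Rightarrow> (int^2 \<Rightarrow> real) \<Rightarrow> (int^2 \<Rightarrow> int) \<Rightarrow> (reflection \<times> toric_point) set set" where
  "real_part A a \<delta> = real_toric (newton_polygon A) closure_of
     (\<Union>e\<in>edges A a. \<Union>\<epsilon>\<in>phase A a \<delta> e.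
        (\<lambda>x. copy_gluing (newton_polygon A) `` {(\<epsilon>, toric_incl x)}) ` e)"

definition is_oval :: "'a topology \<Rightarrow> 'a set \<Rightarrow> bool" where
  "is_oval X K \<longleftrightarrow> card (connected_components_of (subtopology X (topspace X - K))) = 2"


section \<open>Twisted edges\<close>

definition distinct_sides :: "(real^2) set \<Rightarrow> (real^2) set \<Rightarrow> (real^2) set \<Rightarrow> bool" where
  "distinct_sides L S T \<longleftrightarrow> (\<exists>n c. n \<noteq> 0 \<and> L = {x. n \<bullet> x = c} \<and>
     S - L \<subseteq> {x. n \<bullet> x < c} \<and> T - L \<subseteq> {x. n \<bullet> x > c})"

text \<open>For a non-singular curve and \<open>\<epsilon> \<in> \<E>\<^sub>e\<close>, each endpoint of \<open>e\<close> lies on exactly one other edge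
  \<open>e'\<close> with \<open>\<epsilon> \<in> \<E>\<^sub>e\<^sub>'\<close>, so \<open>e1\<close> and \<open>e2\<close> below are determined by \<open>e\<close>, \<open>\<epsilon>\<close>, \<open>p\<close>, \<open>q\<close>.\<close>

definition twisted_edges ::
  "(int^2) set \<Rightarrow> (int^2 \<Rightarrow> real) \<Rightarrow> (int^2 \<Rightarrow> int) \<Rightarrow> (real^2) set set" where
  "twisted_edges A a \<delta> = {e \<in> edges A a. bounded e \<and>
     (\<forall>\<epsilon>\<in>phase A a \<delta> e. \<forall>p q e1 e2.
        e = closed_segment p q \<and>
        e1 \<in> edges A a - {e} \<and> p \<in> e1 \<and> \<epsilon> \<in> phase A a \<delta> e1 \<and>
        e2 \<in> edges A a - {e} \<and> q \<in> e2 \<and> \<epsilon> \<in> phase A a \<delta> e2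
        \<longrightarrow> distinct_sides (affine hull e) e1 e2)}"


section \<open>Well-definedness\<close>

lemma istopology_quotient:
  assumes "equiv (topspace X) R"
  shows "istopology (\<lambda>\<U>. \<U> \<subseteq> topspace X // R \<and> openin X (\<Union>\<U>))"
proof -
  have int: "\<Union>(S \<inter> T) = \<Union>S \<inter> \<Union>T"
    if "S \<subseteq> topspace X // R" "T \<subseteq> topspace X // R" for S T
    using quotient_disj[OF assms] that by blast
  have un: "\<Union>(\<Union>\<K>) = \<Union>(Union ` \<K>)" for \<K> :: "'a set set set"
    by blast
  show ?thesis
    unfolding istopology_def
  proof (intro conjI allI impI)
    fix S T
    assume S: "S \<subseteq> topspace X // R \<and> openin X (\<Union>S)"
      and T: "T \<subseteq> topspace X // R \<and> openin X (\<Union>T)"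
    then show "S \<inter> T \<subseteq> topspace X // R" by blast
    show "openin X (\<Union>(S \<inter> T))"
      using int[of S T] S T by auto
  next
    fix \<K>
    assume K: "\<forall>S\<in>\<K>. S \<subseteq> topspace X // R \<and> openin X (\<Union>S)"
    then show "\<Union>\<K> \<subseteq> topspace X // R" by blast
    show "openin X (\<Union>(\<Union>\<K>))"
      unfolding un using K by blast
  qed
qed

lemma istopology_trop_toric:
  "istopology (\<lambda>U. U \<subseteq> toric_points \<Sigma> \<and>
     (\<forall>\<sigma>\<in>\<Sigma>. openin (chart_topology \<Sigma> \<sigma>) (U \<inter> chart_points \<Sigma> \<sigma>)))"
  (is "istopology ?P")
proof -
  have "?P (S \<inter> T)" if S: "?P S" and T: "?P T" for S T
  proof (intro conjI ballI)
    show "S \<inter> T \<subseteq> toric_points \<Sigma>" using S by (simp add: le_infI1)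
  next
    fix \<sigma> assume "\<sigma> \<in> \<Sigma>"
    then have "openin (chart_topology \<Sigma> \<sigma>)
        ((S \<inter> chart_points \<Sigma> \<sigma>) \<inter> (T \<inter> chart_points \<Sigma> \<sigma>))"
      using S T by (simp add: openin_Int)
    then show "openin (chart_topology \<Sigma> \<sigma>) (S \<inter> T \<inter> chart_points \<Sigma> \<sigma>)"
      by (simp add: Int_ac)
  qed
  moreover have "?P (\<Union>\<K>)" if K: "\<forall>U\<in>\<K>. ?P U" for \<K>
  proof (intro conjI ballI)
    show "\<Union>\<K> \<subseteq> toric_points \<Sigma>" using K by (simp add: Sup_le_iff)
  next
    fix \<sigma> assume "\<sigma> \<in> \<Sigma>"
    then have "openin (chart_topology \<Sigma> \<sigma>) (\<Union>U\<in>\<K>. U \<inter> chart_points \<Sigma> \<sigma>)"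
      using K by (intro openin_Union) auto
    then show "openin (chart_topology \<Sigma> \<sigma>) (\<Union>\<K> \<inter> chart_points \<Sigma> \<sigma>)"
      by (simp add: Int_commute Int_Union)
  qed
  ultimately show ?thesis
    unfolding istopology_def by simp
qed

lemma topspace_chart_topology: "topspace (chart_topology \<Sigma> \<sigma>) = chart_points \<Sigma> \<sigma>"
  unfolding chart_topology_def topspace_pullback_topology by auto

lemma openin_trop_toric:
  "openin (trop_toric \<Sigma>) U \<longleftrightarrow> U \<subseteq> toric_points \<Sigma> \<and>
     (\<forall>\<sigma>\<in>\<Sigma>. openin (chart_topology \<Sigma> \<sigma>) (U \<inter> chart_points \<Sigma> \<sigma>))"
  unfolding trop_toric_def topology_inverse'[OF istopology_trop_toric] ..

lemma topspace_trop_toric: "topspace (trop_toric \<Sigma>) = toric_points \<Sigma>"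
proof
  show "topspace (trop_toric \<Sigma>) \<subseteq> toric_points \<Sigma>"
    using openin_topspace openin_trop_toric by blast
  have "toric_points \<Sigma> \<inter> chart_points \<Sigma> \<sigma> = topspace (chart_topology \<Sigma> \<sigma>)" for \<sigma>
    unfolding topspace_chart_topology by (auto simp: toric_points_def chart_points_def)
  then have "openin (trop_toric \<Sigma>) (toric_points \<Sigma>)"
    by (simp add: openin_trop_toric)
  then show "toric_points \<Sigma> \<subseteq> topspace (trop_toric \<Sigma>)"
    by (rule openin_subset)
qed

lemma dual_cone_inj:
  assumes P: "polytope \<Delta>"
    and "\<Gamma> face_of \<Delta>" "\<Gamma> \<noteq> {}" "\<Gamma>' face_of \<Delta>" "\<Gamma>' \<noteq> {}"
    and eq: "dual_cone \<Delta> \<Gamma> = dual_cone \<Delta> \<Gamma>'"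
  shows "\<Gamma> = \<Gamma>'"
proof -
  have sub: "G' \<subseteq> G" if G: "G face_of \<Delta>" "G \<noteq> {}" and G': "G' face_of \<Delta>" "G' \<noteq> {}"
    and e: "dual_cone \<Delta> G = dual_cone \<Delta> G'" for G G'
  proof -
    have "G exposed_face_of \<Delta>"
      using G P by (simp add: exposed_face_of_polyhedron polytope_imp_polyhedron)
    then obtain n b where n: "\<Delta> \<subseteq> {x. n \<bullet> x \<le> b}" "G = \<Delta> \<inter> {x. n \<bullet> x = b}"
      unfolding exposed_face_of_def by blast
    then have "n \<in> dual_cone \<Delta> G"
      unfolding dual_cone_def by auto
    then have *: "n \<bullet> q \<le> n \<bullet> p" if "p \<in> G'" "q \<in> \<Delta>" for p q
      using e that unfolding dual_cone_def by auto
    obtain g where g: "g \<in> G" using G by blast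
    show ?thesis
    proof
      fix p assume p: "p \<in> G'"
      then have pD: "p \<in> \<Delta>" using G' face_of_imp_subset by blast
      have "b \<le> n \<bullet> p" using *[OF p, of g] g n by auto
      then show "p \<in> G" using n pD by force
    qed
  qed
  show ?thesis
    using sub[of \<Gamma> \<Gamma>'] sub[of \<Gamma>' \<Gamma>] assms by auto
qed

lemma mod2_add: "mod2 (\<alpha> + \<beta>) = mod2 \<alpha> + mod2 \<beta>"
  by (simp add: mod2_def vec_eq_iff)

lemma pt_add: "pt (\<alpha> + \<beta>) = pt \<alpha> + pt \<beta>"
  by (simp add: pt_def vec_eq_iff)

lemma equiv_copy_gluing:
  assumes P: "polytope \<Delta>"
  shows "equiv (topspace (toric_copies \<Delta>)) (copy_gluing \<Delta>)"
proof (rule equivI)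
  have top: "topspace (toric_copies \<Delta>) =
      {(\<epsilon>, p). \<exists>\<Gamma>. \<Gamma> face_of \<Delta> \<and> \<Gamma> \<noteq> {} \<and> p \<in> stratum (dual_cone \<Delta> \<Gamma>)}"
    unfolding toric_copies_def topspace_sum_topology
    by (auto simp: topspace_trop_toric toric_points_def dual_fan_def)
  show "copy_gluing \<Delta> \<subseteq> topspace (toric_copies \<Delta>) \<times> topspace (toric_copies \<Delta>)"
    unfolding top copy_gluing_def by blast
  have z: "mod2 0 = 0" "pt 0 = 0"
    by (simp_all add: mod2_def pt_def vec_eq_iff)
  show "refl_on (topspace (toric_copies \<Delta>)) (copy_gluing \<Delta>)"
  proof (rule refl_onI)
    fix x assume "x \<in> topspace (toric_copies \<Delta>)"
    then obtain \<epsilon> p \<Gamma> where "x = (\<epsilon>, p)" "\<Gamma> face_of \<Delta>" "\<Gamma> \<noteq> {}" "p \<in> stratum (dual_cone \<Delta> \<Gamma>)"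
      unfolding top by blast
    then have "\<exists>\<alpha>. (x, x) = ((\<epsilon>, p), (\<epsilon> + mod2 \<alpha>, p)) \<and> (\<exists>\<Gamma>. \<Gamma> face_of \<Delta> \<and> \<Gamma> \<noteq> {} \<and>
        (\<forall>x\<in>\<Gamma>. \<forall>y\<in>\<Gamma>. pt \<alpha> \<bullet> (x - y) = 0) \<and> p \<in> stratum (dual_cone \<Delta> \<Gamma>))"
      by (intro exI[of _ 0]) (auto simp: z)
    then show "(x, x) \<in> copy_gluing \<Delta>"
      unfolding copy_gluing_def by blast
  qed
  show "sym (copy_gluing \<Delta>)"
  proof (rule symI)
    fix x y assume "(x, y) \<in> copy_gluing \<Delta>"
    then obtain \<epsilon> p \<alpha> \<Gamma> where *: "x = (\<epsilon>, p)" "y = (\<epsilon> + mod2 \<alpha>, p)"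
      "\<Gamma> face_of \<Delta>" "\<Gamma> \<noteq> {}" "\<forall>x\<in>\<Gamma>. \<forall>y\<in>\<Gamma>. pt \<alpha> \<bullet> (x - y) = 0" "p \<in> stratum (dual_cone \<Delta> \<Gamma>)"
      unfolding copy_gluing_def by blast
    have "b + b = 0" for b :: bit by (cases b) auto
    then have "\<epsilon> + mod2 \<alpha> + mod2 \<alpha> = \<epsilon>"
      by (simp add: vec_eq_iff add.assoc)
    then have "(y, x) = ((\<epsilon> + mod2 \<alpha>, p), (\<epsilon> + mod2 \<alpha> + mod2 \<alpha>, p))"
      using * by simp
    then show "(y, x) \<in> copy_gluing \<Delta>"
      using *(3-) unfolding copy_gluing_def by blast
  qed
  show "trans (copy_gluing \<Delta>)"
  proof (rule transI)
    fix x y z assume "(x, y) \<in> copy_gluing \<Delta>" "(y, z) \<in> copy_gluing \<Delta>"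
    then obtain \<epsilon> p \<alpha> \<Gamma> \<beta> \<Gamma>' where *: "x = (\<epsilon>, p)" "z = (\<epsilon> + mod2 \<alpha> + mod2 \<beta>, p)"
      "\<Gamma> face_of \<Delta>" "\<Gamma> \<noteq> {}" "\<forall>x\<in>\<Gamma>. \<forall>y\<in>\<Gamma>. pt \<alpha> \<bullet> (x - y) = 0" "p \<in> stratum (dual_cone \<Delta> \<Gamma>)"
      "\<Gamma>' face_of \<Delta>" "\<Gamma>' \<noteq> {}" "\<forall>x\<in>\<Gamma>'. \<forall>y\<in>\<Gamma>'. pt \<beta> \<bullet> (x - y) = 0"
      "p \<in> stratum (dual_cone \<Delta> \<Gamma>')"
      unfolding copy_gluing_def by blast
    have "dual_cone \<Delta> \<Gamma> = dual_cone \<Delta> \<Gamma>'"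
      using *(6,10) unfolding stratum_def by auto
    then have "\<Gamma>' = \<Gamma>"
      using dual_cone_inj[OF P] *(3,4,7,8) by metis
    then have "\<forall>x\<in>\<Gamma>. \<forall>y\<in>\<Gamma>. pt (\<alpha> + \<beta>) \<bullet> (x - y) = 0"
      using *(5,9) by (simp add: pt_add inner_add_left)
    moreover have "(x, z) = ((\<epsilon>, p), (\<epsilon> + mod2 (\<alpha> + \<beta>), p))"
      using * by (simp add: mod2_add add.assoc)
    ultimately show "(x, z) \<in> copy_gluing \<Delta>"
      using *(3,4,6) unfolding copy_gluing_def by blast
  qed
qed

lemma quotient_map_quotient_topology:
  assumes R: "equiv (topspace X) R"
  shows "quotient_map X (quotient_topology X R) (\<lambda>x. R `` {x})"
proof -
  have op: "openin (quotient_topology X R) \<U> \<longleftrightarrow> \<U> \<subseteq> topspace X // R \<and> openin X (\<Union>\<U>)" for \<U>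
    unfolding quotient_topology_def topology_inverse'[OF istopology_quotient[OF R]] ..
  have un: "\<Union>(topspace X // R) = topspace X"
    using R by (rule Union_quotient)
  have top: "topspace (quotient_topology X R) = topspace X // R"
  proof
    show "topspace (quotient_topology X R) \<subseteq> topspace X // R"
      using op openin_topspace by blast
    have "openin (quotient_topology X R) (topspace X // R)"
      by (simp add: op un)
    then show "topspace X // R \<subseteq> topspace (quotient_topology X R)"
      by (rule openin_subset)
  qed
  have im: "(\<lambda>x. R `` {x}) ` topspace X = topspace X // R"
    by (auto simp: quotient_def)
  have pre: "{x \<in> topspace X. R `` {x} \<in> \<U>} = \<Union>\<U>" if "\<U> \<subseteq> topspace X // R" for \<U>
  proof
    show "{x \<in> topspace X. R `` {x} \<in> \<U>} \<subseteq> \<Union>\<U>"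
      using equiv_class_self[OF R] by blast
    show "\<Union>\<U> \<subseteq> {x \<in> topspace X. R `` {x} \<in> \<U>}"
    proof
      fix x assume "x \<in> \<Union>\<U>"
      then obtain K where K: "x \<in> K" "K \<in> \<U>" by blast
      with that obtain y where y: "y \<in> topspace X" "K = R `` {y}"
        by (metis quotientE subsetD)
      then have "R `` {x} = K"
        using K equiv_class_eq[OF R] by blast
      moreover have "x \<in> topspace X"
        using K that un by blast
      ultimately show "x \<in> {x \<in> topspace X. R `` {x} \<in> \<U>}"
        using K by simp
    qed
  qed
  show ?thesis
    unfolding quotient_map_def using op pre top im by auto
qed

lemma dual_face_cell:
  assumes A: "finite A" "A \<noteq> {}"
  shows "dual_face A a (cell A a x) = convex hull (pt ` max_terms A a x)"
proof -
  let ?f = "\<lambda>v y. a v + pt v \<bullet> y"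
  have le: "?f v y \<le> trop_poly A a y" if "v \<in> A" for v y
    unfolding trop_poly_def using A that by simp
  have "trop_poly A a x \<in> (\<lambda>v. ?f v x) ` A"
    unfolding trop_poly_def using A by (intro Max_in) auto
  then obtain u where u: "u \<in> max_terms A a x"
    unfolding max_terms_def by auto
  have cell_eq: "cell A a x = (\<Inter>v\<in>max_terms A a x. \<Inter>w\<in>A. {y. (pt w - pt v) \<bullet> y \<le> a v - a w})"
  proof (intro set_eqI iffI)
    fix y assume "y \<in> cell A a x"
    then have "trop_poly A a y = ?f v y" if "v \<in> max_terms A a x" for v
      using that unfolding cell_def max_terms_def by blast
    then have "?f w y \<le> ?f v y" if "v \<in> max_terms A a x" "w \<in> A" for v w
      using le[OF that(2), of y] that(1) by simp
    then show "y \<in> (\<Inter>v\<in>max_terms A a x. \<Inter>w\<in>A. {y. (pt w - pt v) \<bullet> y \<le> a v - a w})"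
      by (force simp: inner_diff_left)
  next
    fix y assume y: "y \<in> (\<Inter>v\<in>max_terms A a x. \<Inter>w\<in>A. {y. (pt w - pt v) \<bullet> y \<le> a v - a w})"
    show "y \<in> cell A a x"
      unfolding cell_def
    proof (clarify)
      fix v assume v: "v \<in> max_terms A a x"
      then have vA: "v \<in> A" by (simp add: max_terms_def)
      have "?f w y \<le> ?f v y" if "w \<in> A" for w
        using y v that by (force simp: inner_diff_left)
      then have "trop_poly A a y \<le> ?f v y"
        unfolding trop_poly_def using A by simp
      then show "v \<in> max_terms A a y"
        using le[OF vA, of y] vA unfolding max_terms_def by simp
    qed
  qed
  have conv: "convex (cell A a x)"
    unfolding cell_eq by (intro convex_INT convex_halfspace_le)
  have xc: "x \<in> cell A a x" by (simp add: cell_def)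
  define z where "z = (SOME z. z \<in> rel_interior (cell A a x))"
  have "rel_interior (cell A a x) \<noteq> {}"
    using conv xc rel_interior_eq_empty by blast
  then have z: "z \<in> rel_interior (cell A a x)"
    unfolding z_def some_in_eq .
  then have zc: "z \<in> cell A a x" using rel_interior_subset by blast
  have "max_terms A a z \<subseteq> max_terms A a x"
  proof
    fix w assume w: "w \<in> max_terms A a z"
    have uz: "u \<in> max_terms A a z" using zc u by (auto simp: cell_def)
    have zeq: "?f w z = ?f u z" using w uz by (simp add: max_terms_def)
    obtain e where e: "e > 1" "(1 - e) *\<^sub>R x + e *\<^sub>R z \<in> cell A a x"
      using convex_rel_interior_if2[OF conv z] hull_inc[OF xc] by blast
    let ?y = "(1 - e) *\<^sub>R x + e *\<^sub>R z"
    have "u \<in> max_terms A a ?y" using e u by (auto simp: cell_def)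
    then have "?f w ?y \<le> ?f u ?y"
      using le[of w ?y] w by (auto simp: max_terms_def)
    then have "(1 - e) * (?f w x - ?f u x) + e * (?f w z - ?f u z) \<le> 0"
      by (simp add: inner_add_right algebra_simps)
    then have "(1 - e) * (?f w x - ?f u x) \<le> 0"
      using zeq by simp
    then have "?f u x \<le> ?f w x"
      using e(1) by (simp add: mult_le_0_iff)
    then show "w \<in> max_terms A a x"
      using le[of w x] u w by (auto simp: max_terms_def)
  qed
  then have "max_terms A a z = max_terms A a x"
    using zc by (auto simp: cell_def)
  then show ?thesis
    unfolding dual_face_def z_def[symmetric] by simp
qed

end

theory Submission
  imports Defs
begin

text \<open>
  The surface is cut by the four copies of the curve into closed cells \<open>(\<epsilon>, v)\<close>, one for each
  quadrant \<open>\<epsilon>\<close> and each monomial \<open>v\<close> whose region is nonempty. Since the edges of the Newton polygon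
  have even lattice length, all its vertices are congruent modulo 2 (\<open>polygon_vertices_congruent\<close>).
  Measuring exponents from a vertex \<open>v0\<close>, the signs \<open>\<delta>\<close> extended to the symmetric copies are therefore
  compatible with the gluing of the copies, so that each cell has a sign, and the real part is
  the set of points that lie in cells of both signs (\<open>real_part_eq_wall\<close>).

  Let \<open>K\<close> be a component of the real part. Locally along \<open>K\<close> the positive cells are joined
  to each other off the real part, and so are the negative ones; as \<open>K\<close> and the surface are connected,
  the complement of \<open>K\<close> has at most two components. It has exactly two as soon as
  the cells can be coloured with two colours that change only across \<open>K\<close> (\<open>is_oval_if_coloured\<close>).

  If \<open>K\<close> does not meet the toric boundary, it is a bounded subset of one open quadrant. There the
  real part separates positive from negative regions, and since in the plane a closed set that separates
  two points has a component that does, \<open>K\<close> separates the two sides of each of its points.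
  A bounded side of \<open>K\<close> is one colour class (\<open>inner_component_oval\<close>).

  The hypothesis on twists concerns the components that meet the toric boundary. For every unimodular
  triangle there are a unique reflection \<open>\<epsilon>0\<close> and a unique constant such that, up to that constant, the
  signs of its vertices in the quadrant \<open>\<epsilon>0\<close> follow the pattern of a simple Harnack curve: a vertex
  congruent to \<open>v0\<close> has one sign, all the others have the opposite sign. Two triangles that share an edge
  have the same pattern precisely when the edge is not twisted. The edges around the unbounded regions are
  exposed, so one pattern is valid for all triangles that have a vertex on the boundary of the Newton
  polygon (\<open>outer_pattern\<close>). In each quadrant this pattern singles out one class modulo 2 as the
  minority, and each boundary point \<open>b\<close> is in the minority in exactly one quadrant
  (\<open>outer_minority\<close>). In that quadrant the whole frontier of the region of \<open>b\<close> belongs to the real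
  part; the arcs obtained in this way for consecutive boundary points meet on the toric boundary
  (\<open>one_component_meets_arcs\<close>). So only one component meets the toric boundary, and giving every
  region that is bounded in the plane the majority sign of its quadrant is a colouring for it
  (\<open>boundary_component_oval\<close>).
\<close>

section \<open>Propagation along finite closed covers\<close>

text \<open>The members of the cover that satisfy \<open>P\<close> and those that do not have closed unions, which are
  disjoint on \<open>S\<close>. Most connectedness arguments below are instances: a property passes from one region
  to another through points that they share.\<close>

lemma closed_cover_propagation:
  assumes S: "connectedin X S" and I: "finite I"
    and C: "\<And>i. i \<in> I \<Longrightarrow> closedin X (C i)" and cov: "S \<subseteq> (\<Union>i\<in>I. C i)"
    and step: "\<And>i j x. \<lbrakk>i \<in> I; j \<in> I; x \<in> S; x \<in> C i; x \<in> C j; P i\<rbrakk> \<Longrightarrow> P j"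
    and i: "i \<in> I" "x \<in> S" "x \<in> C i" "P i" and j: "j \<in> I" "y \<in> S" "y \<in> C j"
  shows "P j"
proof (rule ccontr)
  assume nj: "\<not> P j"
  define U where "U = (\<Union>i\<in>{i\<in>I. P i}. C i)"
  define V where "V = (\<Union>i\<in>{i\<in>I. \<not> P i}. C i)"
  have "closedin X U" "closedin X V"
    unfolding U_def V_def using I C by (auto intro!: closedin_Union)
  moreover have "S \<subseteq> U \<union> V" using cov unfolding U_def V_def by blast
  moreover have "U \<inter> V \<inter> S = {}" using step unfolding U_def V_def by blast
  moreover have "x \<in> U \<inter> S" "y \<in> V \<inter> S" using i j nj unfolding U_def V_def by auto
  ultimately show False using S unfolding connectedin_closedin by blast
qed

corollary closed_cover_propagation_euclidean:
  fixes S :: "'a::topological_space set"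
  assumes S: "connected S" and I: "finite I"
    and C: "\<And>i. i \<in> I \<Longrightarrow> closed (C i)" and cov: "S \<subseteq> (\<Union>i\<in>I. C i)"
    and step: "\<And>i j x. \<lbrakk>i \<in> I; j \<in> I; x \<in> S; x \<in> C i; x \<in> C j; P i\<rbrakk> \<Longrightarrow> P j"
    and i: "i \<in> I" "x \<in> S" "x \<in> C i" "P i" and j: "j \<in> I" "y \<in> S" "y \<in> C j"
  shows "P j"
proof -
  have "connectedin euclidean S" using S by simp
  then show ?thesis
    using I _ cov step i j by (rule closed_cover_propagation) (use C in simp)
qed

section \<open>Components of the wall between positive and negative cells\<close>

text \<open>Closed cells \<open>C i\<close> that are closures of connected sets \<open>Opn i\<close>, where each \<open>Opn i\<close> is met by
  no other cell, as in a polyhedral decomposition of a surface. The wall is the set of points at which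
  cells of both signs meet.\<close>

locale signed_cell_cover =
  fixes X :: "'p topology" and I :: "'i set" and C Opn :: "'i \<Rightarrow> 'p set" and s :: "'i \<Rightarrow> bit"
  assumes finite_cells: "finite I"
    and closed_cell: "\<And>i. i \<in> I \<Longrightarrow> closedin X (C i)"
    and cells_cover: "topspace X = (\<Union>i\<in>I. C i)"
    and connected_open_cell: "\<And>i. i \<in> I \<Longrightarrow> connectedin X (Opn i)"
    and open_cell_nonempty: "\<And>i. i \<in> I \<Longrightarrow> Opn i \<noteq> {}"
    and open_cell_subset: "\<And>i. i \<in> I \<Longrightarrow> Opn i \<subseteq> C i"
    and open_cell_dense: "\<And>i. i \<in> I \<Longrightarrow> C i \<subseteq> X closure_of (Opn i)"
    and open_cell_disjoint: "\<And>i j. \<lbrakk>i \<in> I; j \<in> I; i \<noteq> j\<rbrakk> \<Longrightarrow> Opn i \<inter> C j = {}"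
    and connected_total: "connected_space X"
begin

definition wall :: "'p set" where
  "wall = {p. \<exists>i\<in>I. \<exists>j\<in>I. p \<in> C i \<and> p \<in> C j \<and> s i \<noteq> s j}"

text \<open>Whether two open cells lie in the same component of the complement of \<open>K\<close>, phrased without
  reference to components.\<close>

definition linked :: "'p set \<Rightarrow> 'i \<Rightarrow> 'i \<Rightarrow> bool" where
  "linked K i j \<longleftrightarrow> (\<exists>T. connectedin X T \<and> T \<inter> K = {} \<and> Opn i \<subseteq> T \<and> Opn j \<subseteq> T)"

lemma linked_sym: "linked K i j \<Longrightarrow> linked K j i"
  unfolding linked_def by blast

lemma linked_trans:
  assumes "linked K i j" "linked K j k" "j \<in> I"
  shows "linked K i k"
proof -
  obtain S T where ST: "connectedin X S" "S \<inter> K = {}" "Opn i \<subseteq> S" "Opn j \<subseteq> S"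
      "connectedin X T" "T \<inter> K = {}" "Opn j \<subseteq> T" "Opn k \<subseteq> T"
    using assms unfolding linked_def by blast
  have "S \<inter> T \<noteq> {}" using ST open_cell_nonempty[OF \<open>j \<in> I\<close>] by blast
  then have "connectedin X (S \<union> T)" using ST connectedin_Un by blast
  then show ?thesis unfolding linked_def using ST by (intro exI[of _ "S \<union> T"]) auto
qed

lemma connected_insert_open_cell:
  assumes "i \<in> I" "p \<in> C i"
  shows "connectedin X (insert p (Opn i))"
proof (rule connectedin_intermediate_closure_of[OF connected_open_cell[OF assms(1)]])
  have "Opn i \<subseteq> X closure_of Opn i"
    using closure_of_subset connected_open_cell[OF assms(1)] connectedin_subset_topspace by metis
  then show "insert p (Opn i) \<subseteq> X closure_of Opn i"
    using open_cell_dense[OF assms(1)] assms(2) by blast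
qed blast

lemma open_cell_wall:
  assumes "i \<in> I"
  shows "Opn i \<inter> wall = {}"
  using assms open_cell_disjoint unfolding wall_def by blast

lemma linked_if_meet:
  assumes "i \<in> I" "j \<in> I" "p \<in> C i" "p \<in> C j" "p \<notin> K" "K \<subseteq> wall"
  shows "linked K i j"
proof -
  have "connectedin X (insert p (Opn i) \<union> insert p (Opn j))"
    using connected_insert_open_cell assms by (intro connectedin_Un) auto
  moreover have "Opn i \<inter> K = {}" "Opn j \<inter> K = {}" using open_cell_wall assms by blast+
  ultimately show ?thesis unfolding linked_def using assms
    by (intro exI[of _ "insert p (Opn i) \<union> insert p (Opn j)"]) auto
qed

text \<open>At a point of the wall, cells of equal sign are linked off the wall by assumption. Hence the
  component of the complement that contains the positive cells at a point of \<open>K\<close> is locally constant along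
  \<open>K\<close>, likewise for the negative cells, so all cells that touch \<open>K\<close> are linked to one of two cells. Since
  the surface is connected this extends to all cells, which gives at most two components. Cells of
  different colour cannot be linked, which gives at least two.\<close>

theorem is_oval_if_coloured:
  assumes link: "\<And>p i j. \<lbrakk>p \<in> wall; i \<in> I; j \<in> I; p \<in> C i; p \<in> C j; s i = s j\<rbrakk>
                   \<Longrightarrow> \<exists>q. q \<in> C i \<and> q \<in> C j \<and> q \<notin> wall"
    and K: "K \<in> connected_components_of (subtopology X wall)"
    and col: "\<And>p i j. \<lbrakk>i \<in> I; j \<in> I; p \<in> C i; p \<in> C j; \<kappa> i \<noteq> \<kappa> j\<rbrakk> \<Longrightarrow> p \<in> K"
    and ab: "a \<in> I" "b \<in> I" "\<kappa> a \<noteq> \<kappa> b"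
  shows "is_oval X K"
proof -
  have K_conn: "connectedin X K" and KR: "K \<subseteq> wall" and K_ne: "K \<noteq> {}"
    using connectedin_connected_components_of[OF K] connected_components_of_subset[OF K]
      nonempty_connected_components_of[OF K] by (auto simp: connectedin_subtopology)
  let ?Y = "subtopology X (topspace X - K)"
  define D where "D i = connected_component_of_set ?Y (SOME x. x \<in> Opn i)" for i
  have some: "(SOME x. x \<in> Opn i) \<in> Opn i" if "i \<in> I" for i
    using open_cell_nonempty[OF that] some_in_eq by blast
  have inY: "Opn i \<subseteq> topspace X - K" if "i \<in> I" for i
    using open_cell_wall[OF that] KR connected_open_cell[OF that] connectedin_subset_topspace by blast
  have "connectedin ?Y (D i)" for i unfolding D_def by (rule connectedin_connected_component_of)
  then have D_conn: "connectedin X (D i)" "D i \<inter> K = {}" for i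
    unfolding connectedin_subtopology by blast+
  have D_sup: "T \<subseteq> D i" if "connectedin X T" "T \<inter> K = {}" "T \<inter> Opn i \<noteq> {}" "i \<in> I" for T i
  proof -
    have "connectedin X (T \<union> Opn i)" using connectedin_Un connected_open_cell that by blast
    moreover have "(T \<union> Opn i) \<subseteq> topspace X - K"
      using inY[OF that(4)] that(1,2) connectedin_subset_topspace by blast
    ultimately have "connectedin ?Y (T \<union> Opn i)" by (simp add: connectedin_subtopology)
    then have "T \<union> Opn i \<subseteq> D i" unfolding D_def
      by (rule connected_component_of_maximal) (use some[OF that(4)] in blast)
    then show ?thesis by blast
  qed
  have Oi_D: "Opn i \<subseteq> D i" if "i \<in> I" for i
    using D_sup[OF connected_open_cell[OF that]] inY[OF that] open_cell_nonempty[OF that] that by blast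
  have D_eq: "D i = D j" if "linked K i j" "i \<in> I" "j \<in> I" for i j
  proof -
    have "D a \<subseteq> D b" if l: "linked K a b" "a \<in> I" "b \<in> I" for a b
    proof -
      obtain T where T: "connectedin X T" "T \<inter> K = {}" "Opn a \<subseteq> T" "Opn b \<subseteq> T"
        using l unfolding linked_def by blast
      have "D a \<inter> T \<noteq> {}" using Oi_D[OF l(2)] T open_cell_nonempty[OF l(2)] by blast
      then have "connectedin X (D a \<union> T)" using D_conn T connectedin_Un by blast
      moreover have "(D a \<union> T) \<inter> K = {}" using D_conn T by blast
      moreover have "(D a \<union> T) \<inter> Opn b \<noteq> {}" using T open_cell_nonempty[OF l(3)] by blast
      ultimately show ?thesis using D_sup[OF _ _ _ l(3)] by blast
    qed
    then show ?thesis using that linked_sym by blast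
  qed
  \<comment> \<open>\<open>K\<close> is covered by the intersections of two cells of opposite sign; the property to be propagated
    is that both of them are linked to the right side.\<close>
  define J where "J = {(i,j). i \<in> I \<and> j \<in> I \<and> s i \<noteq> s j}"
  have J_fin: "finite J" unfolding J_def
    by (rule finite_subset[of _ "I \<times> I"]) (use finite_cells in auto)
  obtain p0 where "p0 \<in> K" using K_ne by blast
  then obtain i0 j0 where ij0: "i0 \<in> I" "j0 \<in> I" "p0 \<in> C i0" "p0 \<in> C j0" "s i0 \<noteq> s j0"
    using KR unfolding wall_def by blast
  define good where "good i \<longleftrightarrow> linked K i (if s i = s i0 then i0 else j0)" for i
  have same: "good j" if h: "good i" "i \<in> I" "j \<in> I" "p \<in> K" "p \<in> C i" "p \<in> C j" "s i = s j" for i j p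
  proof -
    obtain q where q: "q \<in> C i" "q \<in> C j" "q \<notin> wall"
      using link[of p i j] h KR by blast
    then have "linked K j i" using linked_if_meet[of j i q K] h KR by blast
    then show ?thesis using h linked_trans unfolding good_def by metis
  qed
  have refl: "linked K i i" if "i \<in> I" for i
    using connected_open_cell[OF that] inY[OF that] unfolding linked_def by blast
  have bit2: "x = y \<or> x = z" if "y \<noteq> z" for x y z :: bit using that by (cases x; cases y; cases z) auto
  have touching: "good i" if i: "i \<in> I" "p \<in> C i" "p \<in> K" for i p
  proof -
    have "p \<in> wall" using i KR by blast
    then obtain u v where uv: "(u, v) \<in> J" "p \<in> C u" "p \<in> C v"
      unfolding wall_def J_def by blast
    have "case (u, v) of (u, v) \<Rightarrow> good u \<and> good v"
    proof (rule closed_cover_propagation[OF K_conn J_fin, of "\<lambda>(u,v). C u \<inter> C v" _ "(i0,j0)" p0 "(u,v)" p])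
      fix k assume "k \<in> J"
      then show "closedin X (case k of (u, v) \<Rightarrow> C u \<inter> C v)"
        using closed_cell unfolding J_def by auto
    next
      show "K \<subseteq> (\<Union>k\<in>J. case k of (u, v) \<Rightarrow> C u \<inter> C v)"
        using KR unfolding wall_def J_def by fastforce
    next
      fix k l x
      assume *: "k \<in> J" "l \<in> J" "x \<in> K" "x \<in> (case k of (u, v) \<Rightarrow> C u \<inter> C v)"
        "x \<in> (case l of (u, v) \<Rightarrow> C u \<inter> C v)" "case k of (u, v) \<Rightarrow> good u \<and> good v"
      obtain u v w z where kl: "k = (u, v)" "l = (w, z)" by fastforce
      have uv: "u \<in> I" "v \<in> I" "s u \<noteq> s v" "x \<in> C u" "x \<in> C v" "good u" "good v"
        and wz: "w \<in> I" "z \<in> I" "x \<in> C w" "x \<in> C z"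
        using * unfolding kl J_def by simp_all
      have "good m" if m: "m \<in> I" "x \<in> C m" for m
        using bit2[OF uv(3), of "s m"] same[OF uv(6,1) m(1) *(3) uv(4) m(2)]
          same[OF uv(7,2) m(1) *(3) uv(5) m(2)] by metis
      then show "case l of (u, v) \<Rightarrow> good u \<and> good v" using wz unfolding kl by simp
    next
      show "case (i0, j0) of (u, v) \<Rightarrow> good u \<and> good v"
        using ij0 refl unfolding good_def by auto
    next
      show "(i0, j0) \<in> J" using ij0 unfolding J_def by simp
      show "p0 \<in> (case (i0, j0) of (u, v) \<Rightarrow> C u \<inter> C v)" using ij0 by simp
      show "p \<in> (case (u, v) of (u, v) \<Rightarrow> C u \<inter> C v)" using uv by simp
    qed (fact \<open>p0 \<in> K\<close> uv(1) i(3))+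
    then have gg: "good u" "good v" by simp_all
    have "u \<in> I" "v \<in> I" "s u \<noteq> s v" using uv(1) unfolding J_def by simp_all
    then show ?thesis
      using bit2[of "s u" "s v" "s i"] same[OF gg(1) _ i(1,3) uv(2) i(2)]
        same[OF gg(2) _ i(1,3) uv(3) i(2)] by metis
  qed
  have all: "linked K i i0 \<or> linked K i j0" if i: "i \<in> I" for i
  proof -
    obtain p where p: "p \<in> Opn i" using open_cell_nonempty[OF i] by blast
    have inX: "p \<in> topspace X" "p0 \<in> topspace X"
      using p i open_cell_subset cells_cover ij0 by blast+
    show ?thesis
    proof (rule closed_cover_propagation[of X "topspace X" I C
          "\<lambda>i. linked K i i0 \<or> linked K i j0" i0 p0 i p])
      fix k l x assume *: "k \<in> I" "l \<in> I" "x \<in> topspace X" "x \<in> C k" "x \<in> C l" "linked K k i0 \<or> linked K k j0"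
      show "linked K l i0 \<or> linked K l j0"
      proof (cases "x \<in> K")
        case True
        then show ?thesis using touching[of l x] * unfolding good_def by (auto split: if_splits)
      next
        case False
        then have "linked K l k" using linked_if_meet[of l k x K] * KR by blast
        then show ?thesis using * linked_trans by blast
      qed
    next
      show "p \<in> C i" using p i open_cell_subset by blast
      show "connectedin X (topspace X)" using connected_total by (simp add: connectedin_topspace)
      show "topspace X \<subseteq> (\<Union>i\<in>I. C i)" using cells_cover by simp
      show "linked K i0 i0 \<or> linked K i0 j0" using refl ij0 by blast
    qed (use finite_cells closed_cell ij0 inX i in blast)+
  qed
  have comps: "connected_components_of ?Y = {D i0, D j0}"
  proof
    show "connected_components_of ?Y \<subseteq> {D i0, D j0}"
    proof
      fix E assume E: "E \<in> connected_components_of ?Y"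
      obtain p where p: "p \<in> E" using nonempty_connected_components_of[OF E] by blast
      have pY: "p \<in> topspace X - K" using p connected_components_of_subset[OF E] by auto
      then obtain i where i: "i \<in> I" "p \<in> C i" using cells_cover by blast
      have "insert p (Opn i) \<subseteq> D i"
        by (rule D_sup) (use connected_insert_open_cell[OF i] pY inY[OF i(1)]
            open_cell_nonempty[OF i(1)] i in auto)
      moreover have Dc: "D i \<in> connected_components_of ?Y"
        unfolding D_def connected_components_of_def using some[OF i(1)] inY[OF i(1)] by auto
      ultimately have "E = D i"
        using pairwise_disjoint_connected_components_of[of ?Y] E p
        unfolding pairwise_def disjnt_def by blast
      then show "E \<in> {D i0, D j0}" using all[OF i(1)] D_eq i(1) ij0 by blast
    qed
    show "{D i0, D j0} \<subseteq> connected_components_of ?Y"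
      unfolding D_def connected_components_of_def using some inY ij0 by auto
  qed
  have "D a \<noteq> D b"
  proof
    assume eq: "D a = D b"
    obtain x y where xy: "x \<in> Opn a" "y \<in> Opn b" using open_cell_nonempty ab by blast
    have "\<kappa> b = \<kappa> a"
    proof (rule closed_cover_propagation[of X "D a" I C "\<lambda>i. \<kappa> i = \<kappa> a" a x b y])
      show "D a \<subseteq> (\<Union>i\<in>I. C i)"
        using D_conn(1)[of a] connectedin_subset_topspace cells_cover by blast
    next
      fix i j z assume "i \<in> I" "j \<in> I" "z \<in> D a" "z \<in> C i" "z \<in> C j" "\<kappa> i = \<kappa> a"
      then show "\<kappa> j = \<kappa> a" using col[of i j z] D_conn(2)[of a] by auto
    next
      show "connectedin X (D a)" by (rule D_conn)
      show "x \<in> D a" "y \<in> D a" using xy Oi_D[OF ab(1)] Oi_D[OF ab(2)] eq by auto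
      show "x \<in> C a" "y \<in> C b" using xy open_cell_subset ab by blast+
    qed (use finite_cells closed_cell ab in auto)
    then show False using ab by simp
  qed
  moreover have "D a \<in> {D i0, D j0}" "D b \<in> {D i0, D j0}"
    using all[OF ab(1)] all[OF ab(2)] D_eq ab ij0 by blast+
  ultimately have "D i0 \<noteq> D j0" by auto
  then show ?thesis unfolding is_oval_def comps by simp
qed

end

section \<open>Dominant terms of a tropical polynomial\<close>

abbreviation term_val :: "(int^2 \<Rightarrow> real) \<Rightarrow> int^2 \<Rightarrow> real^2 \<Rightarrow> real" where
  "term_val a v x \<equiv> a v + pt v \<bullet> x"

lemma inner_2: "x \<bullet> y = x $ 1 * y $ 1 + x $ 2 * y $ (2::2)" for x y :: "real^2"
  by (simp add: inner_vec_def sum_2)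

lemma pt_nth [simp]: "pt v $ i = real_of_int (v $ i)"
  by (simp add: pt_def)

lemma pt_diff: "pt (u - v) = pt u - pt v"
  by (simp add: vec_eq_iff)

lemma pt_inject [simp]: "pt u = pt v \<longleftrightarrow> u = v"
  by (simp add: vec_eq_iff)

lemma mem_max_terms:
  assumes "finite B"
  shows "v \<in> max_terms B a x \<longleftrightarrow> v \<in> B \<and> (\<forall>u\<in>B. term_val a u x \<le> term_val a v x)"
proof (cases "v \<in> B")
  case True
  have "trop_poly B a x = term_val a v x \<longleftrightarrow> (\<forall>u\<in>B. term_val a u x \<le> term_val a v x)"
    unfolding trop_poly_def using assms True
    by (subst Max_eq_iff) auto
  then show ?thesis unfolding max_terms_def using True by simp
qed (simp add: max_terms_def)

lemma max_terms_nonempty: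
  assumes "finite B" "B \<noteq> {}"
  shows "max_terms B a x \<noteq> {}"
proof -
  have "trop_poly B a x \<in> (\<lambda>v. term_val a v x) ` B"
    unfolding trop_poly_def using assms by (intro Max_in) auto
  then show ?thesis unfolding max_terms_def by auto
qed

lemma max_terms_subset: "max_terms B a x \<subseteq> B"
  by (auto simp: max_terms_def)

lemma max_terms_region:
  assumes "finite B"
  shows "{x. v \<in> max_terms B a x} =
    (if v \<in> B then (\<Inter>u\<in>B. {x. (pt u - pt v) \<bullet> x \<le> a v - a u}) else {})"
  using mem_max_terms[OF assms] by (auto simp: inner_diff_left algebra_simps)

lemma closed_region: "finite B \<Longrightarrow> closed {x. v \<in> max_terms B a x}"
  unfolding max_terms_region by (auto intro!: closed_INT closed_halfspace_le)

lemma convex_region: "finite B \<Longrightarrow> convex {x. v \<in> max_terms B a x}"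
  unfolding max_terms_region by (auto intro!: convex_INT convex_halfspace_le)

lemma max_terms_tie:
  assumes "finite B" "u \<in> max_terms B a x" "v \<in> max_terms B a x"
  shows "term_val a u x = term_val a v x"
  using assms by (auto simp: mem_max_terms intro: antisym)

text \<open>After a small displacement in direction \<open>d\<close>, only terms that were dominant can still be
  dominant, and among these the slope in direction \<open>d\<close> decides.\<close>

lemma max_terms_perturb:
  assumes B: "finite B" "B \<noteq> {}"
  shows "\<forall>\<^sub>F s in at_right 0. max_terms B a (x + s *\<^sub>R d) =
           {y \<in> max_terms B a x. \<forall>z\<in>max_terms B a x. pt z \<bullet> d \<le> pt y \<bullet> d}"
proof -
  let ?M = "max_terms B a x"
  have M: "?M \<noteq> {}" "finite ?M" using max_terms_nonempty[OF B] finite_subset[OF max_terms_subset B(1)] by auto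
  have "Max ((\<lambda>y. pt y \<bullet> d) ` ?M) \<in> (\<lambda>y. pt y \<bullet> d) ` ?M" using M by (intro Max_in) auto
  then obtain z where z: "z \<in> ?M" "Max ((\<lambda>y. pt y \<bullet> d) ` ?M) = pt z \<bullet> d" by (elim imageE) simp
  have z: "z \<in> ?M" "\<And>y. y \<in> ?M \<Longrightarrow> pt y \<bullet> d \<le> pt z \<bullet> d"
    using z M(2) by (auto simp: z(2)[symmetric])
  have "\<forall>\<^sub>F s in at_right 0. term_val a y (x + s *\<^sub>R d) < term_val a z (x + s *\<^sub>R d)" if "y \<in> B - ?M" for y
  proof -
    have lt: "term_val a y x < term_val a z x"
    proof -
      have "term_val a y x \<le> term_val a z x" using z(1) that B mem_max_terms by blast
      moreover have "term_val a y x \<noteq> term_val a z x"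
      proof
        assume "term_val a y x = term_val a z x"
        then have "y \<in> ?M" using z(1) that B by (auto simp: mem_max_terms)
        then show False using that by blast
      qed
      ultimately show ?thesis by simp
    qed
    have "((\<lambda>s. term_val a z (x + s *\<^sub>R d) - term_val a y (x + s *\<^sub>R d)) \<longlongrightarrow>
        term_val a z (x + 0 *\<^sub>R d) - term_val a y (x + 0 *\<^sub>R d)) (at_right 0)"
      by (intro tendsto_intros)
    then have "\<forall>\<^sub>F s in at_right 0. 0 < term_val a z (x + s *\<^sub>R d) - term_val a y (x + s *\<^sub>R d)"
      using lt by (intro order_tendstoD) auto
    then show ?thesis by eventually_elim simp
  qed
  then have "\<forall>\<^sub>F s in at_right 0. \<forall>y\<in>B - ?M. term_val a y (x + s *\<^sub>R d) < term_val a z (x + s *\<^sub>R d)"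
    using B by (intro eventually_ball_finite) auto
  moreover have "\<forall>\<^sub>F s in at_right (0::real). s > 0"
    by (simp add: eventually_at_right_less)
  ultimately show ?thesis
  proof eventually_elim
    case (elim s)
    have val: "term_val a y (x + s *\<^sub>R d) = term_val a z x + s * (pt y \<bullet> d)" if "y \<in> ?M" for y
      using max_terms_tie[OF B(1) that z(1)] by (simp add: inner_add_right)
    have zB: "z \<in> B" using z(1) max_terms_subset by blast
    have key: "term_val a u (x + s *\<^sub>R d) \<le> term_val a z (x + s *\<^sub>R d)" if "u \<in> B" for u
    proof (cases "u \<in> ?M")
      case True
      then show ?thesis unfolding val[OF True] val[OF z(1)] using z(2)[OF True] elim(2) by simp
    next
      case False then show ?thesis using elim that by (auto intro: less_imp_le)
    qed
    show ?case
    proof (intro set_eqI iffI)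
      fix y assume y: "y \<in> max_terms B a (x + s *\<^sub>R d)"
      then have yB: "y \<in> B" and ge: "term_val a z (x + s *\<^sub>R d) \<le> term_val a y (x + s *\<^sub>R d)"
        using B zB by (auto simp: mem_max_terms)
      have yM: "y \<in> ?M" using elim(1) yB ge by (metis DiffI leD)
      then have "pt z \<bullet> d \<le> pt y \<bullet> d" using ge elim(2) unfolding val[OF yM] val[OF z(1)] by simp
      then show "y \<in> {y \<in> ?M. \<forall>z\<in>?M. pt z \<bullet> d \<le> pt y \<bullet> d}" using yM z(2) by fastforce
    next
      fix y assume "y \<in> {y \<in> ?M. \<forall>z\<in>?M. pt z \<bullet> d \<le> pt y \<bullet> d}"
      then have yM: "y \<in> ?M" and "pt z \<bullet> d \<le> pt y \<bullet> d" using z(1) by auto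
      then have "term_val a z (x + s *\<^sub>R d) \<le> term_val a y (x + s *\<^sub>R d)"
        unfolding val[OF yM] val[OF z(1)] using elim(2) by simp
      then show "y \<in> max_terms B a (x + s *\<^sub>R d)"
        using key yM B max_terms_subset unfolding mem_max_terms[OF B(1)] by (blast intro: order_trans)
    qed
  qed
qed

text \<open>Far out in a direction in which the exponents of \<open>G\<close> have the same, maximal slope, the terms
  outside \<open>G\<close> become negligible while those of \<open>G\<close> keep their relative order. This is how points of
  the boundary strata are seen from the plane.\<close>

lemma max_terms_towards:
  assumes A: "finite A" and G: "G \<subseteq> A" "G \<noteq> {}"
    and d: "\<And>p q. \<lbrakk>p \<in> G; q \<in> G\<rbrakk> \<Longrightarrow> pt p \<bullet> d = pt q \<bullet> d"
      "\<And>p q. \<lbrakk>p \<in> G; q \<in> A - G\<rbrakk> \<Longrightarrow> pt q \<bullet> d < pt p \<bullet> d"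
  shows "\<forall>\<^sub>F t in at_top. max_terms A a (x + t *\<^sub>R d) = max_terms G a x"
proof -
  have fG: "finite G" using A G finite_subset by blast
  have "\<forall>\<^sub>F t in at_top. term_val a q (x + t *\<^sub>R d) < term_val a p (x + t *\<^sub>R d)"
    if "p \<in> G" "q \<in> A - G" for p q
  proof -
    have pos: "pt p \<bullet> d - pt q \<bullet> d > 0" using d(2) that by simp
    have "\<forall>\<^sub>F t in at_top. t > (term_val a q x - term_val a p x) / (pt p \<bullet> d - pt q \<bullet> d)"
      by (rule eventually_gt_at_top)
    then show ?thesis
    proof eventually_elim
      case (elim t)
      then have "term_val a q x - term_val a p x < t * (pt p \<bullet> d - pt q \<bullet> d)"
        using pos by (simp add: pos_divide_less_eq)
      then show ?case by (simp add: inner_add_right algebra_simps)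
    qed
  qed
  then have "\<forall>\<^sub>F t in at_top. \<forall>p\<in>G. \<forall>q\<in>A - G. term_val a q (x + t *\<^sub>R d) < term_val a p (x + t *\<^sub>R d)"
    using A fG by (intro eventually_ball_finite ballI) auto
  then show ?thesis
  proof eventually_elim
    case (elim t)
    have same: "term_val a p (x + t *\<^sub>R d) \<le> term_val a q (x + t *\<^sub>R d) \<longleftrightarrow> term_val a p x \<le> term_val a q x"
      if "p \<in> G" "q \<in> G" for p q
      using d(1)[OF that] by (simp add: inner_add_right)
    show ?case
    proof (intro set_eqI iffI)
      fix v assume "v \<in> max_terms A a (x + t *\<^sub>R d)"
      then have v: "v \<in> A" "\<And>u. u \<in> A \<Longrightarrow> term_val a u (x + t *\<^sub>R d) \<le> term_val a v (x + t *\<^sub>R d)"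
        using A by (auto simp: mem_max_terms)
      have vG: "v \<in> G"
      proof (rule ccontr)
        assume "v \<notin> G"
        obtain p where "p \<in> G" using G by blast
        then have "p \<in> A" "v \<in> A - G" using G v(1) \<open>v \<notin> G\<close> by blast+
        then show False using elim \<open>p \<in> G\<close> v(2)[of p] by (meson not_le)
      qed
      then show "v \<in> max_terms G a x"
        unfolding mem_max_terms[OF fG] using v(2) same G by blast
    next
      fix v assume "v \<in> max_terms G a x"
      then have v: "v \<in> G" "\<And>u. u \<in> G \<Longrightarrow> term_val a u x \<le> term_val a v x"
        using fG by (auto simp: mem_max_terms)
      have "term_val a u (x + t *\<^sub>R d) \<le> term_val a v (x + t *\<^sub>R d)" if "u \<in> A" for u
        using same v elim that by (cases "u \<in> G") (auto intro: less_imp_le)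
      then show "v \<in> max_terms A a (x + t *\<^sub>R d)"
        unfolding mem_max_terms[OF A] using v G by blast
    qed
  qed
qed

section \<open>Unimodular triangles\<close>

definition unimodular_triple :: "int^2 \<Rightarrow> int^2 \<Rightarrow> int^2 \<Rightarrow> bool" where
  "unimodular_triple u v w \<longleftrightarrow>
     \<bar>(v$1 - u$1) * (w$2 - u$2) - (w$1 - u$1) * (v$2 - u$2)\<bar> = 1"

lemma unimodular_triple_functional:
  assumes "unimodular_triple u v w"
  obtains d where "(pt v - pt u) \<bullet> d = p" "(pt w - pt u) \<bullet> d = q"
proof -
  define v1 v2 w1 w2 where "v1 = real_of_int (v$1 - u$1)" and "v2 = real_of_int (v$2 - u$2)"
    and "w1 = real_of_int (w$1 - u$1)" and "w2 = real_of_int (w$2 - u$2)"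
  note defs = this
  define D where "D = v1 * w2 - w1 * v2"
  have "D = real_of_int ((v$1 - u$1) * (w$2 - u$2) - (w$1 - u$1) * (v$2 - u$2))"
    unfolding D_def defs by simp
  then have D: "D \<noteq> 0" using assms unfolding unimodular_triple_def by linarith
  define d :: "real^2" where "d = vector [(p * w2 - q * v2) / D, (q * v1 - p * w1) / D]"
  have d: "d $ 1 = (p * w2 - q * v2) / D" "d $ 2 = (q * v1 - p * w1) / D"
    unfolding d_def by (simp_all add: vector_2)
  have co: "(pt v - pt u) $ 1 = v1" "(pt v - pt u) $ 2 = v2" "(pt w - pt u) $ 1 = w1" "(pt w - pt u) $ 2 = w2"
    unfolding defs by simp_all
  have "v1 * (p * w2 - q * v2) + v2 * (q * v1 - p * w1) = p * D"
    "w1 * (p * w2 - q * v2) + w2 * (q * v1 - p * w1) = q * D"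
    unfolding D_def by (simp_all add: algebra_simps)
  then have "(pt v - pt u) \<bullet> d = p * D / D" "(pt w - pt u) \<bullet> d = q * D / D"
    unfolding inner_2 co d times_divide_eq_right add_divide_distrib[symmetric] by presburger+
  then show ?thesis using D that by simp
qed

text \<open>An affine function takes arbitrary values on the vertices of a triangle, in particular the
  indicator of \<open>T\<close>.\<close>

lemma unimodular_triple_select:
  assumes "unimodular_triple u v w" "M \<subseteq> {u, v, w}" "T \<subseteq> M" "T \<noteq> {}"
  obtains d where "{y \<in> M. \<forall>z\<in>M. pt z \<bullet> d \<le> pt y \<bullet> d} = T"
proof -
  define h :: "int^2 \<Rightarrow> real" where "h y = of_bool (y \<in> T)" for y
  obtain d where d: "(pt v - pt u) \<bullet> d = h v - h u" "(pt w - pt u) \<bullet> d = h w - h u"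
    using unimodular_triple_functional[OF assms(1)] by blast
  have eq: "pt y \<bullet> d = h y + (pt u \<bullet> d - h u)" if "y \<in> M" for y
    using that assms(2) d by (auto simp: inner_diff_left)
  have "{y \<in> M. \<forall>z\<in>M. pt z \<bullet> d \<le> pt y \<bullet> d} = {y \<in> M. \<forall>z\<in>M. h z \<le> h y}"
    using eq by (intro Collect_cong) auto
  also have "\<dots> = T"
    using assms(3,4) by (force simp: h_def)
  finally show ?thesis by (rule that)
qed

lemma unimodular_triangle_lattice_points:
  assumes uni: "unimodular_triple u v w" and y: "pt y \<in> convex hull {pt u, pt v, pt w}"
  shows "y \<in> {u, v, w}"
proof -
  define D where "D = (v$1 - u$1) * (w$2 - u$2) - (w$1 - u$1) * (v$2 - u$2)"
  have D: "D = 1 \<or> D = -1" using uni unfolding D_def unimodular_triple_def by linarith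
  obtain \<alpha> \<beta> \<gamma> where c: "pt y = \<alpha> *\<^sub>R pt u + \<beta> *\<^sub>R pt v + \<gamma> *\<^sub>R pt w"
    "0 \<le> \<alpha>" "0 \<le> \<beta>" "0 \<le> \<gamma>" "\<alpha> + \<beta> + \<gamma> = 1"
    using y unfolding convex_hull_3 by blast
  have al: "\<alpha> = 1 - \<beta> - \<gamma>" using c(5) by simp
  have y1: "real_of_int (y$1 - u$1) = \<beta> * (v$1 - u$1) + \<gamma> * (w$1 - u$1)"
    using arg_cong[OF c(1), of "\<lambda>z. z $ 1"] unfolding al by (simp add: algebra_simps)
  have y2: "real_of_int (y$2 - u$2) = \<beta> * (v$2 - u$2) + \<gamma> * (w$2 - u$2)"
    using arg_cong[OF c(1), of "\<lambda>z. z $ 2"] unfolding al by (simp add: algebra_simps)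
  define b where "b = D * ((y$1 - u$1) * (w$2 - u$2) - (w$1 - u$1) * (y$2 - u$2))"
  define g where "g = D * ((v$1 - u$1) * (y$2 - u$2) - (y$1 - u$1) * (v$2 - u$2))"
  have DD: "real_of_int (D * D) = 1" using D by auto
  \<comment> \<open>The barycentric coordinates are quotients of integers by \<open>D\<close> (Cramer's rule), hence integers.\<close>
  have "real_of_int b = \<beta> * real_of_int (D * D)"
    unfolding b_def of_int_mult of_int_diff[of "_ * _"] y1 y2 unfolding D_def
    by (simp add: algebra_simps)
  then have b: "\<beta> = real_of_int b" using DD by simp
  have "real_of_int g = \<gamma> * real_of_int (D * D)"
    unfolding g_def of_int_mult of_int_diff[of "_ * _"] y1 y2 unfolding D_def
    by (simp add: algebra_simps)
  then have g: "\<gamma> = real_of_int g" using DD by simp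
  have "0 \<le> b" "0 \<le> g" using c(3,4) b g by simp_all
  moreover have "real_of_int (b + g) \<le> 1" using c(2,5) b g by simp
  then have "b + g \<le> 1" by linarith
  ultimately have "(b = 0 \<and> g = 0) \<or> (b = 1 \<and> g = 0) \<or> (b = 0 \<and> g = 1)" by linarith
  then have "pt y = pt u \<or> pt y = pt v \<or> pt y = pt w"
    using c(1) b g al by auto
  then show ?thesis by simp
qed

text \<open>\<open>full_dim\<close> expresses that the Newton polygon is two-dimensional.\<close>

locale tropical_polynomial =
  fixes A :: "(int^2) set" and a :: "int^2 \<Rightarrow> real"
  assumes finite_support: "finite A" and support_nonempty: "A \<noteq> {}"
    and full_dim: "\<And>d::real^2. (\<And>u v. \<lbrakk>u \<in> A; v \<in> A\<rbrakk> \<Longrightarrow> pt u \<bullet> d = pt v \<bullet> d) \<Longrightarrow> d = 0"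
begin

abbreviation M :: "real^2 \<Rightarrow> (int^2) set" where "M x \<equiv> max_terms A a x"

lemma finite_M: "finite (M x)"
  using finite_support max_terms_subset finite_subset by metis

text \<open>Choose \<open>x'\<close> with as many dominant terms as possible. If these lay on a line, one could move
  perpendicularly to that line, keeping all of them dominant, until a further term catches up.\<close>

lemma max_terms_above:
  obtains x' where "M x \<subseteq> M x'" "\<And>d. (\<And>u v. \<lbrakk>u \<in> M x'; v \<in> M x'\<rbrakk> \<Longrightarrow> pt u \<bullet> d = pt v \<bullet> d) \<Longrightarrow> d = 0"
proof -
  let ?P = "\<lambda>n. \<exists>x'. M x \<subseteq> M x' \<and> card (M x') = n"
  have "?P (card (M x))" by blast
  moreover have "\<forall>n. ?P n \<longrightarrow> n \<le> card A"
    using card_mono[OF finite_support max_terms_subset] by blast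
  ultimately have "\<exists>n. ?P n \<and> (\<forall>m. ?P m \<longrightarrow> m \<le> n)" by (rule Nat.ex_has_greatest_nat[of ?P])
  then obtain n x' where n: "\<forall>m. ?P m \<longrightarrow> m \<le> n" and x': "M x \<subseteq> M x'" "card (M x') = n"
    by (elim exE conjE)
  have "d = 0" if const: "\<And>u v. \<lbrakk>u \<in> M x'; v \<in> M x'\<rbrakk> \<Longrightarrow> pt u \<bullet> d = pt v \<bullet> d" for d
  proof (rule ccontr)
    assume d0: "d \<noteq> 0"
    obtain v where v: "v \<in> M x'" using max_terms_nonempty[OF finite_support support_nonempty] by blast
    then have vA: "v \<in> A" using max_terms_subset by blast
    have "\<exists>u\<in>A. pt v \<bullet> d \<noteq> pt u \<bullet> d"
    proof (rule ccontr)
      assume "\<not> ?thesis"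
      then have "pt u \<bullet> d = pt w \<bullet> d" if "u \<in> A" "w \<in> A" for u w using that by (metis (no_types))
      then show False using full_dim[of d] d0 by blast
    qed
    then obtain u1 where u1: "u1 \<in> A" "pt v \<bullet> d < pt u1 \<bullet> d \<or> pt v \<bullet> (- d) < pt u1 \<bullet> (- d)"
      by (auto simp: neq_iff)
    obtain e where e: "\<exists>u\<in>A. pt u \<bullet> e > pt v \<bullet> e" "e = d \<or> e = - d"
      using u1(2)
    proof
      assume "pt v \<bullet> d < pt u1 \<bullet> d"
      then show thesis using that[of d] u1(1) by blast
    next
      assume "pt v \<bullet> (- d) < pt u1 \<bullet> (- d)"
      then show thesis using that[of "- d"] u1(1) by blast
    qed
    have conste: "pt u \<bullet> e = pt w \<bullet> e" if "u \<in> M x'" "w \<in> M x'" for u w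
      using const[OF that] e(2) by auto
    define Q where "Q = {u\<in>A. pt u \<bullet> e > pt v \<bullet> e}"
    have Q: "finite Q" "Q \<noteq> {}" using e(1) finite_support unfolding Q_def by auto
    \<comment> \<open>\<open>f u\<close> is the time at which the term \<open>u\<close> catches up with the dominant ones.\<close>
    define f where "f u = (term_val a v x' - term_val a u x') / (pt u \<bullet> e - pt v \<bullet> e)" for u
    define t where "t = Min (f ` Q)"
    obtain u0 where u0: "u0 \<in> Q" "t = f u0"
      using Min_in[of "f ` Q"] Q unfolding t_def by blast
    have tle: "t \<le> f u" if "u \<in> Q" for u using Q that unfolding t_def by simp
    have vmax: "term_val a u x' \<le> term_val a v x'" if "u \<in> A" for u
      using v that finite_support by (auto simp: mem_max_terms)
    have t0: "0 \<le> t" unfolding u0(2) f_def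
      using u0(1) vmax unfolding Q_def by (auto intro!: divide_nonneg_pos)
    have le: "term_val a u (x' + t *\<^sub>R e) \<le> term_val a v (x' + t *\<^sub>R e)" if "u \<in> A" for u
    proof (cases "u \<in> Q")
      case True
      then have "t * (pt u \<bullet> e - pt v \<bullet> e) \<le> term_val a v x' - term_val a u x'"
        using tle[OF True] unfolding f_def Q_def by (simp add: pos_le_divide_eq)
      then show ?thesis by (simp add: inner_add_right algebra_simps)
    next
      case False
      then have "pt u \<bullet> e \<le> pt v \<bullet> e" using that unfolding Q_def by simp
      then have "t * (pt u \<bullet> e) \<le> t * (pt v \<bullet> e)" using t0 by (simp add: mult_left_mono)
      then show ?thesis using vmax[OF that] by (simp add: inner_add_right)
    qed
    have "u0 \<notin> M x'" using conste[OF _ v, of u0] u0(1) unfolding Q_def by auto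
    moreover have "u0 \<in> M (x' + t *\<^sub>R e)"
    proof -
      have "t * (pt u0 \<bullet> e - pt v \<bullet> e) = term_val a v x' - term_val a u0 x'"
        using u0 unfolding f_def Q_def by simp
      then have "term_val a u0 (x' + t *\<^sub>R e) = term_val a v (x' + t *\<^sub>R e)"
        by (simp add: inner_add_right algebra_simps)
      then show ?thesis using le u0(1) unfolding Q_def mem_max_terms[OF finite_support] by simp
    qed
    moreover have sub: "M x' \<subseteq> M (x' + t *\<^sub>R e)"
    proof
      fix w assume w: "w \<in> M x'"
      have "term_val a w (x' + t *\<^sub>R e) = term_val a v (x' + t *\<^sub>R e)"
        using max_terms_tie[OF finite_support w v] conste[OF w v] by (simp add: inner_add_right)
      then show "w \<in> M (x' + t *\<^sub>R e)"
        using le w max_terms_subset unfolding mem_max_terms[OF finite_support] by auto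
    qed
    ultimately have "card (M x') < card (M (x' + t *\<^sub>R e))"
      by (intro psubset_card_mono finite_M) auto
    moreover have "card (M (x' + t *\<^sub>R e)) \<le> n" using n sub x'(1) by (metis order_trans)
    ultimately show False using x' by simp
  qed
  then show ?thesis using that x'(1) by blast
qed

end

locale nonsingular_tropical_curve = tropical_polynomial +
  assumes nonsingular: "nonsingular_curve A a"
begin

text \<open>The dominant terms at a point given by \<open>max_terms_above\<close> span a two-dimensional dual face,
  which is a triangle of area 1/2 and contains no lattice points besides its vertices.\<close>

lemma in_unimodular_triangle:
  obtains x' u v w where "M x \<subseteq> M x'" "M x' = {u, v, w}" "unimodular_triple u v w"
proof -
  obtain x' where x': "M x \<subseteq> M x'"
    and rigid: "\<And>d. (\<And>u v. \<lbrakk>u \<in> M x'; v \<in> M x'\<rbrakk> \<Longrightarrow> pt u \<bullet> d = pt v \<bullet> d) \<Longrightarrow> d = 0"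
    using max_terms_above[of x] by metis
  let ?F = "convex hull (pt ` M x')"
  have dim: "aff_dim (pt ` M x') = 2"
  proof (rule ccontr)
    assume "aff_dim (pt ` M x') \<noteq> 2"
    then have "aff_dim (pt ` M x') < int (DIM(real^2))"
      using aff_dim_le_DIM[of "pt ` M x'"] by simp
    then obtain d b where "d \<noteq> 0" "pt ` M x' \<subseteq> {x. d \<bullet> x = b}"
      using aff_lowdim_subset_hyperplane by metis
    then have "pt u \<bullet> d = b" if "u \<in> M x'" for u using that by (auto simp: inner_commute)
    then show False using rigid[of d] \<open>d \<noteq> 0\<close> by metis
  qed
  have "?F \<in> dual_subdivision A a"
    unfolding dual_subdivision_def cells_def
    using dual_face_cell[OF finite_support support_nonempty, of a x'] by force
  then have F: "2 simplex ?F" "measure lborel ?F = 1/2"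
    using nonsingular dim unfolding nonsingular_curve_def by (auto simp: aff_dim_convex_hull)
  obtain C where C: "\<not> affine_dependent C" "card C = 3" "?F = convex hull C"
    using F(1) unfolding simplex_def by auto
  have "C \<subseteq> pt ` M x'"
  proof
    fix c assume "c \<in> C"
    then have "c extreme_point_of ?F"
      using extreme_point_of_convex_hull_affine_independent[OF C(1)] C(3) by metis
    then show "c \<in> pt ` M x'" by (rule extreme_point_of_convex_hull)
  qed
  moreover obtain p q r where pqr: "C = {p, q, r}" using C(2) by (auto simp: card_3_iff)
  ultimately have "p \<in> pt ` M x'" "q \<in> pt ` M x'" "r \<in> pt ` M x'" by simp_all
  then obtain u v w where uvw: "p = pt u" "q = pt v" "r = pt w" "u \<in> M x'" "v \<in> M x'" "w \<in> M x'"
    by (elim imageE)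
  have hull: "?F = convex hull {pt u, pt v, pt w}" using C(3) pqr uvw by simp
  have "\<bar>(pt w $ 1 - pt u $ 1) * (pt v $ 2 - pt u $ 2) - (pt v $ 1 - pt u $ 1) * (pt w $ 2 - pt u $ 2)\<bar> = 1"
    using F(2) unfolding hull content_triangle by simp
  then have "\<bar>real_of_int ((w $ 1 - u $ 1) * (v $ 2 - u $ 2) - (v $ 1 - u $ 1) * (w $ 2 - u $ 2))\<bar> = 1"
    by simp
  then have uni: "unimodular_triple u v w"
    unfolding unimodular_triple_def by linarith
  have "M x' \<subseteq> {u, v, w}"
  proof
    fix y assume "y \<in> M x'"
    then have "pt y \<in> ?F" by (simp add: hull_inc)
    then show "y \<in> {u, v, w}" using unimodular_triangle_lattice_points[OF uni] hull by metis
  qed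
  then show ?thesis using that[OF x' _ uni] uvw by blast
qed

text \<open>Dominant terms are vertices of a unimodular triangle, so they can be perturbed independently:
  every nonempty subset of them is the exact set of dominant terms at some nearby point.\<close>

lemma select_terms:
  assumes B: "finite B" "B \<noteq> {}" and sub: "max_terms B a x \<subseteq> M x'" and T: "T \<subseteq> max_terms B a x" "T \<noteq> {}"
  obtains d where "\<forall>\<^sub>F s in at_right 0. max_terms B a (x + s *\<^sub>R d) = T"
proof -
  obtain y u v w where y: "M x' \<subseteq> M y" "M y = {u, v, w}" "unimodular_triple u v w"
    using in_unimodular_triangle .
  then have "max_terms B a x \<subseteq> {u, v, w}" using sub by blast
  then obtain d where "{y \<in> max_terms B a x. \<forall>z\<in>max_terms B a x. pt z \<bullet> d \<le> pt y \<bullet> d} = T"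
    using unimodular_triple_select[OF y(3) _ T] by blast
  then show ?thesis using that max_terms_perturb[OF B, of a x d] by simp
qed

end

section \<open>Regions of the plane and their shape at infinity\<close>

context tropical_polynomial
begin

abbreviation region :: "int^2 \<Rightarrow> (real^2) set" where "region v \<equiv> {x. v \<in> M x}"
abbreviation open_region :: "int^2 \<Rightarrow> (real^2) set" where "open_region v \<equiv> {x. M x = {v}}"

lemma M_subset: "M x \<subseteq> A" by (rule max_terms_subset)

lemma M_nonempty: "M x \<noteq> {}" by (rule max_terms_nonempty[OF finite_support support_nonempty])

lemma mem_M: "v \<in> M x \<longleftrightarrow> v \<in> A \<and> (\<forall>u\<in>A. term_val a u x \<le> term_val a v x)"
  by (rule mem_max_terms[OF finite_support])

lemma M_eq_singleton: "M x = {v} \<longleftrightarrow> v \<in> A \<and> (\<forall>u\<in>A - {v}. term_val a u x < term_val a v x)"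
proof
  assume Mv: "M x = {v}"
  then have v: "v \<in> M x" by simp
  have "term_val a u x < term_val a v x" if u: "u \<in> A - {v}" for u
  proof (rule ccontr)
    assume "\<not> ?thesis"
    then have "u \<in> M x" using u v unfolding mem_M by (meson DiffD1 not_le order_trans less_imp_le)
    then show False using Mv u by blast
  qed
  then show "v \<in> A \<and> (\<forall>u\<in>A - {v}. term_val a u x < term_val a v x)" using v mem_M by blast
next
  assume v: "v \<in> A \<and> (\<forall>u\<in>A - {v}. term_val a u x < term_val a v x)"
  then have "v \<in> M x" unfolding mem_M by (metis DiffI order_refl less_imp_le singletonD)
  moreover have "u = v" if "u \<in> M x" for u
    using that v unfolding mem_M by (metis DiffI not_le singletonD)
  ultimately show "M x = {v}" by blast
qed

lemma open_open_region: "open (open_region v)"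
proof (cases "v \<in> A")
  case True
  have "open_region v = (\<Inter>u\<in>A - {v}. {x. (pt u - pt v) \<bullet> x < a v - a u})"
    using True by (auto simp: M_eq_singleton inner_diff_left algebra_simps)
  then show ?thesis using finite_support by (auto intro!: open_INT open_halfspace_lt)
qed (simp add: M_eq_singleton)

lemma convex_open_region: "convex (open_region v)"
proof (cases "v \<in> A")
  case True
  have "open_region v = (\<Inter>u\<in>A - {v}. {x. (pt u - pt v) \<bullet> x < a v - a u})"
    using True by (auto simp: M_eq_singleton inner_diff_left algebra_simps)
  then show ?thesis by (auto intro!: convex_INT convex_halfspace_lt)
qed (simp add: M_eq_singleton)

lemma region_subset_closure:
  assumes z: "M z = {v}"
  shows "region v \<subseteq> closure (open_region v)"
proof
  fix x assume "x \<in> region v"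
  then have x: "v \<in> A" "\<And>u. u \<in> A \<Longrightarrow> term_val a u x \<le> term_val a v x" by (auto simp: mem_M)
  have "M (x + s *\<^sub>R (z - x)) = {v}" if s: "0 < s" "s < 1" for s
    unfolding M_eq_singleton
  proof (intro conjI ballI)
    fix u assume u: "u \<in> A - {v}"
    have val: "term_val a w (x + s *\<^sub>R (z - x)) = (1 - s) * term_val a w x + s * term_val a w z" for w
      by (simp add: inner_add_right inner_diff_right algebra_simps)
    have "s * term_val a u z < s * term_val a v z" using z u s unfolding M_eq_singleton by simp
    moreover have "(1 - s) * term_val a u x \<le> (1 - s) * term_val a v x"
      using x(2) u s by (intro mult_left_mono) auto
    ultimately show "term_val a u (x + s *\<^sub>R (z - x)) < term_val a v (x + s *\<^sub>R (z - x))"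
      unfolding val by linarith
  qed (rule x(1))
  moreover have "\<forall>\<^sub>F s in at_right (0::real). 0 < s \<and> s < 1"
    unfolding eventually_at_right_field by (rule exI[of _ 1]) auto
  ultimately have ev: "\<forall>\<^sub>F s in at_right 0. x + s *\<^sub>R (z - x) \<in> open_region v"
    by (auto elim!: eventually_mono)
  have "((\<lambda>s. x + s *\<^sub>R (z - x)) \<longlongrightarrow> x + 0 *\<^sub>R (z - x)) (at_right 0)" by (intro tendsto_intros)
  then show "x \<in> closure (open_region v)"
    using ev closed_closure by (intro Lim_in_closed_set[of "closure (open_region v)" _ "at_right 0"])
      (auto elim!: eventually_mono intro: subsetD[OF closure_subset])
qed

lemma trop_curve_complement: "- trop_curve A a = (\<Union>v. open_region v)"
proof -
  have "\<not> 2 \<le> card (M x) \<longleftrightarrow> (\<exists>v. M x = {v})" for x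
  proof -
    have "card (M x) \<noteq> 0" using finite_M M_nonempty by simp
    then have "\<not> 2 \<le> card (M x) \<longleftrightarrow> card (M x) = 1" by linarith
    then show ?thesis by (simp add: card_1_singleton_iff)
  qed
  then show ?thesis unfolding trop_curve_def by auto
qed

lemma open_region_component:
  assumes "M z = {b}"
  shows "open_region b \<in> components (- trop_curve A a)"
  unfolding in_components_maximal
proof (intro conjI allI impI)
  show "open_region b \<noteq> {}" "open_region b \<subseteq> - trop_curve A a"
    using assms trop_curve_complement by blast+
  show "connected (open_region b)" using convex_open_region convex_connected by blast
  fix d assume d: "d \<noteq> {} \<and> open_region b \<subseteq> d \<and> d \<subseteq> - trop_curve A a \<and> connected d"
  have "y \<in> open_region b" if "y \<in> d" for y
  proof -
    have "y \<in> (\<Union>v. open_region v)" using d that trop_curve_complement by blast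
    then obtain j where j: "M y = {j}" by blast
    have "j = b"
    proof (rule closed_cover_propagation_euclidean[of d A region "\<lambda>v. v = b" b z j y])
      fix i j x assume *: "x \<in> d" "x \<in> region i" "x \<in> region j" "i = b"
      have "x \<in> (\<Union>v. open_region v)" using d * trop_curve_complement by blast
      then obtain k where "M x = {k}" by blast
      then show "j = b" using * by simp
    next
      show "d \<subseteq> (\<Union>v\<in>A. region v)" using M_nonempty M_subset by blast
      show "b \<in> A" "j \<in> A" using assms j M_subset by blast+
      show "z \<in> d" using assms d by blast
    qed (use d that assms j in \<open>auto simp: finite_support closed_region\<close>)
    then show ?thesis using j by simp
  qed
  then show "d = open_region b" using d by blast
qed

text \<open>The lattice points on the boundary of the Newton polygon. Their regions are the unbounded ones,
  since a direction \<open>w\<close> as in the definition is a direction of recession.\<close>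

definition outer :: "int^2 \<Rightarrow> bool" where
  "outer b \<longleftrightarrow> b \<in> A \<and> (\<exists>w. w \<noteq> 0 \<and> (\<forall>u\<in>A. pt u \<bullet> w \<le> pt b \<bullet> w))"

lemma region_recession:
  assumes "\<forall>u\<in>A. pt u \<bullet> w \<le> pt b \<bullet> w" "0 \<le> t"
  shows "b \<in> M x \<Longrightarrow> b \<in> M (x + t *\<^sub>R w)" "M x = {b} \<Longrightarrow> M (x + t *\<^sub>R w) = {b}"
proof -
  have le: "t * (pt u \<bullet> w) \<le> t * (pt b \<bullet> w)" if "u \<in> A" for u
    using assms that by (intro mult_left_mono) auto
  have val: "term_val a u (x + t *\<^sub>R w) = term_val a u x + t * (pt u \<bullet> w)" for u
    by (simp add: inner_add_right)
  show "b \<in> M x \<Longrightarrow> b \<in> M (x + t *\<^sub>R w)" unfolding mem_M val using le by force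
  show "M x = {b} \<Longrightarrow> M (x + t *\<^sub>R w) = {b}" unfolding M_eq_singleton val
    using le by (auto intro: add_less_le_mono)
qed

lemma ray_far:
  fixes w :: "'b::real_normed_vector"
  assumes "w \<noteq> 0"
  obtains t where "0 \<le> t" "R < norm (x + t *\<^sub>R w)"
proof -
  define t where "t = (\<bar>R\<bar> + norm x + 1) / norm w"
  have "t * norm w = \<bar>R\<bar> + norm x + 1" "0 \<le> t" unfolding t_def using assms by auto
  moreover have "norm (t *\<^sub>R w) \<le> norm (x + t *\<^sub>R w) + norm x"
    using norm_triangle_ineq4[of "x + t *\<^sub>R w" x] by simp
  ultimately have "R < norm (x + t *\<^sub>R w)" by simp
  then show ?thesis using that \<open>0 \<le> t\<close> by blast
qed

lemma outer_far_point:
  assumes "outer b" "b \<in> M x"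
  obtains y where "b \<in> M y" "R < norm y"
  using assms region_recession ray_far unfolding outer_def by metis

lemma unbounded_open_region:
  assumes "outer b" "M z = {b}"
  shows "\<not> bounded (open_region b)"
proof
  assume "bounded (open_region b)"
  then obtain R where R: "\<And>x. M x = {b} \<Longrightarrow> norm x \<le> R" unfolding bounded_iff by blast
  obtain w where w: "w \<noteq> 0" "\<forall>u\<in>A. pt u \<bullet> w \<le> pt b \<bullet> w" using assms unfolding outer_def by blast
  obtain t where "0 \<le> t" "R < norm (z + t *\<^sub>R w)" using ray_far[OF w(1)] by blast
  then show False using R region_recession(2)[OF w(2) _ assms(2)] by fastforce
qed

text \<open>If no direction is maximal on all of \<open>T\<close>, then by compactness of the circle the largest term exceeds
  some term of \<open>T\<close> by an amount that grows linearly with the norm, so the terms of \<open>T\<close> cannot all be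
  dominant far out.\<close>

lemma bounded_terms:
  assumes T: "T \<subseteq> A" "T \<noteq> {}" and bad: "\<And>w. w \<noteq> 0 \<Longrightarrow> \<exists>v\<in>T. \<exists>u\<in>A. pt v \<bullet> w < pt u \<bullet> w"
  shows "bounded {x. M x = T}"
proof -
  \<comment> \<open>\<open>\<psi>\<close> measures how far the direction \<open>w\<close> is from being maximal on all of \<open>T\<close>.\<close>
  define \<psi> where "\<psi> w = (\<Sum>v\<in>T. \<Sum>u\<in>A. max 0 (pt u \<bullet> w - pt v \<bullet> w))" for w :: "real^2"
  have fT: "finite T" using T finite_support finite_subset by blast
  have pos: "0 < \<psi> w" if w: "w \<noteq> 0" for w
  proof -
    obtain v u where vu: "v \<in> T" "u \<in> A" "pt v \<bullet> w < pt u \<bullet> w" using bad[OF w] by blast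
    have "0 < (\<Sum>u\<in>A. max 0 (pt u \<bullet> w - pt v \<bullet> w))"
      by (rule sum_pos2[of _ u]) (use finite_support vu in auto)
    then show ?thesis unfolding \<psi>_def
      by (intro sum_pos2[OF fT vu(1)] sum_nonneg) auto
  qed
  have "continuous_on (sphere 0 1) \<psi>" unfolding \<psi>_def by (intro continuous_intros)
  moreover have "(sphere 0 1 :: (real^2) set) \<noteq> {}" by simp
  ultimately obtain w0 where w0: "w0 \<in> sphere 0 1" "\<And>w. w \<in> sphere 0 1 \<Longrightarrow> \<psi> w0 \<le> \<psi> w"
    using continuous_attains_inf[OF compact_sphere] by metis
  have e: "0 < \<psi> w0" using pos w0(1) by (metis mem_sphere_0 norm_zero zero_neq_one)
  define K where "K = (\<Sum>v\<in>T. \<Sum>u\<in>A. \<bar>a v - a u\<bar>)"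
  have K0: "0 \<le> K" unfolding K_def by (intro sum_nonneg) auto
  have "norm x \<le> K / \<psi> w0" if x: "M x = T" for x
  proof (cases "x = 0")
    case False
    have "\<psi> x \<le> K" unfolding \<psi>_def K_def
    proof (intro sum_mono)
      fix v u assume "v \<in> T" "u \<in> A"
      then have "term_val a u x \<le> term_val a v x" using x mem_M by blast
      then show "max 0 (pt u \<bullet> x - pt v \<bullet> x) \<le> \<bar>a v - a u\<bar>" by auto
    qed
    moreover have "\<psi> x = norm x * \<psi> (x /\<^sub>R norm x)"
    proof -
      have "max 0 (pt u \<bullet> x - pt v \<bullet> x) = norm x * max 0 (pt u \<bullet> (x /\<^sub>R norm x) - pt v \<bullet> (x /\<^sub>R norm x))" for u v
      proof -
        have "norm x * (pt y \<bullet> (x /\<^sub>R norm x)) = pt y \<bullet> x" for y using False by simp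
        then show ?thesis by (simp only: max_mult_distrib_left right_diff_distrib) simp
      qed
      then show ?thesis unfolding \<psi>_def sum_distrib_left by (intro sum.cong) auto
    qed
    moreover have "norm x * \<psi> w0 \<le> norm x * \<psi> (x /\<^sub>R norm x)"
      using False by (intro mult_left_mono w0(2)) auto
    ultimately show ?thesis using e by (simp add: pos_le_divide_eq)
  qed (use K0 e in auto)
  then show ?thesis unfolding bounded_iff by blast
qed

text \<open>Outside a large disc all dominant terms lie on a common proper face of the Newton polygon.\<close>

lemma far_direction:
  obtains R where "\<And>x. R < norm x \<Longrightarrow> \<exists>w. w \<noteq> 0 \<and> (\<forall>v\<in>M x. \<forall>u\<in>A. pt u \<bullet> w \<le> pt v \<bullet> w)"
proof -
  define \<T> where "\<T> = {T. T \<subseteq> A \<and> T \<noteq> {} \<and> (\<forall>w. w \<noteq> 0 \<longrightarrow> (\<exists>v\<in>T. \<exists>u\<in>A. pt v \<bullet> w < pt u \<bullet> w))}"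
  have "finite \<T>" unfolding \<T>_def using finite_support by simp
  then have "bounded (\<Union>T\<in>\<T>. {x. M x = T})"
    using bounded_terms unfolding \<T>_def by (intro bounded_UN) auto
  then obtain R where R: "\<And>T x. T \<in> \<T> \<Longrightarrow> M x = T \<Longrightarrow> norm x \<le> R" unfolding bounded_iff by blast
  have "\<exists>w. w \<noteq> 0 \<and> (\<forall>v\<in>M x. \<forall>u\<in>A. pt u \<bullet> w \<le> pt v \<bullet> w)" if "R < norm x" for x
  proof (rule ccontr)
    assume no: "\<not> ?thesis"
    have "M x \<in> \<T>"
      unfolding \<T>_def
    proof (intro CollectI conjI allI impI M_subset M_nonempty)
      fix w :: "real^2" assume "w \<noteq> 0"
      then obtain v u where "v \<in> M x" "u \<in> A" "\<not> pt u \<bullet> w \<le> pt v \<bullet> w" using no by blast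
      then show "\<exists>v\<in>M x. \<exists>u\<in>A. pt v \<bullet> w < pt u \<bullet> w" by (meson not_le)
    qed
    then show False using R that by fastforce
  qed
  then show ?thesis using that by blast
qed

text \<open>The complement of a large disc is connected and is covered by the regions of the boundary
  points, so a property that passes between boundary points whose regions share a far point holds for all
  of them.\<close>

lemma far_propagation:
  assumes step: "\<And>w x b b'. \<lbrakk>w \<noteq> 0; b \<in> M x; b' \<in> M x; \<And>v u. v \<in> M x \<Longrightarrow> u \<in> A \<Longrightarrow> pt u \<bullet> w \<le> pt v \<bullet> w; P b\<rbrakk> \<Longrightarrow> P b'"
    and b: "outer b" "b \<in> M x" "P b" and b': "outer b'" "b' \<in> M x'"
  shows "P b'"
proof -
  obtain R where R: "\<And>x. R < norm x \<Longrightarrow> \<exists>w. w \<noteq> 0 \<and> (\<forall>v\<in>M x. \<forall>u\<in>A. pt u \<bullet> w \<le> pt v \<bullet> w)"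
    using far_direction by metis
  obtain y where y: "b \<in> M y" "R < norm y" using outer_far_point[OF b(1,2)] by blast
  obtain y' where y': "b' \<in> M y'" "R < norm y'" using outer_far_point[OF b'] by blast
  have conn: "connected (- cball 0 R :: (real^2) set)"
    by (intro connected_complement_bounded_convex) auto
  show ?thesis
  proof (rule closed_cover_propagation_euclidean[OF conn finite_support, of region P b y b' y'])
    fix i j x assume *: "x \<in> - cball 0 R" "x \<in> region i" "x \<in> region j" "P i"
    then have "R < norm x" by simp
    then obtain w where "w \<noteq> 0" "\<forall>v\<in>M x. \<forall>u\<in>A. pt u \<bullet> w \<le> pt v \<bullet> w" using R by blast
    then show "P j" using step[of w i x j] * by simp
  next
    show "- cball 0 R \<subseteq> (\<Union>v\<in>A. region v)" using M_nonempty M_subset by blast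
    show "b \<in> A" "b' \<in> A" using b b' M_subset by blast+
  qed (use y y' b in \<open>auto simp: closed_region finite_support\<close>)
qed

text \<open>A region that recedes in direction \<open>w\<close> can be left for good by moving in direction \<open>- w\<close>: far
  enough, two such paths can be joined by a segment in a half-plane that avoids the region.\<close>

lemma connected_region_complement:
  assumes "outer b"
  shows "connected (- region b)"
proof -
  obtain w where w: "w \<noteq> 0" "\<forall>u\<in>A. pt u \<bullet> w \<le> pt b \<bullet> w" and bA: "b \<in> A"
    using assms unfolding outer_def by blast
  have "\<exists>u\<in>A. pt u \<bullet> w < pt b \<bullet> w"
  proof (rule ccontr)
    assume "\<not> ?thesis"
    then have "pt u \<bullet> w = pt b \<bullet> w" if "u \<in> A" for u using w that by (meson antisym not_le)
    then show False using full_dim[of w] w(1) by metis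
  qed
  then obtain u0 where u0: "u0 \<in> A" "pt u0 \<bullet> w < pt b \<bullet> w" by blast
  have seg: "closed_segment x (x - t *\<^sub>R w) \<subseteq> - region b" if x: "x \<notin> region b" and t: "0 \<le> t" for x t
  proof
    fix y assume "y \<in> closed_segment x (x - t *\<^sub>R w)"
    then obtain k where k: "0 \<le> k" "y = (1 - k) *\<^sub>R x + k *\<^sub>R (x - t *\<^sub>R w)"
      unfolding closed_segment_def by blast
    have "x = y + (k * t) *\<^sub>R w" unfolding k(2) by (simp add: algebra_simps)
    then show "y \<in> - region b" using region_recession(1)[OF w(2), of "k * t" y] x k(1) t by auto
  qed
  have "connected_component (- region b) x y" if xy: "x \<in> - region b" "y \<in> - region b" for x y
  proof -
    have pos: "0 < pt b \<bullet> w - pt u0 \<bullet> w" using u0 by simp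
    define f where "f z = (term_val a b z - term_val a u0 z) / (pt b \<bullet> w - pt u0 \<bullet> w)" for z
    define t where "t = max 0 (max (f x) (f y)) + 1"
    have t: "0 \<le> t" "f x < t" "f y < t" unfolding t_def by auto
    define H where "H = {z. (pt b - pt u0) \<bullet> z < a u0 - a b}"
    have H: "H \<subseteq> - region b"
      unfolding H_def mem_M using u0 by (auto simp: inner_diff_left algebra_simps not_le)
    have inH: "z - t *\<^sub>R w \<in> H" if "f z < t" for z
    proof -
      have "term_val a b z - term_val a u0 z < t * (pt b \<bullet> w - pt u0 \<bullet> w)"
        using that pos unfolding f_def by (simp add: pos_divide_less_eq)
      then show ?thesis unfolding H_def by (simp add: inner_diff_left inner_diff_right algebra_simps)
    qed
    have "convex H" unfolding H_def by (rule convex_halfspace_lt)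
    then have "closed_segment (x - t *\<^sub>R w) (y - t *\<^sub>R w) \<subseteq> - region b"
      using inH[OF t(2)] inH[OF t(3)] H by (meson convex_contains_segment subset_trans)
    then have 1: "connected_component (- region b) (x - t *\<^sub>R w) (y - t *\<^sub>R w)"
      unfolding connected_component_def by (intro exI[of _ "closed_segment (x - t *\<^sub>R w) (y - t *\<^sub>R w)"]) auto
    have 2: "connected_component (- region b) z (z - t *\<^sub>R w)" if "z \<in> - region b" for z
      using seg[of z t] t(1) that unfolding connected_component_def
      by (intro exI[of _ "closed_segment z (z - t *\<^sub>R w)"]) auto
    show ?thesis
      using connected_component_trans[OF 2[OF xy(1)] connected_component_trans[OF 1 connected_component_sym[OF 2[OF xy(2)]]]] .
  qed
  then show ?thesis unfolding connected_iff_connected_component by blast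
qed

end

context nonsingular_tropical_curve
begin

lemma select_terms_plane:
  assumes "T \<subseteq> M x" "T \<noteq> {}"
  obtains d where "\<forall>\<^sub>F s in at_right 0. M (x + s *\<^sub>R d) = T"
  using select_terms[OF finite_support support_nonempty order_refl assms] .

lemma exact_terms:
  assumes "T \<subseteq> M x" "T \<noteq> {}"
  obtains y where "M y = T"
proof -
  obtain d where "\<forall>\<^sub>F s in at_right 0. M (x + s *\<^sub>R d) = T" using select_terms_plane[OF assms] .
  then show ?thesis using that eventually_happens[of _ "at_right (0::real)"] trivial_limit_at_right_real by blast
qed

lemma frontier_region: "frontier (region b) = {x. b \<in> M x \<and> M x \<noteq> {b}}"
proof -
  have cl: "closure (region b) = region b" using closed_region[OF finite_support] by simp
  have "x \<notin> interior (region b)" if x: "b \<in> M x" "M x \<noteq> {b}" for x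
  proof
    assume xi: "x \<in> interior (region b)"
    obtain u where u: "u \<in> M x" "u \<noteq> b" using x by blast
    obtain d where d: "\<forall>\<^sub>F s in at_right 0. M (x + s *\<^sub>R d) = {u}"
      using select_terms_plane[of "{u}" x] u by auto
    have "((\<lambda>s. x + s *\<^sub>R d) \<longlongrightarrow> x + 0 *\<^sub>R d) (at_right 0)" by (intro tendsto_intros)
    then have "\<forall>\<^sub>F s in at_right 0. x + s *\<^sub>R d \<in> interior (region b)"
      using topological_tendstoD[OF _ open_interior] xi by force
    with d have "\<forall>\<^sub>F s in at_right (0::real). False"
    proof eventually_elim
      case (elim s)
      then have "b \<in> M (x + s *\<^sub>R d)" using interior_subset[of "region b"] by blast
      then show ?case using elim(1) u(2) by simp
    qed
    then show False using trivial_limit_at_right_real by (simp add: eventually_False)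
  qed
  moreover have "x \<in> interior (region b)" if "M x = {b}" for x
    by (rule interiorI[OF open_open_region[of b]]) (use that in auto)
  ultimately show ?thesis unfolding frontier_def cl by blast
qed

text \<open>The plane is unicoherent: the frontier of a connected set with connected complement is
  connected.\<close>

lemma connected_region_boundary:
  assumes "outer b"
  shows "connected {x. b \<in> M x \<and> M x \<noteq> {b}}"
  using connected_frontier_simple[OF convex_connected[OF convex_region[OF finite_support]]
      connected_region_complement[OF assms]] frontier_region[of b] by simp

text \<open>A vertex of a unimodular triangle is the unique maximum of some linear function on the dominant
  terms; on a segment such a maximum is an end point.\<close>

lemma segment_terms:
  assumes "u \<in> M x" "v \<in> M x" and sub: "pt ` M x \<subseteq> closed_segment (pt u) (pt v)"
  shows "M x = {u, v}"
proof -
  have "y \<in> {u, v}" if y: "y \<in> M x" for y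
  proof -
    obtain y' p q r where t: "M x \<subseteq> M y'" "M y' = {p, q, r}" "unimodular_triple p q r"
      using in_unimodular_triangle .
    have sT: "{y} \<subseteq> M x" "{y} \<noteq> {}" using y by auto
    have "M x \<subseteq> {p, q, r}" using t by simp
    then obtain d where d: "{y \<in> M x. \<forall>z\<in>M x. pt z \<bullet> d \<le> pt y \<bullet> d} = {y}"
      using unimodular_triple_select[OF t(3) _ sT] by blast
    obtain k where k: "0 \<le> k" "k \<le> 1" "pt y = (1 - k) *\<^sub>R pt u + k *\<^sub>R pt v"
      using sub y unfolding closed_segment_def by blast
    have top: "pt z \<bullet> d \<le> pt y \<bullet> d" if "z \<in> M x" for z using d that by blast
    have eq: "(1 - k) * (pt y \<bullet> d - pt u \<bullet> d) + k * (pt y \<bullet> d - pt v \<bullet> d) = 0"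
      unfolding k(3) by (simp add: inner_add_left algebra_simps)
    have "0 \<le> (1 - k) * (pt y \<bullet> d - pt u \<bullet> d)" "0 \<le> k * (pt y \<bullet> d - pt v \<bullet> d)"
      using k top assms by simp_all
    with eq have "(1 - k) * (pt y \<bullet> d - pt u \<bullet> d) = 0" "k * (pt y \<bullet> d - pt v \<bullet> d) = 0" by linarith+
    then have "pt y \<bullet> d = pt u \<bullet> d \<or> pt y \<bullet> d = pt v \<bullet> d" by auto
    then have "u \<in> {y \<in> M x. \<forall>z\<in>M x. pt z \<bullet> d \<le> pt y \<bullet> d} \<or> v \<in> {y \<in> M x. \<forall>z\<in>M x. pt z \<bullet> d \<le> pt y \<bullet> d}"
      using top assms by auto
    then show ?thesis unfolding d by blast
  qed
  then show ?thesis using assms by blast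
qed

end

section \<open>Edges of the curve and twists\<close>

lemma perp_2_collinear:
  fixes n x y :: "real^2"
  assumes "n \<noteq> 0" "n \<bullet> x = 0" "n \<bullet> y = 0" "y \<noteq> 0"
  obtains c where "x = c *\<^sub>R y"
proof -
  have rot: "\<exists>k. z = k *\<^sub>R vector [- (n $ 2), n $ 1]" if z: "n \<bullet> z = 0" for z :: "real^2"
  proof -
    define N where "N = n $ 1 * n $ 1 + n $ 2 * n $ 2"
    have N: "N \<noteq> 0" using assms(1) unfolding N_def
      by (metis inner_2 inner_eq_zero_iff)
    have e: "n $ 1 * z $ 1 + n $ 2 * z $ 2 = 0" using z by (simp add: inner_2)
    define k where "k = (n $ 1 * z $ 2 - n $ 2 * z $ 1) / N"
    have "z $ 1 * N = - (n $ 2) * (n $ 1 * z $ 2 - n $ 2 * z $ 1) + n $ 1 * (n $ 1 * z $ 1 + n $ 2 * z $ 2)"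
      "z $ 2 * N = n $ 1 * (n $ 1 * z $ 2 - n $ 2 * z $ 1) + n $ 2 * (n $ 1 * z $ 1 + n $ 2 * z $ 2)"
      unfolding N_def by (simp_all add: algebra_simps)
    then have "z $ 1 * N = - (n $ 2) * (n $ 1 * z $ 2 - n $ 2 * z $ 1)"
      "z $ 2 * N = n $ 1 * (n $ 1 * z $ 2 - n $ 2 * z $ 1)"
      unfolding e by simp_all
    then have "z $ 1 = - (n $ 2) * k" "z $ 2 = n $ 1 * k"
      unfolding k_def times_divide_eq_right using N by (metis nonzero_mult_div_cancel_right)+
    then have "z = k *\<^sub>R vector [- (n $ 2), n $ 1]"
      by (simp add: vec_eq_iff forall_2 vector_2)
    then show ?thesis by blast
  qed
  obtain k l where kl: "x = k *\<^sub>R vector [- (n $ 2), n $ 1]" "y = l *\<^sub>R vector [- (n $ 2), n $ 1]"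
    using rot assms by blast
  have "l \<noteq> 0" using kl(2) assms(4) by auto
  then have "x = (k / l) *\<^sub>R y" unfolding kl by simp
  then show ?thesis by (rule that)
qed

lemma untwisted_edge_witness:
  assumes "e \<in> edges A a" "bounded e" "e \<notin> twisted_edges A a \<delta>"
  obtains \<epsilon> p q e1 e2 where "\<epsilon> \<in> phase A a \<delta> e" "e = closed_segment p q"
    "e1 \<in> edges A a - {e}" "p \<in> e1" "\<epsilon> \<in> phase A a \<delta> e1"
    "e2 \<in> edges A a - {e}" "q \<in> e2" "\<epsilon> \<in> phase A a \<delta> e2"
    "\<not> distinct_sides (affine hull e) e1 e2"
  using assms unfolding twisted_edges_def mem_Collect_eq by metis

context nonsingular_tropical_curve
begin

lemma unimodular_triple_vertex_unique:
  assumes "unimodular_triple u v w" "{u, v, w} \<subseteq> M t" "{u, v, w} \<subseteq> M t'"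
  shows "t = t'"
proof (rule ccontr)
  assume ne: "t \<noteq> t'"
  have tie: "(pt y - pt u) \<bullet> (t - t') = 0" if "y \<in> {u, v, w}" for y
  proof -
    have "term_val a y t = term_val a u t" "term_val a y t' = term_val a u t'"
      using assms(2,3) that by (auto intro: max_terms_tie[OF finite_support])
    then show ?thesis by (simp add: inner_diff_left inner_diff_right)
  qed
  obtain d where d: "(pt v - pt u) \<bullet> d = (t - t') $ 1" "(pt w - pt u) \<bullet> d = (t - t') $ 2"
    using unimodular_triple_functional[OF assms(1)] by blast
  have vw: "pt v - pt u \<noteq> 0"
  proof
    assume "pt v - pt u = 0"
    then show False using assms(1) by (simp add: unimodular_triple_def)
  qed
  obtain c where c: "pt w - pt u = c *\<^sub>R (pt v - pt u)"
    using perp_2_collinear[of "t - t'" "pt w - pt u" "pt v - pt u"] tie[of v] tie[of w] ne vw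
    by (auto simp: inner_commute)
  obtain e where e: "(pt v - pt u) \<bullet> e = 0" "(pt w - pt u) \<bullet> e = 1"
    using unimodular_triple_functional[OF assms(1)] by blast
  then show False unfolding c by simp
qed

lemma cell_two_terms: "M x = {u, v} \<Longrightarrow> cell A a x = region u \<inter> region v"
  by (auto simp: cell_def)

lemma dual_face_two_terms:
  "M x = {u, v} \<Longrightarrow> dual_face A a (cell A a x) = closed_segment (pt u) (pt v)"
  using dual_face_cell[OF finite_support support_nonempty, of a x] by (simp add: segment_convex_hull)

lemma edge_dim:
  assumes "M x = {u, v}" "u \<noteq> v"
  shows "aff_dim (region u \<inter> region v) = 1"
    and "affine hull (region u \<inter> region v) = {y. (pt u - pt v) \<bullet> y = a v - a u}"
proof -
  let ?e = "region u \<inter> region v" and ?n = "pt u - pt v"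
  have n: "?n \<noteq> 0" using assms(2) by simp
  have sub: "?e \<subseteq> {y. ?n \<bullet> y = a v - a u}"
  proof
    fix y assume "y \<in> ?e"
    then have "term_val a u y = term_val a v y" by (intro max_terms_tie[OF finite_support]) auto
    then show "y \<in> {y. ?n \<bullet> y = a v - a u}" by (simp add: inner_diff_left)
  qed
  have le: "aff_dim ?e \<le> 1"
    using aff_dim_subset[OF sub] aff_dim_hyperplane[OF n, of "a v - a u"] by simp
  obtain d :: "real^2" where d: "d \<noteq> 0" "?n \<bullet> d = 0"
  proof
    show "vector [- (?n $ 2), ?n $ 1] \<noteq> (0::real^2)"
      using n by (auto simp: vec_eq_iff forall_2 vector_2)
    show "?n \<bullet> vector [- (?n $ 2), ?n $ 1] = 0" by (simp add: inner_2 vector_2 algebra_simps)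
  qed
  have "{y \<in> M x. \<forall>z\<in>M x. pt z \<bullet> d \<le> pt y \<bullet> d} = {u, v}"
    using d(2) unfolding assms(1) by (auto simp: inner_diff_left)
  then have "\<forall>\<^sub>F s in at_right 0. M (x + s *\<^sub>R d) = {u, v}"
    using max_terms_perturb[OF finite_support support_nonempty, of a x d] by simp
  then have "\<forall>\<^sub>F s in at_right (0::real). M (x + s *\<^sub>R d) = {u, v} \<and> 0 < s"
    using eventually_at_right_less[of "0::real"] by (rule eventually_conj)
  then obtain s where s: "M (x + s *\<^sub>R d) = {u, v}" "0 < s"
    using eventually_happens'[OF trivial_limit_at_right_real] by blast
  have two: "x \<in> ?e" "x + s *\<^sub>R d \<in> ?e" "x \<noteq> x + s *\<^sub>R d" using s assms d by auto
  have "aff_dim ?e \<noteq> 0" using two aff_dim_eq_0[of ?e] by (metis singletonD)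
  moreover have "aff_dim ?e \<noteq> - 1" using two aff_dim_empty[of ?e] by blast
  moreover have "aff_dim ?e \<ge> - 1" by (rule aff_dim_geq)
  ultimately show dim: "aff_dim ?e = 1" using le by linarith
  show "affine hull ?e = {y. ?n \<bullet> y = a v - a u}"
  proof (rule affine_dim_equal)
    show "affine {y. ?n \<bullet> y = a v - a u}" by (rule affine_hyperplane)
    then show "affine hull ?e \<subseteq> {y. ?n \<bullet> y = a v - a u}" using sub by (metis hull_minimal)
    show "affine hull ?e \<noteq> {}" using hull_inc[OF two(1), of affine] by (metis empty_iff)
    show "aff_dim (affine hull ?e) = aff_dim {y. ?n \<bullet> y = a v - a u}"
      using dim aff_dim_hyperplane[OF n, of "a v - a u"] by simp
  qed simp
qed

lemma edge_two_terms:
  assumes "M x = {u, v}" "u \<noteq> v"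
  shows "region u \<inter> region v \<in> edges A a"
  unfolding edges_def cells_def
  using edge_dim(1)[OF assms] cell_two_terms[OF assms(1)] by (metis (mono_tags) mem_Collect_eq rangeI)

text \<open>The two exponents that witness the phase are the end points of the dual segment, hence
  extreme points of it, and by \<open>segment_terms\<close> the only dominant terms.\<close>

lemma edge_phase:
  assumes e: "e \<in> edges A a" "\<epsilon> \<in> phase A a \<delta> e" and nz: "\<And>v. v \<in> A \<Longrightarrow> \<delta> v \<noteq> 0"
  obtains x u v where "M x = {u, v}" "u \<noteq> v" "e = region u \<inter> region v"
    "copy_sign \<delta> \<epsilon> u = - copy_sign \<delta> \<epsilon> v"
proof -
  obtain x where x: "e = cell A a x" using e unfolding edges_def cells_def by blast
  obtain u v where uv: "convex hull (pt ` M x) = closed_segment (pt u) (pt v)"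
     "copy_sign \<delta> \<epsilon> u = - copy_sign \<delta> \<epsilon> v"
    using e(2) unfolding phase_def x dual_face_cell[OF finite_support support_nonempty] by blast
  have "pt u extreme_point_of (convex hull (pt ` M x))" "pt v extreme_point_of (convex hull (pt ` M x))"
    unfolding uv(1) segment_convex_hull by (simp_all add: extreme_point_of_convex_hull_2)
  then have "pt u \<in> pt ` M x" "pt v \<in> pt ` M x" using extreme_point_of_convex_hull by blast+
  then have mem: "u \<in> M x" "v \<in> M x" by auto
  have "M x = {u, v}"
    using segment_terms[OF mem] uv(1) hull_subset[of "pt ` M x" convex] by simp
  moreover have "u \<noteq> v"
  proof
    assume "u = v"
    then have "copy_sign \<delta> \<epsilon> u = 0" using uv(2) by simp
    then show False using nz[of u] mem(1) M_subset unfolding copy_sign_def by (auto split: if_splits)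
  qed
  ultimately show ?thesis using that[of x u v] uv(2) x cell_two_terms by simp
qed

text \<open>Along the line of the edge the third dominant term \<open>w\<close> at \<open>t\<close> is dominated on the side of \<open>t'\<close>.
  If the edge continued beyond \<open>t\<close>, then \<open>w\<close> would be dominated on both sides of \<open>t\<close>, although it is
  dominant at \<open>t\<close>.\<close>

lemma edge_is_segment:
  assumes t: "M t = {b, u, w}" "unimodular_triple b u w" and t': "M t' = {b, u, w'}" "unimodular_triple b u w'"
    and ne: "t \<noteq> t'"
  shows "region b \<inter> region u = closed_segment t t'"
proof
  have "convex (region b \<inter> region u)" using convex_region[OF finite_support] by (intro convex_Int)
  moreover have "t \<in> region b \<inter> region u" "t' \<in> region b \<inter> region u" using t t' by auto
  ultimately show "closed_segment t t' \<subseteq> region b \<inter> region u" by (simp add: convex_contains_segment)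
  have bu: "pt b - pt u \<noteq> 0"
  proof
    assume "pt b - pt u = 0"
    then show False using t(2) by (simp add: unimodular_triple_def)
  qed
  have tie: "(pt b - pt u) \<bullet> (y - t) = 0" if "y \<in> region b \<inter> region u" for y
  proof -
    have "term_val a b y = term_val a u y" "term_val a b t = term_val a u t"
      using that t by (auto intro: max_terms_tie[OF finite_support])
    then show ?thesis by (simp add: inner_diff_left inner_diff_right)
  qed
  have no_passing: False
    if s: "M s = {b, u, z}" "unimodular_triple b u z" and r: "b \<in> M r" "b \<in> M y" "u \<in> M y" "u \<in> M r"
      and mid: "s = (1 - k) *\<^sub>R y + k *\<^sub>R r" "0 < k" "k < 1" and sr: "s \<noteq> r" for s z r y k
  proof -
    let ?f = "\<lambda>x. term_val a b x - term_val a z x"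
    have zA: "z \<in> A" using s M_subset by blast
    have "0 \<le> ?f y" "0 \<le> ?f r" using r zA by (auto simp: mem_M)
    moreover have "?f s = (1 - k) * ?f y + k * ?f r"
      unfolding mid(1) by (simp add: inner_add_right algebra_simps)
    moreover have "?f s = 0" using max_terms_tie[OF finite_support, of b a s z] s(1) by simp
    ultimately have "k * ?f r = 0"
      using mid by (smt (verit) mult_nonneg_nonneg)
    then have fr: "?f r = 0" using mid(2) by simp
    then have "z \<in> M r" using r(1) zA by (auto simp: mem_M)
    then have "s = r" using unimodular_triple_vertex_unique[OF s(2), of s r] s(1) r by simp
    then show False using sr by simp
  qed
  show "region b \<inter> region u \<subseteq> closed_segment t t'"
  proof
    fix y assume y: "y \<in> region b \<inter> region u"
    have t'e: "t' \<in> region b \<inter> region u" using t' by simp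
    obtain c where c: "y - t = c *\<^sub>R (t' - t)"
      using perp_2_collinear[OF bu tie[OF y] tie[OF t'e]] ne by auto
    have yc: "y = (1 - c) *\<^sub>R t + c *\<^sub>R t'" using c by (simp add: algebra_simps)
    have "0 \<le> c"
    proof (rule ccontr)
      assume "\<not> 0 \<le> c"
      then have neg: "c < 0" by simp
      define k where "k = - c / (1 - c)"
      have k: "0 < k" "k < 1" unfolding k_def using neg by (simp_all add: divide_simps)
      have "(1 - k) * (1 - c) = 1" "(1 - k) * c + k = 0"
        unfolding k_def using neg by (simp_all add: field_simps)
      moreover have "(1 - k) *\<^sub>R y + k *\<^sub>R t' = ((1 - k) * (1 - c)) *\<^sub>R t + ((1 - k) * c + k) *\<^sub>R t'"
        unfolding yc by (simp add: algebra_simps)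
      ultimately have "t = (1 - k) *\<^sub>R y + k *\<^sub>R t'" by simp
      then show False using no_passing[OF t, of t' y k] y t' k ne by simp
    qed
    moreover have "c \<le> 1"
    proof (rule ccontr)
      assume "\<not> c \<le> 1"
      then have big: "1 < c" by simp
      define k where "k = (c - 1) / c"
      have k: "0 < k" "k < 1" unfolding k_def using big by (simp_all add: divide_simps)
      have "(1 - k) * c = 1" "(1 - k) * (1 - c) + k = 0"
        unfolding k_def using big by (simp_all add: field_simps)
      moreover have "(1 - k) *\<^sub>R y + k *\<^sub>R t = ((1 - k) * c) *\<^sub>R t' + ((1 - k) * (1 - c) + k) *\<^sub>R t"
        unfolding yc by (simp add: algebra_simps)
      ultimately have "t' = (1 - k) *\<^sub>R y + k *\<^sub>R t" by simp
      then show False using no_passing[OF t', of t y k] y t k ne by simp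
    qed
    ultimately show "y \<in> closed_segment t t'" unfolding closed_segment_def yc by blast
  qed
qed

lemma outer_edge_exposed:
  assumes b: "outer b" "M x = {b, u}" "u \<noteq> b"
  shows "exposed_edge A a (region b \<inter> region u)"
proof -
  obtain z where z: "M z = {b}" using exact_terms[of "{b}" x] b(2) by auto
  have "region b \<inter> region u \<subseteq> closure (open_region b)" using region_subset_closure[OF z] by blast
  moreover have "interior (open_region b) = open_region b" by (rule interior_open[OF open_open_region])
  ultimately have "region b \<inter> region u \<subseteq> frontier (open_region b)"
    unfolding frontier_def using b(3) by auto
  then show ?thesis
    unfolding exposed_edge_def using open_region_component[OF z] unbounded_open_region[OF b(1) z] by blast
qed

text \<open>The sign of \<open>w\<close> agrees with that of exactly one of \<open>b\<close> and \<open>u\<close>, and the edge of the real part that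
  continues at \<open>t\<close> separates \<open>w\<close> from the other one.\<close>

lemma sided_edges:
  assumes e: "e \<in> edges A a - {region b \<inter> region u}" "\<epsilon> \<in> phase A a \<delta> e"
    and nz: "\<And>v. v \<in> A \<Longrightarrow> \<delta> v \<in> {-1, 1}"
    and t: "t \<in> e" "M t = {b, u, w}" and opp: "copy_sign \<delta> \<epsilon> b = - copy_sign \<delta> \<epsilon> u"
  shows "if copy_sign \<delta> \<epsilon> w = copy_sign \<delta> \<epsilon> b then e \<subseteq> region u else e \<subseteq> region b"
proof -
  have e': "e \<in> edges A a" "\<And>v. v \<in> A \<Longrightarrow> \<delta> v \<noteq> 0" using e nz by force+
  obtain x p q where x: "M x = {p, q}" "p \<noteq> q" "e = region p \<inter> region q"
    "copy_sign \<delta> \<epsilon> p = - copy_sign \<delta> \<epsilon> q"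
    using edge_phase[OF e'(1) e(2) e'(2)] .
  have pq: "p \<in> {b, u, w}" "q \<in> {b, u, w}" using x(3) t by auto
  have "{b, u, w} \<subseteq> A" using t(2) M_subset by blast
  then have nz: "copy_sign \<delta> \<epsilon> w \<noteq> 0" "copy_sign \<delta> \<epsilon> b \<noteq> 0"
    using e'(2) unfolding copy_sign_def by (auto split: if_splits)
  have "\<not> (p \<in> {b, u} \<and> q \<in> {b, u})" using e(1) x(2,3) by (auto simp: Int_commute)
  then have "(p = w \<and> q \<in> {b, u}) \<or> (q = w \<and> p \<in> {b, u})" using pq x(2) by auto
  then show ?thesis using x(3,4) opp nz by auto
qed

text \<open>If the opposite vertices \<open>w\<close> and \<open>w'\<close> had different signs, the two continuing edges would bound the
  regions of \<open>b\<close> and of \<open>u\<close> respectively, so they would lie on distinct sides and the exposed edge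
  would be twisted.\<close>

lemma untwisted_outer_edge:
  assumes nt: "\<forall>e\<in>twisted_edges A a \<delta>. \<not> exposed_edge A a e"
    and pm: "\<And>v. v \<in> A \<Longrightarrow> \<delta> v \<in> {-1, 1}"
    and b: "outer b" and t: "M t = {b, u, w}" "unimodular_triple b u w"
    and t': "M t' = {b, u, w'}" "unimodular_triple b u w'" and ne: "t \<noteq> t'"
  obtains \<epsilon> where "copy_sign \<delta> \<epsilon> b = - copy_sign \<delta> \<epsilon> u" "copy_sign \<delta> \<epsilon> w = copy_sign \<delta> \<epsilon> w'"
proof -
  let ?e = "region b \<inter> region u"
  have bu: "u \<noteq> b" using t(2) by (auto simp: unimodular_triple_def)
  obtain x where x: "M x = {b, u}" using exact_terms[of "{b, u}" t] t(1) by auto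
  have nz: "\<And>v. v \<in> A \<Longrightarrow> \<delta> v \<noteq> 0" using pm by force
  have seg: "?e = closed_segment t t'" by (rule edge_is_segment[OF t t' ne])
  have "?e \<in> edges A a" using edge_two_terms[OF x] bu by blast
  moreover have "bounded ?e" unfolding seg by (rule bounded_closed_segment)
  moreover have "?e \<notin> twisted_edges A a \<delta>" using nt outer_edge_exposed[OF b x bu] by blast
  ultimately obtain \<epsilon> p q e1 e2 where h: "\<epsilon> \<in> phase A a \<delta> ?e" "?e = closed_segment p q"
    "e1 \<in> edges A a - {?e}" "p \<in> e1" "\<epsilon> \<in> phase A a \<delta> e1"
    "e2 \<in> edges A a - {?e}" "q \<in> e2" "\<epsilon> \<in> phase A a \<delta> e2"
    "\<not> distinct_sides (affine hull ?e) e1 e2"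
    by (rule untwisted_edge_witness)
  have face: "dual_face A a ?e = closed_segment (pt b) (pt u)"
    using dual_face_two_terms[OF x] cell_two_terms[OF x] by simp
  obtain r s where "closed_segment (pt b) (pt u) = closed_segment (pt r) (pt s)"
    "copy_sign \<delta> \<epsilon> r = - copy_sign \<delta> \<epsilon> s"
    using h(1) unfolding phase_def face by blast
  then have opp: "copy_sign \<delta> \<epsilon> b = - copy_sign \<delta> \<epsilon> u"
    by (auto simp: closed_segment_eq doubleton_eq_iff)
  have sides: "copy_sign \<delta> \<epsilon> w1 = copy_sign \<delta> \<epsilon> w2"
    if p: "M p = {b, u, w1}" and q: "M q = {b, u, w2}" for w1 w2
  proof (rule ccontr)
    assume dif: "copy_sign \<delta> \<epsilon> w1 \<noteq> copy_sign \<delta> \<epsilon> w2"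
    have A: "{b, u, w1, w2} \<subseteq> A" using p q M_subset by blast
    have val: "copy_sign \<delta> \<epsilon> v \<in> {-1, 1}" if "v \<in> A" for v
      using pm[OF that] unfolding copy_sign_def by auto
    have s1: "if copy_sign \<delta> \<epsilon> w1 = copy_sign \<delta> \<epsilon> b then e1 \<subseteq> region u else e1 \<subseteq> region b"
      by (rule sided_edges[OF h(3,5) pm h(4) p opp])
    have s2: "if copy_sign \<delta> \<epsilon> w2 = copy_sign \<delta> \<epsilon> b then e2 \<subseteq> region u else e2 \<subseteq> region b"
      by (rule sided_edges[OF h(6,8) pm h(7) q opp])
    have hull: "affine hull ?e = {y. (pt b - pt u) \<bullet> y = a u - a b}"
      using edge_dim(2)[OF x] bu by auto
    have n0: "pt b - pt u \<noteq> 0" "pt u - pt b \<noteq> 0" using bu by auto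
    have Ab: "b \<in> A" "u \<in> A" using A by auto
    have ru: "(pt b - pt u) \<bullet> y \<le> a u - a b" if "y \<in> region u" for y
      using that Ab by (auto simp: mem_M inner_diff_left algebra_simps)
    have rb: "(pt b - pt u) \<bullet> y \<ge> a u - a b" if "y \<in> region b" for y
      using that Ab by (auto simp: mem_M inner_diff_left algebra_simps)
    consider "e1 \<subseteq> region u" "e2 \<subseteq> region b" | "e1 \<subseteq> region b" "e2 \<subseteq> region u"
      using s1 s2 dif val[of w1] val[of w2] val[of b] A by (auto split: if_splits)
    then have "distinct_sides (affine hull ?e) e1 e2"
    proof cases
      case 1
      show ?thesis unfolding distinct_sides_def hull
        by (intro exI[of _ "pt b - pt u"] exI[of _ "a u - a b"])
          (use 1 n0 ru rb in \<open>force simp: order.strict_iff_order\<close>)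
    next
      case 2
      have flip: "(pt u - pt b) \<bullet> y = - ((pt b - pt u) \<bullet> y)" for y by (simp add: inner_diff_left)
      have "{y. (pt b - pt u) \<bullet> y = a u - a b} = {y. (pt u - pt b) \<bullet> y = a b - a u}"
        unfolding flip by auto
      moreover have "e1 - {y. (pt b - pt u) \<bullet> y = a u - a b} \<subseteq> {y. (pt u - pt b) \<bullet> y < a b - a u}"
        "e2 - {y. (pt b - pt u) \<bullet> y = a u - a b} \<subseteq> {y. (pt u - pt b) \<bullet> y > a b - a u}"
        unfolding flip using 2 ru rb by (force simp: order.strict_iff_order)+
      ultimately show ?thesis unfolding distinct_sides_def hull using n0 by blast
    qed
    then show False using h(9) by contradiction
  qed
  have "{p, q} = {t, t'}" using h(2) seg by (simp add: closed_segment_eq)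
  then have "(p = t \<and> q = t') \<or> (p = t' \<and> q = t)" by (auto simp: doubleton_eq_iff)
  then have "copy_sign \<delta> \<epsilon> w = copy_sign \<delta> \<epsilon> w'"
  proof (elim disjE conjE)
    assume "p = t" "q = t'"
    then have "M p = {b, u, w}" "M q = {b, u, w'}" using t(1) t'(1) by (simp_all only:)
    then show ?thesis by (rule sides)
  next
    assume "p = t'" "q = t"
    then have "M p = {b, u, w'}" "M q = {b, u, w}" using t(1) t'(1) by (simp_all only:)
    then show ?thesis by (rule sides[symmetric])
  qed
  then show ?thesis using that opp by blast
qed

end

section \<open>Sign patterns along the boundary of the Newton polygon\<close>

definition bdot :: "bit^2 \<Rightarrow> bit^2 \<Rightarrow> bit" where
  "bdot x y = x $ 1 * y $ 1 + x $ 2 * y $ 2"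

text \<open>The minority class of a quadrant is obtained from the reflection by exchanging coordinates. In
  the gluing, the same exchange turns a lattice direction into its normal modulo 2.\<close>

definition swap2 :: "bit^2 \<Rightarrow> bit^2" where
  "swap2 x = (\<chi> i. if i = 1 then x $ 2 else x $ 1)"

lemma swap2_nth [simp]: "swap2 x $ 1 = x $ 2" "swap2 x $ 2 = x $ 1"
  by (simp_all add: swap2_def)

text \<open>The sign pattern of a simple Harnack curve, additively: 0 on the zero class and 1 on the three
  other classes.\<close>

definition harnack :: "bit^2 \<Rightarrow> bit" where
  "harnack z = z $ 1 + z $ 2 + z $ 1 * z $ 2"

lemma bit2_eqI: "x $ 1 = y $ 1 \<Longrightarrow> x $ 2 = y $ 2 \<Longrightarrow> x = y" for x y :: "bit^2"
  by (simp add: vec_eq_iff forall_2)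

lemma bit_add_self: "b + b = 0" "b + (b + c) = c" for b c :: bit
  by (cases b; cases c; simp)+

lemma bit_cramer:
  fixes q1 q2 r1 r2 g h :: bit
  assumes "q1 * r2 + r1 * q2 = 1"
  shows "(g * r2 + h * q2) * q1 + (q1 * h + r1 * g) * q2 = g" "(g * r2 + h * q2) * r1 + (q1 * h + r1 * g) * r2 = h"
  using assms by (cases q1; cases q2; cases r1; cases r2; cases g; cases h; simp)+

lemma bit_solve:
  fixes p1 p2 q1 q2 r1 r2 f g h :: bit
  assumes "(q1 + p1) * (r2 + p2) + (r1 + p1) * (q2 + p2) = 1"
  shows "\<exists>c e1 e2. c + e1 * p1 + e2 * p2 = f \<and> c + e1 * q1 + e2 * q2 = g \<and> c + e1 * r1 + e2 * r2 = h"
proof -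
  define e1 where "e1 = (f + g) * (r2 + p2) + (f + h) * (q2 + p2)"
  define e2 where "e2 = (q1 + p1) * (f + h) + (r1 + p1) * (f + g)"
  have e: "e1 * (q1 + p1) + e2 * (q2 + p2) = f + g" "e1 * (r1 + p1) + e2 * (r2 + p2) = f + h"
    unfolding e1_def e2_def by (rule bit_cramer[OF assms])+
  define c where "c = f + e1 * p1 + e2 * p2"
  have "c + e1 * p1 + e2 * p2 = f"
    unfolding c_def by (simp only: ac_simps bit_add_self add_0_right add_0_left)
  moreover have "c + e1 * q1 + e2 * q2 = f + (e1 * (q1 + p1) + e2 * (q2 + p2))"
    "c + e1 * r1 + e2 * r2 = f + (e1 * (r1 + p1) + e2 * (r2 + p2))"
    unfolding c_def by (simp_all only: distrib_left ac_simps)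
  ultimately show ?thesis unfolding e bit_add_self by blast
qed

lemma bit_same_det:
  fixes q1 q2 r1 r2 s1 s2 :: bit
  assumes "q1 * r2 + r1 * q2 = 1" "q1 * s2 + s1 * q2 = 1"
  shows "(s1 = r1 \<and> s2 = r2) \<or> (s1 = q1 + r1 \<and> s2 = q2 + r2)"
  using assms by (cases q1; cases q2; cases r1; cases r2; cases s1; cases s2; simp)

lemma bit_harnack_fourth:
  fixes p1 p2 q1 q2 r1 r2 :: bit
  assumes "(q1 + p1) * (r2 + p2) + (r1 + p1) * (q2 + p2) = 1"
  shows "(p1 + q1 + r1) + (p2 + q2 + r2) + (p1 + q1 + r1) * (p2 + q2 + r2) =
    (p1 + p2 + p1 * p2) + (q1 + q2 + q1 * q2) + (r1 + r2 + r1 * r2) + 1"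
  using assms by (cases p1; cases p2; cases q1; cases q2; cases r1; cases r2; simp)

text \<open>Over the field with two elements, a point that completes a segment to a triangle is one of the
  two remaining points of the affine plane; if it is the other one, then all four points occur, and the
  pattern takes the value 1 on three of them.\<close>

lemma bit_fourth_class:
  fixes p1 p2 q1 q2 r1 r2 s1 s2 :: bit
  assumes "(q1 + p1) * (r2 + p2) + (r1 + p1) * (q2 + p2) = 1"
    "(q1 + p1) * (s2 + p2) + (s1 + p1) * (q2 + p2) = 1"
  shows "(s1 = r1 \<and> s2 = r2) \<or> (s1 = p1 + q1 + r1 \<and> s2 = p2 + q2 + r2 \<and>
    s1 + s2 + s1 * s2 = (p1 + p2 + p1 * p2) + (q1 + q2 + q1 * q2) + (r1 + r2 + r1 * r2) + 1)"
  using bit_same_det[OF assms]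
proof
  assume "s1 + p1 = r1 + p1 \<and> s2 + p2 = r2 + p2"
  then show ?thesis by (metis add_right_cancel)
next
  have *: "s = p + q + r" if "s + p = q + p + (r + p)" for s p q r :: bit
    using that by (cases s; cases p; cases q; cases r; simp)
  assume "s1 + p1 = q1 + p1 + (r1 + p1) \<and> s2 + p2 = q2 + p2 + (r2 + p2)"
  then have s: "s1 = p1 + q1 + r1" "s2 = p2 + q2 + r2" using * by blast+
  show ?thesis unfolding s using bit_harnack_fourth[OF assms(1)] by blast
qed

lemma bit_sign_fourth:
  fixes Db Du Dw Dw' Ab Au Aw :: bit
  assumes "Db + Ab \<noteq> Du + Au" "Dw + Aw = Dw' + (Ab + Au + Aw)"
  shows "Dw' = 1 + Db + Du + Dw"
  using assms by (cases Db; cases Du; cases Dw; cases Dw'; cases Ab; cases Au; cases Aw; simp)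

lemma bit_pattern_fourth:
  fixes Db Du Dw Bb Bu Bw Hb Hu Hw c :: bit
  assumes "Db + Bb = c + Hb" "Du + Bu = c + Hu" "Dw + Bw = c + Hw"
  shows "(1 + Db + Du + Dw) + (Bb + Bu + Bw) = c + (Hb + Hu + Hw + 1)"
proof -
  have move: "x = z + y" if "x + y = z" for x y z :: bit using that by (cases x; cases y; cases z; simp)
  have D: "Db = (c + Hb) + Bb" "Du = (c + Hu) + Bu" "Dw = (c + Hw) + Bw"
    using assms move by blast+
  show ?thesis unfolding D
    by (cases c; cases Bb; cases Bu; cases Bw; cases Hb; cases Hu; cases Hw; simp)
qed

lemma unimodular_triple_rotate: "unimodular_triple u v w \<Longrightarrow> unimodular_triple v w u"
  unfolding unimodular_triple_def by (simp add: algebra_simps)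

lemma unimodular_triple_swap: "unimodular_triple u v w \<Longrightarrow> unimodular_triple u w v"
  unfolding unimodular_triple_def by (simp add: algebra_simps abs_minus_commute)

lemma unimodular_triple_mod2:
  assumes "unimodular_triple u v w"
  shows "(mod2 v $ 1 + mod2 u $ 1) * (mod2 w $ 2 + mod2 u $ 2) +
    (mod2 w $ 1 + mod2 u $ 1) * (mod2 v $ 2 + mod2 u $ 2) = 1"
proof -
  have neg: "- x = x" "x - y = x + y" for x y :: bit by (cases x; cases y; simp)+
  let ?d = "(v$1 - u$1) * (w$2 - u$2) - (w$1 - u$1) * (v$2 - u$2)"
  have "?d = 1 \<or> ?d = - 1" using assms unfolding unimodular_triple_def by linarith
  then have "(of_int ?d :: bit) = 1" by (elim disjE) (simp_all only: of_int_1 of_int_minus neg)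
  then show ?thesis unfolding mod2_def by (simp only: of_int_diff of_int_mult neg vec_lambda_beta)
qed

text \<open>The point \<open>v0\<close> serves as origin for classes modulo 2. It is arbitrary here; only the
  compatibility of signs with the gluing of the copies requires it to be a vertex of the Newton
  polygon.\<close>

locale real_tropical_curve = nonsingular_tropical_curve +
  fixes \<delta> :: "int^2 \<Rightarrow> int" and v0 :: "int^2"
  assumes signs: "\<And>v. v \<in> A \<Longrightarrow> \<delta> v \<in> {-1, 1}"
    and exposed_untwisted: "\<forall>e\<in>twisted_edges A a \<delta>. \<not> exposed_edge A a e"
begin

definition cls :: "int^2 \<Rightarrow> bit^2" where "cls v = mod2 v + mod2 v0"

definition sign_bit :: "int^2 \<Rightarrow> bit" where "sign_bit v = (if \<delta> v = 1 then 0 else 1)"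

text \<open>The sign at \<open>\<epsilon>(v)\<close> of the extended distribution, written additively and renormalised by the
  factor that depends on \<open>\<epsilon>\<close> and \<open>v0\<close> only.\<close>

definition sign_at :: "reflection \<Rightarrow> int^2 \<Rightarrow> bit" where
  "sign_at \<epsilon> v = sign_bit v + bdot \<epsilon> (cls v)"

lemma opposite_iff:
  assumes "u \<in> A" "v \<in> A"
  shows "copy_sign \<delta> \<epsilon> u = - copy_sign \<delta> \<epsilon> v \<longleftrightarrow> sign_at \<epsilon> u \<noteq> sign_at \<epsilon> v"
proof -
  have s: "(\<Sum>i\<in>UNIV. \<epsilon> $ i * mod2 w $ i) = bdot \<epsilon> (mod2 w)" for w by (simp add: sum_2 bdot_def)
  have l: "bdot \<epsilon> (cls w) = bdot \<epsilon> (mod2 w) + bdot \<epsilon> (mod2 v0)" for w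
    unfolding bdot_def cls_def by (simp only: vector_add_component) (simp only: algebra_simps)
  have D: "\<delta> u = -1 \<or> \<delta> u = 1" "\<delta> v = -1 \<or> \<delta> v = 1" using signs assms by auto
  show ?thesis
    using D unfolding copy_sign_def s sign_at_def l sign_bit_def
    by (cases "bdot \<epsilon> (mod2 u)"; cases "bdot \<epsilon> (mod2 v)"; cases "bdot \<epsilon> (mod2 v0)") auto
qed

lemma same_iff:
  assumes "u \<in> A" "v \<in> A"
  shows "copy_sign \<delta> \<epsilon> u = copy_sign \<delta> \<epsilon> v \<longleftrightarrow> sign_at \<epsilon> u = sign_at \<epsilon> v"
proof -
  have "copy_sign \<delta> \<epsilon> w \<in> {-1, 1}" if "w \<in> A" for w using signs[OF that] unfolding copy_sign_def by auto
  then have "copy_sign \<delta> \<epsilon> u = copy_sign \<delta> \<epsilon> v \<longleftrightarrow> \<not> copy_sign \<delta> \<epsilon> u = - copy_sign \<delta> \<epsilon> v"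
    using assms by (metis insertE singletonD minus_minus one_neq_neg_one)
  then show ?thesis using opposite_iff[OF assms] by simp
qed

definition matches :: "bit \<Rightarrow> reflection \<Rightarrow> int^2 \<Rightarrow> bool" where
  "matches c \<epsilon> v \<longleftrightarrow> sign_at \<epsilon> v = c + harnack (cls v)"

lemma unimodular_triple_cls:
  assumes "unimodular_triple u v w"
  shows "(cls v $ 1 + cls u $ 1) * (cls w $ 2 + cls u $ 2) + (cls w $ 1 + cls u $ 1) * (cls v $ 2 + cls u $ 2) = 1"
proof -
  have "cls x $ i + cls y $ i = mod2 x $ i + mod2 y $ i" for x y i
    unfolding cls_def vector_add_component
    by (cases "mod2 x $ i"; cases "mod2 y $ i"; cases "mod2 v0 $ i") auto
  then show ?thesis using unimodular_triple_mod2[OF assms] by simp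
qed

text \<open>Three linear equations in the three bits \<open>c\<close>, \<open>\<epsilon>\<^sub>1\<close>, \<open>\<epsilon>\<^sub>2\<close>; unimodularity makes the system
  invertible.\<close>

lemma pattern_exists:
  assumes "unimodular_triple u v w"
  obtains c \<epsilon> where "matches c \<epsilon> u" "matches c \<epsilon> v" "matches c \<epsilon> w"
proof -
  obtain c e1 e2 where e: "c + e1 * cls u $ 1 + e2 * cls u $ 2 = sign_bit u + harnack (cls u)"
    "c + e1 * cls v $ 1 + e2 * cls v $ 2 = sign_bit v + harnack (cls v)"
    "c + e1 * cls w $ 1 + e2 * cls w $ 2 = sign_bit w + harnack (cls w)"
    using bit_solve[OF unimodular_triple_cls[OF assms]] by blast
  define \<epsilon> :: "bit^2" where "\<epsilon> = (\<chi> i. if i = 1 then e1 else e2)"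
  have b: "bdot \<epsilon> z = e1 * z $ 1 + e2 * z $ 2" for z by (simp add: bdot_def \<epsilon>_def)
  have "s + t = c + h" if "c + t = s + h" for s t c h :: bit
    using that by (cases s; cases t; cases c; cases h) auto
  then have "matches c \<epsilon> x" if "c + e1 * cls x $ 1 + e2 * cls x $ 2 = sign_bit x + harnack (cls x)" for x
    using that unfolding matches_def sign_at_def b by (metis add.assoc)
  then show ?thesis using that e by blast
qed

text \<open>If \<open>w\<close> and \<open>w'\<close> are congruent, their signs agree in every quadrant. Otherwise all four classes occur,
  the contributions of a reflection to the sum of the four signs cancel, and both the signs and the
  pattern sum to 1.\<close>

lemma pattern_propagates:
  assumes uni: "unimodular_triple b u w" "unimodular_triple b u w'"
    and sg: "sign_at \<epsilon> b \<noteq> sign_at \<epsilon> u" "sign_at \<epsilon> w = sign_at \<epsilon> w'"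
    and m: "matches c \<epsilon>' b" "matches c \<epsilon>' u" "matches c \<epsilon>' w"
  shows "matches c \<epsilon>' w'"
  using bit_fourth_class[OF unimodular_triple_cls[OF uni(1)] unimodular_triple_cls[OF uni(2)]]
proof
  assume "cls w' $ 1 = cls w $ 1 \<and> cls w' $ 2 = cls w $ 2"
  then have "cls w' = cls w" by (intro bit2_eqI) auto
  then show ?thesis using sg(2) m(3) unfolding matches_def sign_at_def by (metis add_right_cancel)
next
  assume *: "cls w' $ 1 = cls b $ 1 + cls u $ 1 + cls w $ 1 \<and> cls w' $ 2 = cls b $ 2 + cls u $ 2 + cls w $ 2 \<and>
    cls w' $ 1 + cls w' $ 2 + cls w' $ 1 * cls w' $ 2 =
    (cls b $ 1 + cls b $ 2 + cls b $ 1 * cls b $ 2) + (cls u $ 1 + cls u $ 2 + cls u $ 1 * cls u $ 2) +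
    (cls w $ 1 + cls w $ 2 + cls w $ 1 * cls w $ 2) + 1"
  then have h: "harnack (cls w') = harnack (cls b) + harnack (cls u) + harnack (cls w) + 1"
    unfolding harnack_def by blast
  have "cls w' $ 1 = cls b $ 1 + cls u $ 1 + cls w $ 1" "cls w' $ 2 = cls b $ 2 + cls u $ 2 + cls w $ 2"
    using * by blast+
  then have d: "bdot e (cls w') = bdot e (cls b) + bdot e (cls u) + bdot e (cls w)" for e
    unfolding bdot_def by (simp only: algebra_simps)
  have D: "sign_bit w' = 1 + sign_bit b + sign_bit u + sign_bit w"
    using sg unfolding sign_at_def d by (rule bit_sign_fourth)
  show ?thesis
    using m unfolding matches_def sign_at_def d h D by (rule bit_pattern_fourth)
qed

text \<open>The vertices of the curve, named after their dual triangles.\<close>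

definition triangle :: "real^2 \<Rightarrow> bool" where
  "triangle t \<longleftrightarrow> (\<exists>u v w. M t = {u, v, w} \<and> unimodular_triple u v w)"

lemma triangle_above: obtains t where "M x \<subseteq> M t" "triangle t"
  using in_unimodular_triangle unfolding triangle_def by metis

lemma triangle_through_edge:
  assumes "triangle t" "b \<in> M t" "u \<in> M t" "b \<noteq> u"
  obtains w where "M t = {b, u, w}" "unimodular_triple b u w"
proof -
  obtain p q r where Mt: "M t = {p, q, r}" and uni: "unimodular_triple p q r"
    using assms(1) unfolding triangle_def by blast
  note rot = unimodular_triple_rotate[OF uni] unimodular_triple_rotate[OF unimodular_triple_rotate[OF uni]]
  note swp = unimodular_triple_swap[OF uni] rot[THEN unimodular_triple_swap]
  consider "b = p" "u = q" | "b = q" "u = r" | "b = r" "u = p" | "b = p" "u = r" | "b = q" "u = p" | "b = r" "u = q"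
    using assms Mt by auto
  then show ?thesis
  proof cases
    case 1 then show ?thesis using that[of r] Mt uni by auto
  next
    case 2 then show ?thesis using that[of p] Mt rot by auto
  next
    case 3 then show ?thesis using that[of q] Mt rot by auto
  next
    case 4 then show ?thesis using that[of q] Mt swp by auto
  next
    case 5 then show ?thesis using that[of r] Mt swp by auto
  next
    case 6 then show ?thesis using that[of p] Mt swp by auto
  qed
qed

lemma three_terms_triangle:
  assumes "p \<in> M x" "q \<in> M x" "r \<in> M x" "p \<noteq> q" "q \<noteq> r" "p \<noteq> r"
  shows "triangle x"
proof -
  obtain t where t: "M x \<subseteq> M t" "triangle t" using triangle_above .
  have in_t: "p \<in> M t" "q \<in> M t" "r \<in> M t" using t(1) assms by blast+
  obtain w where w: "M t = {p, q, w}" "unimodular_triple p q w"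
    using triangle_through_edge[OF t(2) in_t(1,2) assms(4)] .
  have "r = w" using in_t(3) w(1) assms by simp
  then have "M x = M t" using w(1) t(1) assms by auto
  then show ?thesis using t(2) unfolding triangle_def by simp
qed

lemma cls_distinct:
  assumes "u \<in> M x" "v \<in> M x" "u \<noteq> v"
  shows "mod2 u \<noteq> mod2 v"
proof
  assume eq: "mod2 u = mod2 v"
  obtain t where t: "M x \<subseteq> M t" "triangle t" using triangle_above .
  have in_t: "u \<in> M t" "v \<in> M t" using t(1) assms by blast+
  obtain w where w: "M t = {u, v, w}" "unimodular_triple u v w"
    using triangle_through_edge[OF t(2) in_t assms(3)] .
  from w(2) have e: "(mod2 v $ 1 + mod2 u $ 1) * (mod2 w $ 2 + mod2 u $ 2) +
    (mod2 w $ 1 + mod2 u $ 1) * (mod2 v $ 2 + mod2 u $ 2) = 1" by (rule unimodular_triple_mod2)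
  have z: "b + b = 0" for b :: bit by (cases b) auto
  show False using e unfolding eq by (simp only: z mult_zero_left mult_zero_right add_0) simp
qed

lemma pattern_across_outer_edge:
  assumes b: "outer b" and t: "triangle t" "triangle t'" and e: "b \<noteq> u" "{b, u} \<subseteq> M t" "{b, u} \<subseteq> M t'"
    and m: "\<forall>v\<in>M t. matches c \<epsilon> v"
  shows "\<forall>v\<in>M t'. matches c \<epsilon> v"
proof (cases "t = t'")
  case False
  obtain w where w: "M t = {b, u, w}" "unimodular_triple b u w"
    using e by (auto intro: triangle_through_edge[OF t(1), of b u])
  obtain w' where w': "M t' = {b, u, w'}" "unimodular_triple b u w'"
    using e by (auto intro: triangle_through_edge[OF t(2), of b u])
  obtain \<eta> where "copy_sign \<delta> \<eta> b = - copy_sign \<delta> \<eta> u" "copy_sign \<delta> \<eta> w = copy_sign \<delta> \<eta> w'"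
    using untwisted_outer_edge[OF exposed_untwisted signs b w w' False] .
  moreover have "b \<in> A" "u \<in> A" "w \<in> A" "w' \<in> A" using w w' M_subset by blast+
  ultimately have "sign_at \<eta> b \<noteq> sign_at \<eta> u" "sign_at \<eta> w = sign_at \<eta> w'"
    using opposite_iff same_iff by blast+
  then have "matches c \<epsilon> w'" using pattern_propagates[OF w(2) w'(2)] m w(1) by blast
  then show ?thesis using m w w' by blast
qed (use m in simp)

text \<open>The frontier of an unbounded region is connected and consists of exposed edges, across which the
  pattern propagates.\<close>

lemma pattern_around_outer_region:
  assumes b: "outer b" and t: "triangle t" "b \<in> M t" "triangle t'" "b \<in> M t'"
    and m: "\<forall>v\<in>M t. matches c \<epsilon> v"
  shows "\<forall>v\<in>M t'. matches c \<epsilon> v"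
proof -
  have other: "\<exists>u\<in>M s. u \<noteq> b" if "triangle s" for s
  proof (rule ccontr)
    assume "\<not> ?thesis"
    moreover have "\<exists>p q r. M s = {p, q, r} \<and> unimodular_triple p q r" using that unfolding triangle_def .
    ultimately show False by (auto simp: unimodular_triple_def)
  qed
  obtain u u' where u: "u \<in> M t" "u \<noteq> b" "u' \<in> M t'" "u' \<noteq> b" using other t by meson
  define P where "P y \<longleftrightarrow> (\<forall>s. triangle s \<longrightarrow> {b, y} \<subseteq> M s \<longrightarrow> (\<forall>v\<in>M s. matches c \<epsilon> v))" for y
  have start: "P y" if "triangle s" "{b, y} \<subseteq> M s" "y \<noteq> b" "\<forall>v\<in>M s. matches c \<epsilon> v" for y s
    unfolding P_def using pattern_across_outer_edge[OF b that(1)] that(2-) by metis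
  have "P u'"
  proof (rule closed_cover_propagation_euclidean[OF connected_region_boundary[OF b], of "A - {b}"
        "\<lambda>y. region b \<inter> region y" P u t u' t'])
    fix i j x assume *: "i \<in> A - {b}" "j \<in> A - {b}" "x \<in> region b \<inter> region i" "x \<in> region b \<inter> region j" "P i"
    show "P j"
    proof (cases "i = j")
      case False
      have tx: "triangle x" using three_terms_triangle[of b x i j] * False by auto
      then have "\<forall>v\<in>M x. matches c \<epsilon> v" using \<open>P i\<close> * unfolding P_def by auto
      then show ?thesis using start[OF tx] * by auto
    qed (use * in simp)
  next
    show "{x. b \<in> M x \<and> M x \<noteq> {b}} \<subseteq> (\<Union>y\<in>A - {b}. region b \<inter> region y)" using M_subset by blast
    show "P u" using start[OF t(1)] u t m by blast
    show "u \<in> A - {b}" "u' \<in> A - {b}" using u M_subset by blast+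
  next
    fix i assume "i \<in> A - {b}"
    show "closed (region b \<inter> region i)" using closed_region[OF finite_support] by (intro closed_Int)
  qed (use u t finite_support in auto)
  then show ?thesis using t u unfolding P_def by blast
qed

text \<open>Neighbouring unbounded regions have a triangle in common, so the pattern found around one region is
  valid around the next one; \<open>far_propagation\<close> reaches all of them.\<close>

theorem outer_pattern:
  obtains c \<epsilon>0 where "\<And>b x v. \<lbrakk>outer b; b \<in> M x; v \<in> M x\<rbrakk> \<Longrightarrow> matches c \<epsilon>0 v"
proof (cases "\<exists>b x. outer b \<and> b \<in> M x")
  case True
  then obtain b x where b: "outer b" "b \<in> M x" by blast
  obtain t where t: "M x \<subseteq> M t" "triangle t" using triangle_above .
  then obtain p q r where pqr: "M t = {p, q, r}" "unimodular_triple p q r" unfolding triangle_def by blast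
  obtain c \<epsilon> where c: "matches c \<epsilon> p" "matches c \<epsilon> q" "matches c \<epsilon> r" using pattern_exists[OF pqr(2)] .
  define P where "P y \<longleftrightarrow> (\<forall>s. triangle s \<longrightarrow> y \<in> M s \<longrightarrow> (\<forall>v\<in>M s. matches c \<epsilon> v))" for y
  have start: "P b"
  proof -
    have "\<forall>v\<in>M t. matches c \<epsilon> v" using c unfolding pqr(1) by simp
    moreover have "b \<in> M t" using b(2) t(1) by blast
    ultimately show ?thesis unfolding P_def using pattern_around_outer_region[OF b(1) t(2)] by simp
  qed
  have all: "P b'" if b': "outer b'" "b' \<in> M y" for b' y
  proof (rule far_propagation[of P b x b' y])
    fix w x d d' assume *: "w \<noteq> 0" "d \<in> M x" "d' \<in> M x" "\<And>v u. v \<in> M x \<Longrightarrow> u \<in> A \<Longrightarrow> pt u \<bullet> w \<le> pt v \<bullet> w" "P d"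
    have d': "outer d'" unfolding outer_def using * M_subset by blast
    obtain s where s: "M x \<subseteq> M s" "triangle s" using triangle_above .
    then have "\<forall>v\<in>M s. matches c \<epsilon> v" using \<open>P d\<close> * unfolding P_def by blast
    then show "P d'" unfolding P_def using pattern_around_outer_region[OF d' s(2)] s(1) *(3) by blast
  qed (rule b start b')+
  show ?thesis
  proof (rule that)
    fix b x v assume *: "outer b" "b \<in> M x" "v \<in> M x"
    obtain s where s: "M x \<subseteq> M s" "triangle s" using triangle_above .
    then show "matches c \<epsilon> v" using all[OF *(1,2)] * unfolding P_def by blast
  qed
qed (use that in blast)

lemma bit_harnack_quadrant:
  fixes z1 z2 h1 h2 :: bit
  shows "(z1 + z2 + z1 * z2) + (h1 * z1 + h2 * z2) =
    (1 + h1) * (1 + h2) + (if h1 = z2 \<and> h2 = z1 then 1 else 0)"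
  by (cases z1; cases z2; cases h1; cases h2; simp)

lemma bit_minority:
  fixes z1 z2 e1 e2 f1 f2 c D :: bit
  assumes "D + (f1 * z1 + f2 * z2) = c + (z1 + z2 + z1 * z2)"
  shows "D + (e1 * z1 + e2 * z2) =
    (if e1 = f1 + z2 \<and> e2 = f2 + z1 then (c + (1 + (e1 + f1)) * (1 + (e2 + f2))) + 1
     else c + (1 + (e1 + f1)) * (1 + (e2 + f2)))"
proof -
  have split: "e * z = f * z + (e + f) * z" for e f z :: bit by (cases e; cases f; cases z; simp)
  have "D + (e1 * z1 + e2 * z2) = (D + (f1 * z1 + f2 * z2)) + ((e1 + f1) * z1 + (e2 + f2) * z2)"
    by (subst split[of e1 z1 f1], subst split[of e2 z2 f2]) (simp only: ac_simps)
  also have "\<dots> = c + ((1 + (e1 + f1)) * (1 + (e2 + f2)) + (if e1 + f1 = z2 \<and> e2 + f2 = z1 then 1 else 0))"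
    unfolding assms bit_harnack_quadrant[symmetric] by (simp only: ac_simps)
  finally have eq: "D + (e1 * z1 + e2 * z2) =
    c + ((1 + (e1 + f1)) * (1 + (e2 + f2)) + (if e1 + f1 = z2 \<and> e2 + f2 = z1 then 1 else 0))" .
  have "e + f = z \<longleftrightarrow> e = f + z" for e f z :: bit by (cases e; cases f; cases z; simp)
  then show ?thesis unfolding eq by (simp only: if_distrib ac_simps add_0_right split: if_split) simp
qed

text \<open>In the quadrant \<open>\<epsilon>0 + h\<close> the pattern becomes \<open>(z\<^sub>1 + 1 + h\<^sub>2) (z\<^sub>2 + 1 + h\<^sub>1)\<close> up to a constant
  that depends on \<open>h\<close> only. This product is 1 for the single class \<open>z = (h\<^sub>2, h\<^sub>1)\<close>.\<close>

theorem outer_minority: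
  "\<exists>maj \<epsilon>0. \<forall>b x v \<epsilon>. outer b \<longrightarrow> b \<in> M x \<longrightarrow> v \<in> M x \<longrightarrow>
     sign_at \<epsilon> v = (if \<epsilon> = \<epsilon>0 + swap2 (cls v) then maj \<epsilon> + 1 else maj \<epsilon>)"
proof -
  obtain c \<epsilon>0 where m: "\<And>b x v. \<lbrakk>outer b; b \<in> M x; v \<in> M x\<rbrakk> \<Longrightarrow> matches c \<epsilon>0 v" using outer_pattern by metis
  define maj where "maj \<epsilon> = c + (1 + (\<epsilon> $ 1 + \<epsilon>0 $ 1)) * (1 + (\<epsilon> $ 2 + \<epsilon>0 $ 2))" for \<epsilon> :: "bit^2"
  show ?thesis
  proof (rule exI[of _ maj], rule exI[of _ \<epsilon>0], intro allI impI)
    fix b x v \<epsilon> assume "outer b" "b \<in> M x" "v \<in> M x"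
    then have "matches c \<epsilon>0 v" by (rule m)
    then have e: "sign_bit v + (\<epsilon>0 $ 1 * cls v $ 1 + \<epsilon>0 $ 2 * cls v $ 2) =
      c + (cls v $ 1 + cls v $ 2 + cls v $ 1 * cls v $ 2)"
      unfolding matches_def sign_at_def harnack_def bdot_def .
    have "\<epsilon> = \<epsilon>0 + swap2 (cls v) \<longleftrightarrow> \<epsilon> $ 1 = \<epsilon>0 $ 1 + cls v $ 2 \<and> \<epsilon> $ 2 = \<epsilon>0 $ 2 + cls v $ 1"
      unfolding vec_eq_iff forall_2 vector_add_component swap2_nth by blast
    then show "sign_at \<epsilon> v = (if \<epsilon> = \<epsilon>0 + swap2 (cls v) then maj \<epsilon> + 1 else maj \<epsilon>)"
      using bit_minority[OF e, of "\<epsilon> $ 1" "\<epsilon> $ 2"] unfolding sign_at_def bdot_def maj_def by (simp only:)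
  qed
qed

end

section \<open>The Newton polygon and its dual fan\<close>

lemma convex_cone_hull_two:
  "convex_cone hull {x, y} \<subseteq> {s *\<^sub>R x + t *\<^sub>R y | s t. 0 \<le> s \<and> 0 \<le> t}"
proof (rule hull_minimal)
  have 1: "x = 1 *\<^sub>R x + 0 *\<^sub>R y" "y = 0 *\<^sub>R x + 1 *\<^sub>R y" by simp_all
  show "{x, y} \<subseteq> {s *\<^sub>R x + t *\<^sub>R y | s t. 0 \<le> s \<and> 0 \<le> t}"
    using 1 zero_le_one order_refl[of "0::real"] by blast
  show "convex_cone {s *\<^sub>R x + t *\<^sub>R y | s t. 0 \<le> s \<and> 0 \<le> t}"
    unfolding convex_cone_iff
  proof (intro conjI ballI allI impI)
    have "0 = 0 *\<^sub>R x + 0 *\<^sub>R y" by simp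
    then show "0 \<in> {s *\<^sub>R x + t *\<^sub>R y | s t. 0 \<le> s \<and> 0 \<le> t}" by blast
  next
    fix p q assume "p \<in> {s *\<^sub>R x + t *\<^sub>R y | s t. 0 \<le> s \<and> 0 \<le> t}"
      "q \<in> {s *\<^sub>R x + t *\<^sub>R y | s t. 0 \<le> s \<and> 0 \<le> t}"
    then obtain s t s' t' where "p = s *\<^sub>R x + t *\<^sub>R y" "q = s' *\<^sub>R x + t' *\<^sub>R y"
      "0 \<le> s" "0 \<le> t" "0 \<le> s'" "0 \<le> t'" by blast
    then have "p + q = (s + s') *\<^sub>R x + (t + t') *\<^sub>R y" "0 \<le> s + s'" "0 \<le> t + t'"
      by (simp_all add: algebra_simps)
    then show "p + q \<in> {s *\<^sub>R x + t *\<^sub>R y | s t. 0 \<le> s \<and> 0 \<le> t}" by blast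
  next
    fix p and c :: real assume "p \<in> {s *\<^sub>R x + t *\<^sub>R y | s t. 0 \<le> s \<and> 0 \<le> t}" "0 \<le> c"
    then obtain s t where "p = s *\<^sub>R x + t *\<^sub>R y" "0 \<le> s" "0 \<le> t" by blast
    then have "c *\<^sub>R p = (c * s) *\<^sub>R x + (c * t) *\<^sub>R y" "0 \<le> c * s" "0 \<le> c * t"
      using \<open>0 \<le> c\<close> by (simp_all add: scaleR_add_right)
    then show "c *\<^sub>R p \<in> {s *\<^sub>R x + t *\<^sub>R y | s t. 0 \<le> s \<and> 0 \<le> t}" by blast
  qed
qed

lemma unimodular_cone_no_line:
  assumes det: "\<bar>u $ 1 * v $ 2 - u $ 2 * v $ 1\<bar> = 1" and B: "B \<subseteq> {u, v}"
    and d: "d \<in> convex_cone hull (pt ` B)" "- d \<in> convex_cone hull (pt ` B)"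
  shows "d = 0"
proof -
  have "convex_cone hull (pt ` B) \<subseteq> convex_cone hull {pt u, pt v}" using B by (intro hull_mono) auto
  then have "d \<in> convex_cone hull {pt u, pt v}" "- d \<in> convex_cone hull {pt u, pt v}" using d by blast+
  then obtain s t s' t' where st: "d = s *\<^sub>R pt u + t *\<^sub>R pt v" "- d = s' *\<^sub>R pt u + t' *\<^sub>R pt v"
      "0 \<le> s" "0 \<le> t" "0 \<le> s'" "0 \<le> t'" using convex_cone_hull_two[of "pt u" "pt v"] by blast
  define p q where "p = s + s'" and "q = t + t'"
  have "p *\<^sub>R pt u + q *\<^sub>R pt v = d + - d"
    unfolding p_def q_def by (subst st(2), subst st(1)) (simp add: algebra_simps)
  then have z: "p *\<^sub>R pt u + q *\<^sub>R pt v = 0" by simp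
  have e: "p * real_of_int (u$1) + q * real_of_int (v$1) = 0" "p * real_of_int (u$2) + q * real_of_int (v$2) = 0"
    using arg_cong[OF z, of "\<lambda>x. x $ 1"] arg_cong[OF z, of "\<lambda>x. x $ 2"] by simp_all
  let ?D = "real_of_int (u $ 1 * v $ 2 - u $ 2 * v $ 1)"
  have D: "?D \<noteq> 0" using det by linarith
  have "p * ?D = (p * real_of_int (u$1) + q * real_of_int (v$1)) * real_of_int (v$2)
      - (p * real_of_int (u$2) + q * real_of_int (v$2)) * real_of_int (v$1)"
    "q * ?D = (p * real_of_int (u$2) + q * real_of_int (v$2)) * real_of_int (u$1)
      - (p * real_of_int (u$1) + q * real_of_int (v$1)) * real_of_int (u$2)"
    by (simp_all add: algebra_simps)
  then have "p = 0" "q = 0" unfolding e using D by simp_all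
  then have "s = 0" "t = 0" using st(3-) unfolding p_def q_def by linarith+
  then show ?thesis using st(1) by simp
qed

text \<open>A direction on which the polygon is constant spans a line in the dual cone of the polygon itself,
  but a cone generated by part of a basis contains no line.\<close>

lemma unimodular_fan_full_dim:
  assumes fan: "unimodular_fan (dual_fan (newton_polygon A))" and A: "A \<noteq> {}"
    and const: "\<And>u v. \<lbrakk>u \<in> A; v \<in> A\<rbrakk> \<Longrightarrow> pt u \<bullet> d = pt v \<bullet> d"
  shows "d = 0"
proof -
  let ?\<Delta> = "newton_polygon A"
  obtain v where v: "v \<in> A" using A by blast
  have "?\<Delta> \<subseteq> {x. d \<bullet> x = pt v \<bullet> d}"
    unfolding newton_polygon_def
  proof (rule hull_minimal)
    show "pt ` A \<subseteq> {x. d \<bullet> x = pt v \<bullet> d}"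
      using const[OF _ v] by (simp only: image_subset_iff mem_Collect_eq inner_commute[of d]) blast
  qed (rule convex_hyperplane)
  then have "d \<bullet> q = pt v \<bullet> d" if "q \<in> ?\<Delta>" for q using that by blast
  then have mem: "d \<in> dual_cone ?\<Delta> ?\<Delta>" "- d \<in> dual_cone ?\<Delta> ?\<Delta>"
    unfolding dual_cone_def by simp_all
  have "?\<Delta> face_of ?\<Delta>" "?\<Delta> \<noteq> {}"
    using A unfolding newton_polygon_def by (auto intro: face_of_refl)
  then have "dual_cone ?\<Delta> ?\<Delta> \<in> dual_fan ?\<Delta>" unfolding dual_fan_def by blast
  then have "\<exists>u v :: int^2. \<bar>u $ 1 * v $ 2 - u $ 2 * v $ 1\<bar> = 1 \<and>
      (\<exists>B\<subseteq>{u, v}. dual_cone ?\<Delta> ?\<Delta> = convex_cone hull (pt ` B))"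
    using fan unfolding unimodular_fan_def by (rule bspec[rotated])
  then obtain u v :: "int^2" and B where "\<bar>u $ 1 * v $ 2 - u $ 2 * v $ 1\<bar> = 1" "B \<subseteq> {u, v}"
    "dual_cone ?\<Delta> ?\<Delta> = convex_cone hull (pt ` B)" by (elim exE conjE)
  then show ?thesis using mem by (intro unimodular_cone_no_line[of u v B d]) simp_all
qed

lemma finite_int2_segment: "finite {z. pt z \<in> closed_segment (pt u) (pt v)}"
proof -
  have "{z. pt z \<in> closed_segment (pt u) (pt v)} \<subseteq>
    (\<lambda>(x, y). vector [x, y]) ` ({min (u$1) (v$1)..max (u$1) (v$1)} \<times> {min (u$2) (v$2)..max (u$2) (v$2)})"
  proof
    fix z assume "z \<in> {z. pt z \<in> closed_segment (pt u) (pt v)}"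
    then obtain k where k: "pt z = (1 - k) *\<^sub>R pt u + k *\<^sub>R pt v" "0 \<le> k" "k \<le> 1"
      unfolding closed_segment_def by blast
    have "pt z $ i \<in> closed_segment (pt u $ i) (pt v $ i)" for i
      unfolding closed_segment_def mem_Collect_eq
      by (rule exI[of _ k]) (use k in \<open>simp only: vector_add_component vector_scaleR_component real_scaleR_def simp_thms\<close>)
    then have zi: "z $ i \<in> {min (u$i) (v$i)..max (u$i) (v$i)}" for i
      unfolding closed_segment_eq_real_ivl pt_nth
      by (smt (verit) atLeastAtMost_iff of_int_le_iff)
    have "z = vector [z $ 1, z $ 2]" by (simp add: vec_eq_iff forall_2 vector_2)
    then show "z \<in> (\<lambda>(x, y). vector [x, y]) `
        ({min (u$1) (v$1)..max (u$1) (v$1)} \<times> {min (u$2) (v$2)..max (u$2) (v$2)})"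
      by (intro image_eqI[of _ _ "(z $ 1, z $ 2)"]) (use zi in \<open>simp_all only: split mem_Times_iff fst_conv snd_conv simp_thms\<close>)
  qed
  then show ?thesis by (rule finite_subset) simp
qed

text \<open>The reflection of the segment in its midpoint permutes its lattice points. Their number is odd, so the
  midpoint is one of them.\<close>

lemma even_segment_mod2:
  assumes "even (lattice_length (closed_segment (pt u) (pt v)))"
  shows "mod2 u = mod2 v"
proof (cases "u = v")
  case False
  define S where "S = {z. pt z \<in> closed_segment (pt u) (pt v)}"
  have fin: "finite S" unfolding S_def by (rule finite_int2_segment)
  have "u \<in> S" unfolding S_def by simp
  then have "card S \<noteq> 0" using fin by auto
  then have odd: "odd (card S)" using assms unfolding lattice_length_def S_def by simp
  define L where "L z = (pt v - pt u) \<bullet> pt z" for z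
  define r where "r z = u + v - z" for z
  define m where "m = (L u + L v) / 2"
  have ptr: "pt (r z) = pt u + pt v - pt z" for z unfolding r_def by (simp add: pt_diff pt_add)
  have rS: "r z \<in> S" if z: "z \<in> S" for z
  proof -
    obtain k where k: "pt z = (1 - k) *\<^sub>R pt u + k *\<^sub>R pt v" "0 \<le> k" "k \<le> 1"
      using z unfolding S_def closed_segment_def by blast
    have "pt (r z) = (1 - (1 - k)) *\<^sub>R pt u + (1 - k) *\<^sub>R pt v" unfolding ptr k(1) by (simp add: algebra_simps)
    then show ?thesis using k(2,3) unfolding S_def closed_segment_def mem_Collect_eq
      by (intro exI[of _ "1 - k"]) simp
  qed
  have rr: "r (r z) = z" for z unfolding r_def by simp
  have Lr: "L (r z) = 2 * m - L z" for z
    unfolding L_def ptr m_def by (simp add: inner_add_right inner_diff_right)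
  \<comment> \<open>\<open>L\<close> orders the points of the segment, and \<open>m\<close> is its value at the midpoint.\<close>
  have "\<exists>z\<in>S. L z = m"
  proof (rule ccontr)
    assume none: "\<not> ?thesis"
    let ?lo = "{z\<in>S. L z < m}" and ?hi = "{z\<in>S. L z > m}"
    have "bij_betw r ?lo ?hi"
      by (rule bij_betw_byWitness[of _ r]) (use rS rr Lr in auto)
    then have "card ?lo = card ?hi" by (rule bij_betw_same_card)
    moreover have "S = ?lo \<union> ?hi" using none by (auto simp: neq_iff)
    moreover have "card (?lo \<union> ?hi) = card ?lo + card ?hi" using fin by (intro card_Un_disjoint) auto
    ultimately have "card S = card ?lo + card ?lo" by simp
    then show False using odd by simp
  qed
  then obtain z where z: "z \<in> S" "L z = m" by blast
  obtain k where k: "pt z = (1 - k) *\<^sub>R pt u + k *\<^sub>R pt v" using z unfolding S_def closed_segment_def by blast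
  define w where "w = pt v - pt u"
  have w: "w \<bullet> w \<noteq> 0" using False unfolding w_def by simp
  have "pt z = pt u + k *\<^sub>R w" unfolding k w_def by (simp add: algebra_simps)
  then have "L z = w \<bullet> pt u + k * (w \<bullet> w)" unfolding L_def w_def[symmetric] by (simp add: inner_add_right)
  moreover have "pt v = pt u + w" unfolding w_def by simp
  then have "m = w \<bullet> pt u + (1/2) * (w \<bullet> w)" unfolding m_def L_def w_def[symmetric]
    by (simp add: inner_add_right field_simps)
  ultimately have "(k - 1/2) * (w \<bullet> w) = 0" using z(2) by (simp add: algebra_simps)
  then have "k = 1/2" using w by simp
  then have "pt z $ i + pt z $ i = pt u $ i + pt v $ i" for i unfolding k
    by (simp only: vector_add_component vector_scaleR_component real_scaleR_def) (simp add: field_simps)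
  then have "pt (z + z) = pt (u + v)" unfolding pt_add by (simp add: vec_eq_iff)
  then have zz: "z + z = u + v" by simp
  have "mod2 u $ i = mod2 v $ i" for i
  proof -
    have "mod2 z $ i + mod2 z $ i = mod2 u $ i + mod2 v $ i"
      using arg_cong[OF zz, of "\<lambda>x. mod2 x $ i"] unfolding mod2_add vector_add_component .
    then show ?thesis by (cases "mod2 z $ i"; cases "mod2 u $ i"; cases "mod2 v $ i") auto
  qed
  then show ?thesis by (simp add: vec_eq_iff)
qed simp

context tropical_polynomial
begin

abbreviation polygon :: "(real^2) set" where "polygon \<equiv> newton_polygon A"

lemma polytope_polygon: "polytope polygon"
  unfolding newton_polygon_def using finite_support by (intro polytope_convex_hull) simp

lemma convex_polygon: "convex polygon" unfolding newton_polygon_def by simp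

lemma compact_polygon: "compact polygon" using polytope_polygon polytope_imp_compact by blast

lemma pt_in_polygon: "v \<in> A \<Longrightarrow> pt v \<in> polygon"
  unfolding newton_polygon_def by (simp add: hull_inc)

lemma polygon_le:
  assumes "\<And>u. u \<in> A \<Longrightarrow> w \<bullet> pt u \<le> c" "q \<in> polygon"
  shows "w \<bullet> q \<le> c"
proof -
  have "polygon \<subseteq> {x. w \<bullet> x \<le> c}" unfolding newton_polygon_def
    by (rule hull_minimal) (use assms(1) in \<open>auto simp: convex_halfspace_le\<close>)
  then show ?thesis using assms(2) by blast
qed

text \<open>The exponents that survive when the polynomial is restricted to a stratum.\<close>

definition face_terms :: "(real^2) set \<Rightarrow> (int^2) set" where
  "face_terms \<Gamma> = {v\<in>A. pt v \<in> \<Gamma>}"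

lemma face_terms_subset: "face_terms \<Gamma> \<subseteq> A" unfolding face_terms_def by blast

lemma finite_face_terms: "finite (face_terms \<Gamma>)"
  using finite_support face_terms_subset finite_subset by blast

lemma face_vertex:
  assumes "\<Gamma> face_of polygon" "\<Gamma> \<noteq> {}"
  obtains v where "v \<in> face_terms \<Gamma>" "pt v extreme_point_of polygon"
proof -
  have "compact \<Gamma>" "convex \<Gamma>"
    using assms face_of_imp_compact[OF convex_polygon compact_polygon] face_of_imp_convex convex_polygon by blast+
  then obtain x where x: "x extreme_point_of \<Gamma>" using extreme_point_exists_convex assms(2) by blast
  then have xe: "x extreme_point_of polygon" "x \<in> \<Gamma>" using extreme_point_of_face[OF assms(1)] by blast+
  then obtain v where "v \<in> A" "x = pt v"
    using extreme_point_of_convex_hull unfolding newton_polygon_def by blast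
  then show ?thesis using that xe unfolding face_terms_def by blast
qed

lemma face_terms_nonempty: "\<Gamma> face_of polygon \<Longrightarrow> \<Gamma> \<noteq> {} \<Longrightarrow> face_terms \<Gamma> \<noteq> {}"
  using face_vertex by blast

lemma face_normal:
  assumes "\<Gamma> face_of polygon" "\<Gamma> \<noteq> {}"
  obtains n where "n \<in> dual_cone polygon \<Gamma>"
    "\<And>p q. \<lbrakk>p \<in> \<Gamma>; q \<in> polygon; q \<notin> \<Gamma>\<rbrakk> \<Longrightarrow> n \<bullet> q < n \<bullet> p"
proof -
  have "\<Gamma> exposed_face_of polygon"
    using assms polytope_polygon by (simp add: exposed_face_of_polyhedron polytope_imp_polyhedron)
  then obtain n b where n: "polygon \<subseteq> {x. n \<bullet> x \<le> b}" "\<Gamma> = polygon \<inter> {x. n \<bullet> x = b}"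
    unfolding exposed_face_of_def by blast
  have "n \<in> dual_cone polygon \<Gamma>" using n unfolding dual_cone_def by auto
  moreover have "n \<bullet> q < n \<bullet> p" if "p \<in> \<Gamma>" "q \<in> polygon" "q \<notin> \<Gamma>" for p q
  proof -
    have "n \<bullet> p = b" using that(1) unfolding n(2) by simp
    moreover have "n \<bullet> q \<le> b" using that(2) n(1) by blast
    moreover have "n \<bullet> q \<noteq> b" using that(2,3) unfolding n(2) by blast
    ultimately show ?thesis by simp
  qed
  ultimately show ?thesis by (rule that)
qed

definition max_face :: "real^2 \<Rightarrow> (real^2) set" where
  "max_face w = {p\<in>polygon. \<forall>q\<in>polygon. w \<bullet> q \<le> w \<bullet> p}"

lemma max_face: "max_face w face_of polygon" "max_face w \<noteq> {}"
proof -
  have "polygon \<noteq> {}" using support_nonempty pt_in_polygon by blast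
  then obtain p where p: "p \<in> polygon" "\<And>q. q \<in> polygon \<Longrightarrow> w \<bullet> q \<le> w \<bullet> p"
  proof -
    have "continuous_on polygon (\<lambda>x. w \<bullet> x)" by (intro continuous_intros)
    then have "\<exists>p\<in>polygon. \<forall>q\<in>polygon. w \<bullet> q \<le> w \<bullet> p"
      using continuous_attains_sup[OF compact_polygon] \<open>polygon \<noteq> {}\<close> by blast
    then show thesis using that by blast
  qed
  have eq: "max_face w = polygon \<inter> {x. w \<bullet> x = w \<bullet> p}"
    unfolding max_face_def using p by (auto intro: antisym)
  show "max_face w face_of polygon" unfolding eq
    by (rule face_of_Int_supporting_hyperplane_le[OF convex_polygon p(2)])
  show "max_face w \<noteq> {}" unfolding eq using p(1) by blast
qed

lemma max_face_terms: "v \<in> face_terms (max_face w) \<longleftrightarrow> v \<in> A \<and> (\<forall>u\<in>A. pt u \<bullet> w \<le> pt v \<bullet> w)"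
proof -
  have "(\<forall>q\<in>polygon. w \<bullet> q \<le> w \<bullet> pt v) \<longleftrightarrow> (\<forall>u\<in>A. w \<bullet> pt u \<le> w \<bullet> pt v)"
    using polygon_le[of w "w \<bullet> pt v"] pt_in_polygon by blast
  then show ?thesis unfolding face_terms_def max_face_def
    using pt_in_polygon by (auto simp: inner_commute)
qed

text \<open>The normal cones of the vertices cover the connected set of nonzero directions. A direction
  that lies in two of them is normal to an edge with these vertices as end points, and the edge has even
  lattice length.\<close>

lemma polygon_vertices_congruent:
  assumes even: "strict_even_degree A" and u: "u \<in> A" "pt u extreme_point_of polygon"
    and v: "v \<in> A" "pt v extreme_point_of polygon"
  shows "mod2 u = mod2 v"
proof -
  define V where "V = {v\<in>A. pt v extreme_point_of polygon}"
  define N where "N v = {w. \<forall>q\<in>polygon. w \<bullet> q \<le> w \<bullet> pt v}" for v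
  have fV: "finite V" unfolding V_def using finite_support by simp
  have N: "closed (N v)" for v
  proof -
    have "(q - pt v) \<bullet> w \<le> 0 \<longleftrightarrow> w \<bullet> q \<le> w \<bullet> pt v" for q w
      unfolding inner_diff_left inner_commute[of w] by linarith
    then have "N v = (\<Inter>q\<in>polygon. {w. (q - pt v) \<bullet> w \<le> 0})" unfolding N_def by auto
    then show ?thesis by (auto intro!: closed_INT closed_halfspace_le)
  qed
  have start: "\<exists>w. w \<noteq> 0 \<and> w \<in> N v" if v: "v \<in> V" for v
  proof -
    have face: "{pt v} face_of polygon" using v unfolding V_def by (simp add: face_of_singleton)
    obtain n where n: "n \<in> dual_cone polygon {pt v}" "\<And>p q. \<lbrakk>p \<in> {pt v}; q \<in> polygon; q \<notin> {pt v}\<rbrakk> \<Longrightarrow> n \<bullet> q < n \<bullet> p"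
      using face_normal[OF face] by auto
    have "n \<noteq> 0"
    proof
      assume "n = 0"
      then have "q = pt v" if "q \<in> polygon" for q using n(2)[of "pt v" q] that by auto
      then have "pt u = pt v" if "u \<in> A" for u using that pt_in_polygon by blast
      then have "(axis 1 1 :: real^2) = 0" by (intro full_dim) metis
      then show False by (simp add: axis_eq_0_iff)
    qed
    then show ?thesis using n(1) unfolding dual_cone_def N_def by auto
  qed
  have uv: "u \<in> V" "v \<in> V" using u v unfolding V_def by auto
  obtain x y where xy: "x \<noteq> 0" "x \<in> N u" "y \<noteq> 0" "y \<in> N v" using start uv by metis
  have conn: "connected (- {0::real^2})" by (rule connected_punctured_universe) simp
  show ?thesis
  proof (rule closed_cover_propagation_euclidean[OF conn fV, of N "\<lambda>v. mod2 u = mod2 v" u x v y])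
    fix i j w assume *: "i \<in> V" "j \<in> V" "w \<in> - {0}" "w \<in> N i" "w \<in> N j" "mod2 u = mod2 i"
    show "mod2 u = mod2 j"
    proof (cases "i = j")
      case False
      let ?F = "max_face w"
      have ij: "pt i \<in> ?F" "pt j \<in> ?F"
        unfolding max_face_def using * pt_in_polygon unfolding N_def V_def by auto
      have "?F \<subseteq> {x. w \<bullet> x = w \<bullet> pt i}" using ij(1) unfolding max_face_def by (auto intro: antisym)
      then have "aff_dim ?F \<le> 1"
        using aff_dim_subset[of ?F "{x. w \<bullet> x = w \<bullet> pt i}"] aff_dim_hyperplane[of w] *(3) by simp
      moreover have "aff_dim ?F \<noteq> 0"
      proof
        assume "aff_dim ?F = 0"
        then obtain p where "?F = {p}" by (auto simp: aff_dim_eq_0)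
        then have "pt i = pt j" using ij by simp
        then show False using False by simp
      qed
      moreover have "aff_dim ?F \<noteq> - 1" using max_face(2) by (simp add: aff_dim_empty)
      moreover have "aff_dim ?F \<ge> - 1" by (rule aff_dim_geq)
      ultimately have dim: "aff_dim ?F = 1" by linarith
      have "compact ?F" "convex ?F"
        using max_face face_of_imp_compact[OF convex_polygon compact_polygon] face_of_imp_convex convex_polygon by blast+
      moreover have "collinear ?F" using dim by (simp add: collinear_aff_dim)
      ultimately obtain p q where pq: "?F = closed_segment p q"
        using compact_convex_collinear_segment max_face(2) by metis
      have "pt i extreme_point_of ?F" "pt j extreme_point_of ?F"
        using *(1,2) ij unfolding V_def extreme_point_of_face[OF max_face(1)] by auto
      then have "{p, q} = {pt i, pt j}"
        using False unfolding pq by (auto simp: extreme_point_of_segment)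
      then have "?F = closed_segment (pt i) (pt j)"
        unfolding pq by (simp add: segment_convex_hull)
      moreover have "even (lattice_length ?F)"
        using even max_face(1) dim unfolding strict_even_degree_def edge_of_def by blast
      ultimately have "mod2 i = mod2 j" using even_segment_mod2 by metis
      then show ?thesis using *(6) by simp
    qed (use * in simp)
  next
    show "- {0} \<subseteq> (\<Union>v\<in>V. N v)"
    proof
      fix w :: "real^2"
      obtain v where "v \<in> face_terms (max_face w)" "pt v extreme_point_of polygon"
        using face_vertex[OF max_face] .
      then show "w \<in> (\<Union>v\<in>V. N v)" unfolding V_def N_def face_terms_def max_face_def by blast
    qed
  qed (use uv xy N in auto)
qed

text \<open>A face contains a vertex \<open>v\<close>, which is congruent to \<open>v0\<close>, and \<open>\<alpha>\<close> has the same scalar product with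
  \<open>b\<close> as with \<open>v\<close>.\<close>

lemma orthogonal_parity:
  assumes even: "strict_even_degree A" and v0: "v0 \<in> A" "pt v0 extreme_point_of polygon"
    and \<Gamma>: "\<Gamma> face_of polygon" "\<Gamma> \<noteq> {}" and \<alpha>: "\<forall>x\<in>\<Gamma>. \<forall>y\<in>\<Gamma>. pt \<alpha> \<bullet> (x - y) = 0"
    and b: "b \<in> face_terms \<Gamma>"
  shows "bdot (mod2 \<alpha>) (mod2 b + mod2 v0) = 0"
proof -
  obtain v where v: "v \<in> face_terms \<Gamma>" "pt v extreme_point_of polygon" using face_vertex[OF \<Gamma>] .
  have "mod2 v0 = mod2 v"
    using polygon_vertices_congruent[OF even v0 _ v(2)] v(1) unfolding face_terms_def by blast
  moreover have "pt \<alpha> \<bullet> (pt b - pt v) = 0" using \<alpha> v(1) b unfolding face_terms_def by blast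
  then have "real_of_int (\<alpha>$1 * (b$1 - v$1) + \<alpha>$2 * (b$2 - v$2)) = 0" by (simp add: inner_2)
  then have z: "\<alpha>$1 * (b$1 - v$1) + \<alpha>$2 * (b$2 - v$2) = 0" by linarith
  have neg: "x - y = x + y" for x y :: bit by (cases x; cases y; simp)
  have "(of_int (\<alpha>$1 * (b$1 - v$1) + \<alpha>$2 * (b$2 - v$2)) :: bit) = 0" unfolding z by simp
  then have "bdot (mod2 \<alpha>) (mod2 b + mod2 v) = 0"
    unfolding bdot_def mod2_def by (simp only: of_int_add of_int_mult of_int_diff neg vector_add_component vec_lambda_beta)
  ultimately show ?thesis by simp
qed

end

section \<open>The tropical toric surface\<close>

lemma continuous_map_toric_eval:
  assumes "m \<in> chart_monomials \<sigma>"
  shows "continuous_map (chart_topology \<Sigma> \<sigma>) euclidean (\<lambda>p. toric_eval p m)"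
proof -
  have "continuous_map (chart_topology \<Sigma> \<sigma>) euclidean
      ((\<lambda>\<phi>. \<phi> m) \<circ> (\<lambda>p. restrict (toric_eval p) (chart_monomials \<sigma>)))"
    unfolding chart_topology_def
    by (rule continuous_map_pullback) (rule continuous_map_product_projection[OF assms])
  then show ?thesis using assms by (simp add: comp_def)
qed

lemma closedin_trop_toric:
  assumes "Y \<subseteq> toric_points \<Sigma>"
    and "\<And>\<sigma>. \<sigma> \<in> \<Sigma> \<Longrightarrow> closedin (chart_topology \<Sigma> \<sigma>) (Y \<inter> chart_points \<Sigma> \<sigma>)"
  shows "closedin (trop_toric \<Sigma>) Y"
  unfolding closedin_def topspace_trop_toric
proof (intro conjI assms(1))
  show "openin (trop_toric \<Sigma>) (toric_points \<Sigma> - Y)"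
    unfolding openin_trop_toric
  proof (intro conjI ballI Diff_subset)
    fix \<sigma> assume s: "\<sigma> \<in> \<Sigma>"
    have "chart_points \<Sigma> \<sigma> \<subseteq> toric_points \<Sigma>" unfolding chart_points_def toric_points_def by blast
    then have "(toric_points \<Sigma> - Y) \<inter> chart_points \<Sigma> \<sigma> =
      topspace (chart_topology \<Sigma> \<sigma>) - (Y \<inter> chart_points \<Sigma> \<sigma>)"
      unfolding topspace_chart_topology by blast
    then show "openin (chart_topology \<Sigma> \<sigma>) ((toric_points \<Sigma> - Y) \<inter> chart_points \<Sigma> \<sigma>)"
      using openin_diff[OF openin_topspace assms(2)[OF s]] by simp
  qed
qed

lemma inner_diff_flip: "(p - q) \<bullet> y = y \<bullet> p - y \<bullet> q" for p q y :: "'a::real_inner"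
  by (metis inner_commute inner_diff_left)

context tropical_polynomial
begin

abbreviation fan :: "(real^2) set set" where "fan \<equiv> dual_fan polygon"

definition is_face :: "(real^2) set \<Rightarrow> bool" where
  "is_face \<Gamma> \<longleftrightarrow> \<Gamma> face_of polygon \<and> \<Gamma> \<noteq> {}"

text \<open>The image of \<open>x\<close> in the stratum of \<open>\<Gamma>\<close>.\<close>

definition tpoint :: "(real^2) set \<Rightarrow> real^2 \<Rightarrow> toric_point" where
  "tpoint \<Gamma> x = (dual_cone polygon \<Gamma>, (+) x ` span (dual_cone polygon \<Gamma>))"

lemma polygon_face: "is_face polygon"
  unfolding is_face_def using face_of_refl[OF convex_polygon] support_nonempty pt_in_polygon by blast

lemma face_subset_polygon: "is_face \<Gamma> \<Longrightarrow> \<Gamma> \<subseteq> polygon"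
  unfolding is_face_def using face_of_imp_subset by blast

lemma dual_cone_tie:
  assumes "is_face \<Gamma>" "y \<in> dual_cone polygon \<Gamma>" "p \<in> \<Gamma>" "q \<in> \<Gamma>"
  shows "y \<bullet> p = y \<bullet> q"
proof (rule antisym)
  have pq: "p \<in> polygon" "q \<in> polygon" using assms face_subset_polygon by blast+
  show "y \<bullet> p \<le> y \<bullet> q" "y \<bullet> q \<le> y \<bullet> p" using assms(2,3,4) pq unfolding dual_cone_def by blast+
qed

lemma span_dual_cone_tie:
  assumes "is_face \<Gamma>" "y \<in> span (dual_cone polygon \<Gamma>)" "p \<in> \<Gamma>" "q \<in> \<Gamma>"
  shows "y \<bullet> p = y \<bullet> q"
proof -
  have "span (dual_cone polygon \<Gamma>) \<subseteq> {y. (p - q) \<bullet> y = 0}"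
    using dual_cone_tie[OF assms(1) _ assms(3,4)]
    by (intro span_minimal subspace_hyperplane) (auto simp: inner_diff_flip)
  then have "(p - q) \<bullet> y = 0" using assms(2) by blast
  then show ?thesis unfolding inner_diff_flip by simp
qed

text \<open>A normal vector that exposes \<open>\<Gamma>\<close> is also maximal on \<open>\<Gamma>'\<close>.\<close>

lemma dual_cone_mono_face:
  assumes \<Gamma>: "is_face \<Gamma>" and \<Gamma>': "is_face \<Gamma>'" and sub: "dual_cone polygon \<Gamma> \<subseteq> dual_cone polygon \<Gamma>'"
  shows "\<Gamma>' \<subseteq> \<Gamma>"
proof
  fix q assume q: "q \<in> \<Gamma>'"
  obtain n where n: "n \<in> dual_cone polygon \<Gamma>"
    "\<And>p q. \<lbrakk>p \<in> \<Gamma>; q \<in> polygon; q \<notin> \<Gamma>\<rbrakk> \<Longrightarrow> n \<bullet> q < n \<bullet> p"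
    using face_normal \<Gamma> unfolding is_face_def by blast
  obtain p where p: "p \<in> \<Gamma>" using \<Gamma> unfolding is_face_def by blast
  have "n \<bullet> p \<le> n \<bullet> q" using n(1) sub q p face_subset_polygon[OF \<Gamma>] unfolding dual_cone_def by blast
  then show "q \<in> \<Gamma>" using n(2)[OF p, of q] q face_subset_polygon[OF \<Gamma>'] by force
qed

lemma dual_cone_eq_iff: "\<lbrakk>is_face \<Gamma>; is_face \<Gamma>'; dual_cone polygon \<Gamma> = dual_cone polygon \<Gamma>'\<rbrakk> \<Longrightarrow> \<Gamma> = \<Gamma>'"
  using dual_cone_mono_face by (metis order_refl subset_antisym)

abbreviation fterms :: "(real^2) set \<Rightarrow> real^2 \<Rightarrow> (int^2) set" where
  "fterms \<Gamma> x \<equiv> max_terms (face_terms \<Gamma>) a x"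

lemma mem_fterms: "v \<in> fterms \<Gamma> x \<longleftrightarrow> v \<in> face_terms \<Gamma> \<and> (\<forall>u\<in>face_terms \<Gamma>. term_val a u x \<le> term_val a v x)"
  by (rule mem_max_terms[OF finite_face_terms])

lemma fterms_nonempty: "is_face \<Gamma> \<Longrightarrow> fterms \<Gamma> x \<noteq> {}"
  unfolding is_face_def by (intro max_terms_nonempty finite_face_terms face_terms_nonempty) auto

lemma face_terms_polygon: "face_terms polygon = A"
  unfolding face_terms_def using pt_in_polygon by blast

text \<open>Two representatives differ by a vector that is constant on \<open>\<Gamma>\<close>, which leaves the comparison
  of terms on \<open>\<Gamma>\<close> unchanged.\<close>

lemma tpoint_eq:
  assumes "is_face \<Gamma>" "is_face \<Gamma>'" "tpoint \<Gamma> x = tpoint \<Gamma>' x'"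
  shows "\<Gamma>' = \<Gamma>" "fterms \<Gamma>' x' = fterms \<Gamma> x"
proof -
  show \<Gamma>: "\<Gamma>' = \<Gamma>" using assms dual_cone_eq_iff unfolding tpoint_def by (metis prod.inject)
  have "x' + 0 \<in> (+) x ` span (dual_cone polygon \<Gamma>)"
    using assms(3) span_0 unfolding tpoint_def \<Gamma> by (metis image_eqI prod.inject)
  then obtain s where s: "s \<in> span (dual_cone polygon \<Gamma>)" "x' = x + s" by auto
  have tie: "pt u \<bullet> s = pt v \<bullet> s" if "u \<in> face_terms \<Gamma>" "v \<in> face_terms \<Gamma>" for u v
    using span_dual_cone_tie[OF assms(1) s(1), of "pt u" "pt v"] that
    unfolding face_terms_def by (simp add: inner_commute)
  then show "fterms \<Gamma>' x' = fterms \<Gamma> x"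
  proof (intro set_eqI)
    fix v
    have "term_val a u x' \<le> term_val a v x' \<longleftrightarrow> term_val a u x \<le> term_val a v x"
      if "u \<in> face_terms \<Gamma>" "v \<in> face_terms \<Gamma>" for u
      using tie[OF that] unfolding s(2) by (simp add: inner_add_right)
    then show "v \<in> fterms \<Gamma>' x' \<longleftrightarrow> v \<in> fterms \<Gamma> x" unfolding \<Gamma> mem_fterms by blast
  qed
qed

lemma toric_points_fan: "toric_points fan = {tpoint \<Gamma> x | \<Gamma> x. is_face \<Gamma>}"
  unfolding toric_points_def dual_fan_def stratum_def tpoint_def is_face_def by auto

lemma stratum_face: "stratum (dual_cone polygon \<Gamma>) = range (tpoint \<Gamma>)"
  unfolding stratum_def tpoint_def by auto

lemma toric_eval_tpoint:
  "toric_eval (tpoint \<Gamma> x) m =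
    (if \<forall>w\<in>dual_cone polygon \<Gamma>. pt m \<bullet> w = 0 then ereal (pt m \<bullet> x) else - \<infinity>)"
proof -
  have "pt m \<bullet> (SOME y. y \<in> (+) x ` span (dual_cone polygon \<Gamma>)) = pt m \<bullet> x"
    if v: "\<forall>w\<in>dual_cone polygon \<Gamma>. pt m \<bullet> w = 0"
  proof -
    have "x + 0 \<in> (+) x ` span (dual_cone polygon \<Gamma>)" using span_0 by blast
    then have "(SOME y. y \<in> (+) x ` span (dual_cone polygon \<Gamma>)) \<in> (+) x ` span (dual_cone polygon \<Gamma>)"
      using some_in_eq by blast
    then obtain s where s: "s \<in> span (dual_cone polygon \<Gamma>)"
      "(SOME y. y \<in> (+) x ` span (dual_cone polygon \<Gamma>)) = x + s" by blast
    have "span (dual_cone polygon \<Gamma>) \<subseteq> {y. pt m \<bullet> y = 0}"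
      using v by (intro span_minimal subspace_hyperplane) auto
    then have "pt m \<bullet> s = 0" using s(1) by blast
    then show ?thesis unfolding s(2) by (simp add: inner_add_right)
  qed
  then show ?thesis unfolding toric_eval_def tpoint_def by simp
qed

lemma fan_cone: "\<sigma> \<in> fan \<longleftrightarrow> (\<exists>\<Gamma>. is_face \<Gamma> \<and> \<sigma> = dual_cone polygon \<Gamma>)"
  unfolding dual_fan_def is_face_def by blast

lemma tpoint_in_chart:
  assumes "is_face \<Gamma>" "is_face \<Gamma>'" "tpoint \<Gamma> x \<in> chart_points fan (dual_cone polygon \<Gamma>')"
  shows "\<Gamma>' \<subseteq> \<Gamma>"
proof -
  obtain \<tau> where "\<tau> face_of dual_cone polygon \<Gamma>'" "tpoint \<Gamma> x \<in> stratum \<tau>"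
    using assms(3) unfolding chart_points_def by blast
  then have "dual_cone polygon \<Gamma> \<subseteq> dual_cone polygon \<Gamma>'"
    unfolding tpoint_def stratum_def using face_of_imp_subset by fastforce
  then show ?thesis by (rule dual_cone_mono_face[OF assms(1,2)])
qed

lemma chart_monomial_diff:
  assumes "w \<in> face_terms \<Gamma>" "u \<in> A"
  shows "u - w \<in> chart_monomials (dual_cone polygon \<Gamma>)"
  unfolding chart_monomials_def dual_cone_def
  using assms pt_in_polygon unfolding face_terms_def
  by (auto simp: pt_diff inner_diff_flip)

text \<open>With exponents measured from a point \<open>w\<close> of the face of the chart, all monomials of the polynomial are
  regular in the chart, and those off the face of the stratum take the value \<open>-\<infinity>\<close>.\<close>

lemma toric_eval_diff:
  assumes \<Gamma>: "is_face \<Gamma>" and w: "w \<in> face_terms \<Gamma>" and u: "u \<in> A"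
  shows "toric_eval (tpoint \<Gamma> x) (u - w) =
    (if u \<in> face_terms \<Gamma> then ereal (pt u \<bullet> x - pt w \<bullet> x) else - \<infinity>)"
proof -
  have "(\<forall>y\<in>dual_cone polygon \<Gamma>. pt (u - w) \<bullet> y = 0) \<longleftrightarrow> u \<in> face_terms \<Gamma>"
  proof
    assume v: "\<forall>y\<in>dual_cone polygon \<Gamma>. pt (u - w) \<bullet> y = 0"
    obtain n where n: "n \<in> dual_cone polygon \<Gamma>"
      "\<And>p q. \<lbrakk>p \<in> \<Gamma>; q \<in> polygon; q \<notin> \<Gamma>\<rbrakk> \<Longrightarrow> n \<bullet> q < n \<bullet> p"
      using face_normal \<Gamma> unfolding is_face_def by blast
    have "n \<bullet> pt u = n \<bullet> pt w" using v n(1) by (simp add: pt_diff inner_diff_flip)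
    then show "u \<in> face_terms \<Gamma>"
      using n(2)[of "pt w" "pt u"] w u pt_in_polygon unfolding face_terms_def by force
  next
    assume "u \<in> face_terms \<Gamma>"
    then have "y \<bullet> pt u = y \<bullet> pt w" if "y \<in> dual_cone polygon \<Gamma>" for y
      using dual_cone_tie[OF \<Gamma> that] w unfolding face_terms_def by blast
    then show "\<forall>y\<in>dual_cone polygon \<Gamma>. pt (u - w) \<bullet> y = 0"
      by (simp add: pt_diff inner_diff_flip)
  qed
  then show ?thesis unfolding toric_eval_tpoint by (simp add: pt_diff inner_diff_left)
qed

definition toric_cell :: "int^2 \<Rightarrow> toric_point set" where
  "toric_cell v = {tpoint \<Gamma> x | \<Gamma> x. is_face \<Gamma> \<and> v \<in> fterms \<Gamma> x}"

lemma tpoint_in_toric_cell: "is_face \<Gamma> \<Longrightarrow> tpoint \<Gamma> x \<in> toric_cell v \<longleftrightarrow> v \<in> fterms \<Gamma> x"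
  unfolding toric_cell_def using tpoint_eq by blast

text \<open>Dominance as a condition on the coordinates of a chart. The inequality between the terms
  \<open>u\<close> and \<open>v\<close> is tested by the real numbers \<open>c\<close> in between, which keeps clear of sums in the extended
  reals and makes the failure visibly an open condition.\<close>

lemma fterms_by_eval:
  assumes \<Gamma>: "is_face \<Gamma>" and w: "w \<in> face_terms \<Gamma>" and v: "v \<in> A"
  shows "v \<in> fterms \<Gamma> x \<longleftrightarrow> (\<forall>u\<in>A. \<forall>c. \<not> (ereal (c - a u) < toric_eval (tpoint \<Gamma> x) (u - w) \<and>
      toric_eval (tpoint \<Gamma> x) (v - w) < ereal (c - a v)))"
    (is "_ \<longleftrightarrow> ?R")
proof
  assume vf: "v \<in> fterms \<Gamma> x"
  show ?R
  proof (intro ballI allI notI)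
    fix u c assume u: "u \<in> A" and h: "ereal (c - a u) < toric_eval (tpoint \<Gamma> x) (u - w) \<and>
      toric_eval (tpoint \<Gamma> x) (v - w) < ereal (c - a v)"
    have "u \<in> face_terms \<Gamma>" using h unfolding toric_eval_diff[OF \<Gamma> w u] by (auto split: if_splits)
    moreover have "v \<in> face_terms \<Gamma>" using vf mem_fterms by blast
    ultimately show False
      using h vf unfolding toric_eval_diff[OF \<Gamma> w u] toric_eval_diff[OF \<Gamma> w v] mem_fterms by force
  qed
next
  assume R: ?R
  have vf: "v \<in> face_terms \<Gamma>"
  proof (rule ccontr)
    assume "v \<notin> face_terms \<Gamma>"
    then have "toric_eval (tpoint \<Gamma> x) (v - w) = - \<infinity>" by (simp add: toric_eval_diff[OF \<Gamma> w v])
    moreover have wA: "w \<in> A" using w face_terms_subset by blast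
    then have "toric_eval (tpoint \<Gamma> x) (w - w) = 0"
      unfolding toric_eval_diff[OF \<Gamma> w wA] using w by (simp add: zero_ereal_def)
    \<comment> \<open>The term \<open>w\<close> is finite at this point, so any \<open>c\<close> below its value \<open>a w\<close> separates it from \<open>-\<infinity>\<close>.\<close>
    ultimately show False
      using R[rule_format, OF wA, of "a w - 1"] by (simp add: zero_ereal_def)
  qed
  show "v \<in> fterms \<Gamma> x"
    unfolding mem_fterms
  proof (intro conjI ballI vf)
    fix u assume u: "u \<in> face_terms \<Gamma>"
    then have uA: "u \<in> A" using face_terms_subset by blast
    show "term_val a u x \<le> term_val a v x"
    proof (rule ccontr)
      assume n: "\<not> ?thesis"
      define c where "c = (term_val a u x + term_val a v x) / 2 - pt w \<bullet> x"
      have "c - a u < pt u \<bullet> x - pt w \<bullet> x" "pt v \<bullet> x - pt w \<bullet> x < c - a v"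
        using n unfolding c_def by (simp_all add: field_simps)
      then show False
        using R[rule_format, OF uA, of c] u vf
        unfolding toric_eval_diff[OF \<Gamma> w uA] toric_eval_diff[OF \<Gamma> w v] by simp
    qed
  qed
qed

lemma closedin_toric_cell:
  assumes v: "v \<in> A"
  shows "closedin (trop_toric fan) (toric_cell v)"
proof (rule closedin_trop_toric)
  show "toric_cell v \<subseteq> toric_points fan" unfolding toric_cell_def toric_points_fan by blast
  fix \<sigma> assume "\<sigma> \<in> fan"
  then obtain \<Gamma>' where \<Gamma>': "is_face \<Gamma>'" and \<sigma>: "\<sigma> = dual_cone polygon \<Gamma>'" unfolding fan_cone by blast
  obtain w where w: "w \<in> face_terms \<Gamma>'" using face_terms_nonempty \<Gamma>' unfolding is_face_def by blast
  let ?X = "chart_topology fan \<sigma>"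
  define H where "H u c = {p \<in> topspace ?X. toric_eval p (u - w) \<in> {ereal (c - a u)<..}} \<inter>
    {p \<in> topspace ?X. toric_eval p (v - w) \<in> {..<ereal (c - a v)}}" for u c
  have H: "openin ?X (H u c)" if "u \<in> A" for u c
    unfolding H_def \<sigma>
    by (intro openin_Int openin_continuous_map_preimage[OF continuous_map_toric_eval]
        chart_monomial_diff[OF w] that v) auto
  have "toric_cell v \<inter> chart_points fan \<sigma> = topspace ?X - (\<Union>u\<in>A. \<Union>c. H u c)"
  proof -
    have "p \<in> toric_cell v \<longleftrightarrow> p \<notin> (\<Union>u\<in>A. \<Union>c. H u c)" if p: "p \<in> chart_points fan \<sigma>" for p
    proof -
      have "p \<in> toric_points fan" using p unfolding chart_points_def toric_points_def by blast
      then obtain \<Gamma> x where \<Gamma>: "is_face \<Gamma>" and px: "p = tpoint \<Gamma> x" unfolding toric_points_fan by blast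
      have "\<Gamma>' \<subseteq> \<Gamma>" using tpoint_in_chart[OF \<Gamma> \<Gamma>'] p px \<sigma> by blast
      then have "w \<in> face_terms \<Gamma>" using w unfolding face_terms_def by blast
      have "p \<in> toric_cell v \<longleftrightarrow> (\<forall>u\<in>A. \<forall>c. \<not> (ereal (c - a u) < toric_eval p (u - w) \<and>
          toric_eval p (v - w) < ereal (c - a v)))"
        unfolding px tpoint_in_toric_cell[OF \<Gamma>] by (rule fterms_by_eval[OF \<Gamma> \<open>w \<in> face_terms \<Gamma>\<close> v])
      then show ?thesis unfolding H_def topspace_chart_topology using p by auto
    qed
    then show ?thesis unfolding topspace_chart_topology by blast
  qed
  then show "closedin ?X (toric_cell v \<inter> chart_points fan \<sigma>)"
    using H by (simp only:) (intro closedin_diff closedin_topspace openin_Union, blast)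
qed

definition toric_strata :: "(real^2) set \<Rightarrow> toric_point set" where
  "toric_strata \<Gamma>0 = {tpoint \<Gamma> x | \<Gamma> x. is_face \<Gamma> \<and> \<Gamma> \<subseteq> \<Gamma>0}"

lemma face_subset_iff:
  assumes "is_face \<Gamma>" "is_face \<Gamma>0"
  shows "\<Gamma> \<subseteq> \<Gamma>0 \<longleftrightarrow> face_terms \<Gamma> \<subseteq> face_terms \<Gamma>0"
proof
  assume sub: "face_terms \<Gamma> \<subseteq> face_terms \<Gamma>0"
  have "compact \<Gamma>" "convex \<Gamma>" "convex \<Gamma>0"
    using assms face_of_imp_compact[OF convex_polygon compact_polygon] face_of_imp_convex convex_polygon
    unfolding is_face_def by blast+
  have "{x. x extreme_point_of \<Gamma>} \<subseteq> \<Gamma>0"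
  proof
    fix x assume "x \<in> {x. x extreme_point_of \<Gamma>}"
    then have x: "x extreme_point_of polygon" "x \<in> \<Gamma>"
      using extreme_point_of_face assms unfolding is_face_def by blast+
    then have "x \<in> pt ` A" using extreme_point_of_convex_hull unfolding newton_polygon_def by blast
    then show "x \<in> \<Gamma>0" using sub x(2) unfolding face_terms_def by blast
  qed
  then have "convex hull {x. x extreme_point_of \<Gamma>} \<subseteq> \<Gamma>0" using \<open>convex \<Gamma>0\<close> by (rule hull_minimal)
  then show "\<Gamma> \<subseteq> \<Gamma>0" using Krein_Milman_Minkowski[OF \<open>compact \<Gamma>\<close> \<open>convex \<Gamma>\<close>] by simp
qed (auto simp: face_terms_def)

text \<open>In a chart these strata are defined by the vanishing (the value \<open>-\<infinity>\<close>) of the monomials off \<open>\<Gamma>0\<close>.\<close>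

lemma closedin_toric_strata:
  assumes \<Gamma>0: "is_face \<Gamma>0"
  shows "closedin (trop_toric fan) (toric_strata \<Gamma>0)"
proof (rule closedin_trop_toric)
  show "toric_strata \<Gamma>0 \<subseteq> toric_points fan" unfolding toric_strata_def toric_points_fan by blast
  fix \<sigma> assume "\<sigma> \<in> fan"
  then obtain \<Gamma>' where \<Gamma>': "is_face \<Gamma>'" and \<sigma>: "\<sigma> = dual_cone polygon \<Gamma>'" unfolding fan_cone by blast
  obtain w where w: "w \<in> face_terms \<Gamma>'" using face_terms_nonempty \<Gamma>' unfolding is_face_def by blast
  let ?X = "chart_topology fan \<sigma>"
  define Z where "Z u = {p \<in> topspace ?X. toric_eval p (u - w) \<in> {- \<infinity>}}" for u
  have Z: "closedin ?X (Z u)" if "u \<in> A" for u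
    unfolding Z_def \<sigma>
    by (rule closedin_continuous_map_preimage[OF continuous_map_toric_eval[OF chart_monomial_diff[OF w that]]]) simp
  have eq: "toric_strata \<Gamma>0 \<inter> chart_points fan \<sigma> = topspace ?X \<inter> (\<Inter>u\<in>A - face_terms \<Gamma>0. Z u)"
  proof -
    have "p \<in> toric_strata \<Gamma>0 \<longleftrightarrow> p \<in> (\<Inter>u\<in>A - face_terms \<Gamma>0. Z u)" if p: "p \<in> chart_points fan \<sigma>" for p
    proof -
      have "p \<in> toric_points fan" using p unfolding chart_points_def toric_points_def by blast
      then obtain \<Gamma> x where \<Gamma>: "is_face \<Gamma>" and px: "p = tpoint \<Gamma> x" unfolding toric_points_fan by blast
      have "\<Gamma>' \<subseteq> \<Gamma>" using tpoint_in_chart[OF \<Gamma> \<Gamma>'] p px \<sigma> by blast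
      then have wf: "w \<in> face_terms \<Gamma>" using w unfolding face_terms_def by blast
      have "p \<in> toric_strata \<Gamma>0 \<longleftrightarrow> \<Gamma> \<subseteq> \<Gamma>0"
        unfolding toric_strata_def px using \<Gamma> tpoint_eq(1) by blast
      also have "\<dots> \<longleftrightarrow> face_terms \<Gamma> \<subseteq> face_terms \<Gamma>0" by (rule face_subset_iff[OF \<Gamma> \<Gamma>0])
      also have "\<dots> \<longleftrightarrow> (\<forall>u\<in>A - face_terms \<Gamma>0. toric_eval p (u - w) = - \<infinity>)"
      proof -
        have "toric_eval p (u - w) = - \<infinity> \<longleftrightarrow> u \<notin> face_terms \<Gamma>" if "u \<in> A" for u
          unfolding px toric_eval_diff[OF \<Gamma> wf that] by simp
        then show ?thesis using face_terms_subset[of \<Gamma>] by blast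
      qed
      finally show ?thesis unfolding Z_def topspace_chart_topology using p by auto
    qed
    then show ?thesis unfolding topspace_chart_topology by blast
  qed
  show "closedin ?X (toric_strata \<Gamma>0 \<inter> chart_points fan \<sigma>)"
  proof (cases "A - face_terms \<Gamma>0 = {}")
    case False
    then show ?thesis unfolding eq using Z by (intro closedin_Int closedin_INT closedin_topspace) auto
  next
    case True
    show ?thesis unfolding eq True by simp
  qed
qed

lemma dual_cone_polygon: "dual_cone polygon polygon = {0}"
proof -
  have "y = 0" if y: "y \<in> dual_cone polygon polygon" for y
    using dual_cone_tie[OF polygon_face y] pt_in_polygon by (intro full_dim) (metis inner_commute)
  then show ?thesis unfolding dual_cone_def by auto
qed

lemma toric_incl_tpoint: "toric_incl x = tpoint polygon x"
  unfolding toric_incl_def tpoint_def dual_cone_polygon by simp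

text \<open>The cones contain no line since the polygon is two-dimensional. Consequently the plane is contained
  in every chart.\<close>

lemma zero_face_of_dual_cone:
  assumes "is_face \<Gamma>"
  shows "{0} face_of dual_cone polygon \<Gamma>"
  unfolding face_of_singleton extreme_point_of_def
proof (intro conjI ballI notI)
  show "0 \<in> dual_cone polygon \<Gamma>" unfolding dual_cone_def by simp
  fix y z assume y: "y \<in> dual_cone polygon \<Gamma>" and z: "z \<in> dual_cone polygon \<Gamma>" and 0: "0 \<in> open_segment y z"
  obtain k where k: "0 < k" "k < 1" "0 = (1 - k) *\<^sub>R y + k *\<^sub>R z" and ne: "y \<noteq> z"
    using 0 unfolding in_segment by blast
  obtain v where v: "v \<in> \<Gamma>" using assms unfolding is_face_def by blast
  have "y \<bullet> q = y \<bullet> v" if q: "q \<in> polygon" for q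
  proof -
    have 1: "y \<bullet> q \<le> y \<bullet> v" "z \<bullet> q \<le> z \<bullet> v" using y z v q unfolding dual_cone_def by blast+
    have "0 \<bullet> (v - q) = (1 - k) * (y \<bullet> (v - q)) + k * (z \<bullet> (v - q))"
      by (subst k(3)) (simp add: inner_add_left)
    moreover have "0 \<le> k * (z \<bullet> (v - q))" using k 1 by (simp add: inner_diff_right)
    moreover have "0 \<le> (1 - k) * (y \<bullet> (v - q))" using k 1 by (simp add: inner_diff_right)
    ultimately have "(1 - k) * (y \<bullet> (v - q)) = 0" by (simp only: inner_zero_left)
    then show ?thesis using k by (simp add: inner_diff_right)
  qed
  then have "y = 0" using pt_in_polygon by (intro full_dim) (metis inner_commute)
  then have "z = 0" using k by simp
  then show False using ne \<open>y = 0\<close> by simp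
qed

lemma toric_incl_in_chart:
  assumes "is_face \<Gamma>"
  shows "toric_incl x \<in> chart_points fan (dual_cone polygon \<Gamma>)"
proof -
  have "{0} \<in> fan" using polygon_face dual_cone_polygon unfolding fan_cone by metis
  moreover have "toric_incl x \<in> stratum {0}" unfolding toric_incl_tpoint using stratum_face[of polygon] dual_cone_polygon by auto
  ultimately show ?thesis using zero_face_of_dual_cone[OF assms] unfolding chart_points_def by blast
qed

lemma toric_eval_incl: "toric_eval (toric_incl x) m = ereal (pt m \<bullet> x)"
  unfolding toric_incl_tpoint toric_eval_tpoint dual_cone_polygon by simp

lemma continuous_toric_incl: "continuous_map euclidean (trop_toric fan) toric_incl"
  unfolding continuous_map_def
proof (intro conjI allI impI)
  show "toric_incl \<in> topspace euclidean \<rightarrow> topspace (trop_toric fan)"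
    unfolding topspace_trop_toric toric_points_fan toric_incl_tpoint using polygon_face by auto
  fix U assume U: "openin (trop_toric fan) U"
  let ?\<sigma> = "dual_cone polygon polygon"
  have "continuous_map euclidean (product_topology (\<lambda>m. euclidean) (chart_monomials ?\<sigma>))
      ((\<lambda>p. restrict (toric_eval p) (chart_monomials ?\<sigma>)) \<circ> toric_incl)"
    unfolding continuous_map_componentwise
    by (auto simp: comp_def toric_eval_incl intro!: continuous_intros)
  then have "continuous_map euclidean (chart_topology fan ?\<sigma>) toric_incl"
    unfolding chart_topology_def
    by (rule continuous_map_pullback') (use toric_incl_in_chart[OF polygon_face] in auto)
  moreover have "openin (chart_topology fan ?\<sigma>) (U \<inter> chart_points fan ?\<sigma>)"
  proof -
    have "?\<sigma> \<in> fan" using polygon_face fan_cone by blast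
    then show ?thesis using U unfolding openin_trop_toric by blast
  qed
  ultimately have "openin euclidean {x \<in> topspace euclidean. toric_incl x \<in> U \<inter> chart_points fan ?\<sigma>}"
    by (rule openin_continuous_map_preimage)
  then show "openin euclidean {x \<in> topspace euclidean. toric_incl x \<in> U}"
    using toric_incl_in_chart[OF polygon_face] by simp
qed

definition outward_normal :: "(real^2) set \<Rightarrow> real^2 \<Rightarrow> bool" where
  "outward_normal \<Gamma> n \<longleftrightarrow> n \<in> dual_cone polygon \<Gamma> \<and>
     (\<forall>p\<in>\<Gamma>. \<forall>q\<in>polygon. q \<notin> \<Gamma> \<longrightarrow> n \<bullet> q < n \<bullet> p)"

lemma outward_normalD:
  assumes "outward_normal \<Gamma> n"
  shows "n \<in> dual_cone polygon \<Gamma>" "\<And>p q. \<lbrakk>p \<in> \<Gamma>; q \<in> polygon; q \<notin> \<Gamma>\<rbrakk> \<Longrightarrow> n \<bullet> q < n \<bullet> p"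
  using assms unfolding outward_normal_def by blast+

lemma outward_normal_exists:
  assumes "is_face \<Gamma>"
  obtains n where "outward_normal \<Gamma> n"
  using face_normal assms unfolding is_face_def outward_normal_def by (metis (no_types, lifting))

text \<open>An outward normal lies in the relative interior of the dual cone: \<open>n\<close> remains in the cone when a
  small multiple of \<open>y\<close> is subtracted.\<close>

lemma chart_monomial_negative:
  assumes \<Gamma>: "is_face \<Gamma>" and out: "outward_normal \<Gamma> n"
    and m: "m \<in> chart_monomials (dual_cone polygon \<Gamma>)" "y \<in> dual_cone polygon \<Gamma>" "pt m \<bullet> y \<noteq> 0"
  shows "pt m \<bullet> n < 0"
proof (rule ccontr)
  note n = outward_normalD[OF out]
  assume "\<not> ?thesis"
  moreover have "pt m \<bullet> n \<le> 0" using m(1) n(1) unfolding chart_monomials_def by blast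
  ultimately have mn: "pt m \<bullet> n = 0" by simp
  have my: "pt m \<bullet> y < 0" using m unfolding chart_monomials_def by force
  obtain p where p: "p \<in> \<Gamma>" using \<Gamma> unfolding is_face_def by blast
  have "\<forall>\<^sub>F s in at_right 0. (n - s *\<^sub>R y) \<bullet> pt u \<le> (n - s *\<^sub>R y) \<bullet> p" if u: "u \<in> A" for u
  proof (cases "pt u \<in> \<Gamma>")
    case True
    then have "n \<bullet> pt u = n \<bullet> p" "y \<bullet> pt u = y \<bullet> p" using dual_cone_tie[OF \<Gamma>] n(1) m(2) p by blast+
    then show ?thesis by (simp add: inner_diff_left)
  next
    case False
    have "((\<lambda>s. (n - s *\<^sub>R y) \<bullet> (p - pt u)) \<longlongrightarrow> (n - 0 *\<^sub>R y) \<bullet> (p - pt u)) (at_right 0)"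
      by (intro tendsto_intros)
    then have "\<forall>\<^sub>F s in at_right 0. 0 < (n - s *\<^sub>R y) \<bullet> (p - pt u)"
      by (rule order_tendstoD) (use n(2)[OF p pt_in_polygon[OF u] False] in \<open>simp add: inner_diff_right\<close>)
    then show ?thesis by eventually_elim (simp add: inner_diff_right)
  qed
  then have "\<forall>\<^sub>F s in at_right 0. \<forall>u\<in>A. (n - s *\<^sub>R y) \<bullet> pt u \<le> (n - s *\<^sub>R y) \<bullet> p"
    using finite_support by (intro eventually_ball_finite) auto
  then have "\<forall>\<^sub>F s in at_right (0::real). (\<forall>u\<in>A. (n - s *\<^sub>R y) \<bullet> pt u \<le> (n - s *\<^sub>R y) \<bullet> p) \<and> 0 < s"
    using eventually_at_right_less[of "0::real"] by (rule eventually_conj)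
  then obtain s where s: "\<And>u. u \<in> A \<Longrightarrow> (n - s *\<^sub>R y) \<bullet> pt u \<le> (n - s *\<^sub>R y) \<bullet> p" "0 < s"
    using eventually_happens'[OF trivial_limit_at_right_real] by blast
  have "n - s *\<^sub>R y \<in> dual_cone polygon \<Gamma>"
    unfolding dual_cone_def
  proof (intro CollectI ballI)
    fix p' q assume p': "p' \<in> \<Gamma>" and q: "q \<in> polygon"
    have "n \<bullet> p' = n \<bullet> p" "y \<bullet> p' = y \<bullet> p" using dual_cone_tie[OF \<Gamma>] n(1) m(2) p p' by blast+
    then show "(n - s *\<^sub>R y) \<bullet> q \<le> (n - s *\<^sub>R y) \<bullet> p'"
      using polygon_le[OF s(1) q] by (simp add: inner_diff_left)
  qed
  then have "pt m \<bullet> (n - s *\<^sub>R y) \<le> 0" using m(1) unfolding chart_monomials_def by blast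
  then have "0 \<le> s * (pt m \<bullet> y)" using mn by (simp add: inner_diff_right)
  then show False using my s(2) by (simp add: zero_le_mult_iff)
qed

text \<open>Along the ray from \<open>x\<close> in direction \<open>n\<close>, the monomials that vanish on the cone are constant
  and all other monomials of the chart tend to \<open>-\<infinity>\<close>.\<close>

lemma toric_incl_tends:
  assumes \<Gamma>: "is_face \<Gamma>" and out: "outward_normal \<Gamma> n"
    and U: "openin (trop_toric fan) U" "tpoint \<Gamma> x \<in> U"
  shows "\<forall>\<^sub>F t in at_top. toric_incl (x + t *\<^sub>R n) \<in> U"
proof -
  note n = outward_normalD[OF out]
  let ?\<sigma> = "dual_cone polygon \<Gamma>"
  let ?S = "chart_monomials ?\<sigma>"
  have \<sigma>: "?\<sigma> \<in> fan" using \<Gamma> fan_cone by blast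
  have "openin (chart_topology fan ?\<sigma>) (U \<inter> chart_points fan ?\<sigma>)"
    using U(1) \<sigma> unfolding openin_trop_toric by blast
  then obtain V where V: "openin (product_topology (\<lambda>m. euclidean) ?S) V"
    "U \<inter> chart_points fan ?\<sigma> = (\<lambda>p. restrict (toric_eval p) ?S) -` V \<inter> chart_points fan ?\<sigma>"
    unfolding chart_topology_def openin_pullback_topology by blast
  have "?\<sigma> face_of ?\<sigma>"
  proof -
    have "?\<sigma> = (\<Inter>p\<in>\<Gamma>. \<Inter>q\<in>polygon. {w. (q - p) \<bullet> w \<le> 0})"
      unfolding dual_cone_def by (auto simp: inner_diff_flip)
    then have "convex ?\<sigma>" by (auto intro!: convex_INT convex_halfspace_le)
    then show ?thesis by (rule face_of_refl)
  qed
  then have "tpoint \<Gamma> x \<in> chart_points fan ?\<sigma>"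
    unfolding chart_points_def using \<sigma> stratum_face by blast
  then have pV: "restrict (toric_eval (tpoint \<Gamma> x)) ?S \<in> V" using V(2) U(2) by blast
  have "limitin (product_topology (\<lambda>m. euclidean) ?S) (\<lambda>t. restrict (toric_eval (toric_incl (x + t *\<^sub>R n))) ?S)
      (restrict (toric_eval (tpoint \<Gamma> x)) ?S) at_top"
    unfolding limitin_componentwise
  proof (intro conjI ballI)
    fix m assume m: "m \<in> ?S"
    have "((\<lambda>t. ereal (pt m \<bullet> (x + t *\<^sub>R n))) \<longlongrightarrow> toric_eval (tpoint \<Gamma> x) m) at_top"
    proof (cases "\<forall>w\<in>?\<sigma>. pt m \<bullet> w = 0")
      case True
      then have "pt m \<bullet> n = 0" using n(1) by blast
      then show ?thesis unfolding toric_eval_tpoint using True by (simp add: inner_add_right)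
    next
      case False
      then have neg: "pt m \<bullet> n < 0" using chart_monomial_negative[OF \<Gamma> out m] by blast
      have "\<forall>\<^sub>F t in at_top. ereal (pt m \<bullet> (x + t *\<^sub>R n)) < ereal r" for r
        using eventually_gt_at_top[of "(r - pt m \<bullet> x) / (pt m \<bullet> n)"]
      proof eventually_elim
        case (elim t)
        then have "t * (pt m \<bullet> n) < r - pt m \<bullet> x" using neg by (simp add: neg_divide_less_eq)
        then show ?case by (simp add: inner_add_right)
      qed
      then have "((\<lambda>t. ereal (pt m \<bullet> (x + t *\<^sub>R n))) \<longlongrightarrow> - \<infinity>) at_top" unfolding tendsto_MInfty by blast
      then show ?thesis unfolding toric_eval_tpoint using False by auto
    qed
    then show "limitin euclidean (\<lambda>t. restrict (toric_eval (toric_incl (x + t *\<^sub>R n))) ?S m)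
        (restrict (toric_eval (tpoint \<Gamma> x)) ?S m) at_top"
      using m by (simp add: toric_eval_incl)
  qed auto
  then have "\<forall>\<^sub>F t in at_top. restrict (toric_eval (toric_incl (x + t *\<^sub>R n))) ?S \<in> V"
    using V(1) pV unfolding limitin_def by blast
  then show ?thesis
  proof eventually_elim
    case (elim t)
    then show ?case using V(2) toric_incl_in_chart[OF \<Gamma>] by blast
  qed
qed

end

section \<open>The real toric surface\<close>

lemma bit2_add_self: "x + x = 0" "x + (x + y) = y" for x y :: "bit^2"
  by (simp_all only: vec_eq_iff vector_add_component zero_index bit_add_self simp_thms)

lemma bit2_add_eq_iff: "x + y = z \<longleftrightarrow> y = x + z" for x y z :: "bit^2"
  by (metis bit2_add_self(2))

context tropical_polynomial
begin

abbreviation rsurface :: "(reflection \<times> toric_point) set topology" where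
  "rsurface \<equiv> real_toric polygon"

definition rpoint :: "reflection \<Rightarrow> (real^2) set \<Rightarrow> real^2 \<Rightarrow> (reflection \<times> toric_point) set" where
  "rpoint \<epsilon> \<Gamma> x = copy_gluing polygon `` {(\<epsilon>, tpoint \<Gamma> x)}"

text \<open>The reflections by which the copies of the stratum of \<open>\<Gamma>\<close> are identified.\<close>

definition perp :: "(real^2) set \<Rightarrow> reflection \<Rightarrow> bool" where
  "perp \<Gamma> \<eta> \<longleftrightarrow> (\<exists>\<alpha>. mod2 \<alpha> = \<eta> \<and> (\<forall>x\<in>\<Gamma>. \<forall>y\<in>\<Gamma>. pt \<alpha> \<bullet> (x - y) = 0))"

lemma perp_0: "perp \<Gamma> 0"
  unfolding perp_def by (rule exI[of _ 0]) (simp add: mod2_def vec_eq_iff inner_2)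

lemma perp_mono: "perp \<Gamma> \<eta> \<Longrightarrow> \<Gamma>' \<subseteq> \<Gamma> \<Longrightarrow> perp \<Gamma>' \<eta>"
  unfolding perp_def by blast

lemma perp_polygon: "perp polygon \<eta> \<longleftrightarrow> \<eta> = 0"
proof
  assume "perp polygon \<eta>"
  then obtain \<alpha> where \<alpha>: "mod2 \<alpha> = \<eta>" "\<forall>x\<in>polygon. \<forall>y\<in>polygon. pt \<alpha> \<bullet> (x - y) = 0"
    unfolding perp_def by blast
  have "pt u \<bullet> pt \<alpha> = pt v \<bullet> pt \<alpha>" if "u \<in> A" "v \<in> A" for u v
  proof -
    have "pt \<alpha> \<bullet> (pt u - pt v) = 0" using \<alpha>(2) that pt_in_polygon by blast
    then show ?thesis by (simp add: inner_diff_right inner_commute)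
  qed
  then have "pt \<alpha> = 0" by (rule full_dim)
  then have "\<alpha> = 0" by (simp add: vec_eq_iff)
  then show "\<eta> = 0" using \<alpha>(1) by (simp add: mod2_def vec_eq_iff)
qed (simp add: perp_0)

text \<open>In particular all four copies of a zero-dimensional stratum are glued, which makes the surface
  connected.\<close>

lemma perp_vertex: "perp {p} \<eta>"
proof -
  define \<alpha> :: "int^2" where "\<alpha> = (\<chi> i. if \<eta> $ i = 0 then 0 else 1)"
  have "mod2 \<alpha> = \<eta>" unfolding mod2_def \<alpha>_def by (simp add: vec_eq_iff)
  then show ?thesis unfolding perp_def by (intro exI[of _ \<alpha>]) simp
qed

lemma copy_gluing_iff:
  assumes \<Gamma>: "is_face \<Gamma>"
  shows "((\<epsilon>, tpoint \<Gamma> x), (\<epsilon>', q)) \<in> copy_gluing polygon \<longleftrightarrow> q = tpoint \<Gamma> x \<and> perp \<Gamma> (\<epsilon> + \<epsilon>')"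
proof
  assume "((\<epsilon>, tpoint \<Gamma> x), (\<epsilon>', q)) \<in> copy_gluing polygon"
  then obtain \<alpha> \<Gamma>2 where h: "q = tpoint \<Gamma> x" "\<epsilon>' = \<epsilon> + mod2 \<alpha>" "\<Gamma>2 face_of polygon" "\<Gamma>2 \<noteq> {}"
    "\<forall>x\<in>\<Gamma>2. \<forall>y\<in>\<Gamma>2. pt \<alpha> \<bullet> (x - y) = 0" "tpoint \<Gamma> x \<in> stratum (dual_cone polygon \<Gamma>2)"
    unfolding copy_gluing_def by blast
  have f2: "is_face \<Gamma>2" using h(3,4) unfolding is_face_def by blast
  obtain y where "tpoint \<Gamma> x = tpoint \<Gamma>2 y" using h(6) unfolding stratum_face by blast
  then have "\<Gamma>2 = \<Gamma>" using tpoint_eq(1)[OF \<Gamma> f2] by blast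
  moreover have "mod2 \<alpha> = \<epsilon> + \<epsilon>'" using h(2) by (simp add: bit2_add_self)
  ultimately show "q = tpoint \<Gamma> x \<and> perp \<Gamma> (\<epsilon> + \<epsilon>')" using h(1,5) unfolding perp_def by blast
next
  assume h: "q = tpoint \<Gamma> x \<and> perp \<Gamma> (\<epsilon> + \<epsilon>')"
  then obtain \<alpha> where \<alpha>: "mod2 \<alpha> = \<epsilon> + \<epsilon>'" "\<forall>x\<in>\<Gamma>. \<forall>y\<in>\<Gamma>. pt \<alpha> \<bullet> (x - y) = 0" unfolding perp_def by blast
  have "\<epsilon>' = \<epsilon> + mod2 \<alpha>" using \<alpha>(1) by (simp add: bit2_add_self)
  moreover have "tpoint \<Gamma> x \<in> stratum (dual_cone polygon \<Gamma>)" unfolding stratum_face by blast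
  moreover have "\<Gamma> face_of polygon" "\<Gamma> \<noteq> {}" using \<Gamma> unfolding is_face_def by auto
  ultimately show "((\<epsilon>, tpoint \<Gamma> x), (\<epsilon>', q)) \<in> copy_gluing polygon"
    unfolding copy_gluing_def using h \<alpha>(2) by blast
qed

lemma topspace_copies: "topspace (toric_copies polygon) = UNIV \<times> toric_points fan"
  unfolding toric_copies_def topspace_sum_topology by (auto simp: topspace_trop_toric)

lemma equiv_gluing: "equiv (UNIV \<times> toric_points fan) (copy_gluing polygon)"
  using equiv_copy_gluing[OF polytope_polygon] unfolding topspace_copies .

lemma quotient_real_toric: "quotient_map (toric_copies polygon) rsurface (\<lambda>z. copy_gluing polygon `` {z})"
  unfolding real_toric_def by (rule quotient_map_quotient_topology[OF equiv_copy_gluing[OF polytope_polygon]])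

lemma rpoint_eq_iff:
  assumes "is_face \<Gamma>" "is_face \<Gamma>'"
  shows "rpoint \<epsilon> \<Gamma> x = rpoint \<epsilon>' \<Gamma>' x' \<longleftrightarrow> tpoint \<Gamma>' x' = tpoint \<Gamma> x \<and> perp \<Gamma> (\<epsilon> + \<epsilon>')"
proof -
  have "(\<epsilon>, tpoint \<Gamma> x) \<in> UNIV \<times> toric_points fan" "(\<epsilon>', tpoint \<Gamma>' x') \<in> UNIV \<times> toric_points fan"
    using assms unfolding toric_points_fan by auto
  then show ?thesis
    unfolding rpoint_def using eq_equiv_class_iff[OF equiv_gluing] copy_gluing_iff[OF assms(1)] by simp
qed

lemma topspace_rsurface: "topspace rsurface = {rpoint \<epsilon> \<Gamma> x | \<epsilon> \<Gamma> x. is_face \<Gamma>}"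
proof -
  have "topspace rsurface = (\<lambda>z. copy_gluing polygon `` {z}) ` (UNIV \<times> toric_points fan)"
    using quotient_imp_surjective_map[OF quotient_real_toric] topspace_copies by simp
  also have "\<dots> = {rpoint \<epsilon> \<Gamma> x | \<epsilon> \<Gamma> x. is_face \<Gamma>}"
    unfolding toric_points_fan rpoint_def by blast
  finally show ?thesis .
qed

text \<open>The closed cell of the monomial \<open>v\<close> in the quadrant \<open>\<epsilon>\<close>.\<close>

definition rcell :: "reflection \<Rightarrow> int^2 \<Rightarrow> (reflection \<times> toric_point) set set" where
  "rcell \<epsilon> v = {rpoint \<epsilon> \<Gamma> x | \<Gamma> x. is_face \<Gamma> \<and> v \<in> fterms \<Gamma> x}"

lemma rpoint_in_rcell:
  assumes "is_face \<Gamma>"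
  shows "rpoint \<epsilon>' \<Gamma> x \<in> rcell \<epsilon> v \<longleftrightarrow> v \<in> fterms \<Gamma> x \<and> perp \<Gamma> (\<epsilon> + \<epsilon>')"
proof
  assume "rpoint \<epsilon>' \<Gamma> x \<in> rcell \<epsilon> v"
  then obtain \<Gamma>1 x1 where h: "rpoint \<epsilon>' \<Gamma> x = rpoint \<epsilon> \<Gamma>1 x1" "is_face \<Gamma>1" "v \<in> fterms \<Gamma>1 x1"
    unfolding rcell_def by blast
  then have "tpoint \<Gamma>1 x1 = tpoint \<Gamma> x" "perp \<Gamma> (\<epsilon>' + \<epsilon>)" using rpoint_eq_iff[OF assms h(2)] by auto
  then show "v \<in> fterms \<Gamma> x \<and> perp \<Gamma> (\<epsilon> + \<epsilon>')"
    using tpoint_eq(2)[OF h(2) assms] h(3) by (simp add: add.commute)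
next
  assume h: "v \<in> fterms \<Gamma> x \<and> perp \<Gamma> (\<epsilon> + \<epsilon>')"
  then have "rpoint \<epsilon>' \<Gamma> x = rpoint \<epsilon> \<Gamma> x" using rpoint_eq_iff[OF assms assms] by (simp add: add.commute)
  then show "rpoint \<epsilon>' \<Gamma> x \<in> rcell \<epsilon> v" unfolding rcell_def using h assms by blast
qed

lemma rcell_subset: "rcell \<epsilon> v \<subseteq> topspace rsurface"
  unfolding rcell_def topspace_rsurface by blast

text \<open>The part in the copy \<open>\<epsilon>'\<close> of the preimage of a cell is the cell of \<open>v\<close> in the tropical toric
  surface, restricted to the strata whose copies in \<open>\<epsilon>\<close> and \<open>\<epsilon>'\<close> are glued. These strata form a
  finite union of closed ones because smaller faces have more orthogonal vectors.\<close>

lemma closedin_rcell: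
  assumes v: "v \<in> A"
  shows "closedin rsurface (rcell \<epsilon> v)"
proof -
  let ?q = "\<lambda>z. copy_gluing polygon `` {z}"
  have slice: "closedin (trop_toric fan) {p. (\<epsilon>', p) \<in> {z \<in> topspace (toric_copies polygon). ?q z \<in> rcell \<epsilon> v}}" for \<epsilon>'
  proof -
    let ?\<G> = "{\<Gamma>0. is_face \<Gamma>0 \<and> perp \<Gamma>0 (\<epsilon> + \<epsilon>')}"
    have "{p. (\<epsilon>', p) \<in> {z \<in> topspace (toric_copies polygon). ?q z \<in> rcell \<epsilon> v}} =
      (\<Union>\<Gamma>0\<in>?\<G>. toric_cell v \<inter> toric_strata \<Gamma>0)" (is "?L = ?R")
    proof (intro set_eqI)
      fix p
      have "p \<in> ?L \<longleftrightarrow> p \<in> ?R" if p: "p \<in> toric_points fan"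
      proof -
        obtain \<Gamma> x where \<Gamma>: "is_face \<Gamma>" and px: "p = tpoint \<Gamma> x" using p unfolding toric_points_fan by blast
        have st: "tpoint \<Gamma> x \<in> toric_strata \<Gamma>0 \<longleftrightarrow> \<Gamma> \<subseteq> \<Gamma>0" for \<Gamma>0
          unfolding toric_strata_def using \<Gamma> tpoint_eq(1) by blast
        have "p \<in> ?L \<longleftrightarrow> v \<in> fterms \<Gamma> x \<and> perp \<Gamma> (\<epsilon> + \<epsilon>')"
          using p rpoint_in_rcell[OF \<Gamma>] unfolding px topspace_copies rpoint_def by simp
        also have "\<dots> \<longleftrightarrow> p \<in> ?R"
          unfolding px UN_iff Int_iff tpoint_in_toric_cell[OF \<Gamma>] st using \<Gamma> perp_mono by blast
        finally show ?thesis .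
      qed
      moreover have "p \<in> toric_points fan" if "p \<in> ?L" using that topspace_copies by simp
      moreover have "p \<in> toric_points fan" if "p \<in> ?R"
        using that unfolding toric_cell_def toric_points_fan by blast
      ultimately show "p \<in> ?L \<longleftrightarrow> p \<in> ?R" by blast
    qed
    moreover have "finite ?\<G>"
      by (rule finite_subset[OF _ finite_polytope_faces[OF polytope_polygon]]) (auto simp: is_face_def)
    ultimately show ?thesis
      using closedin_toric_cell[OF v] closedin_toric_strata by (simp only:) (intro closedin_Union, auto)
  qed
  have "closedin (toric_copies polygon) {z \<in> topspace (toric_copies polygon). ?q z \<in> rcell \<epsilon> v}"
    unfolding toric_copies_def[of polygon] closedin_sum_topology
  proof (intro conjI ballI)
    show "{z \<in> topspace (sum_topology (\<lambda>\<epsilon>. trop_toric fan) UNIV). ?q z \<in> rcell \<epsilon> v}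
      \<subseteq> Sigma UNIV (topspace \<circ> (\<lambda>\<epsilon>. trop_toric fan))" by auto
    show "closedin (trop_toric fan) {x. (i, x) \<in> {z \<in> topspace (sum_topology (\<lambda>\<epsilon>. trop_toric fan) UNIV). ?q z \<in> rcell \<epsilon> v}}" for i
      using slice unfolding toric_copies_def .
  qed
  then show ?thesis using quotient_real_toric rcell_subset unfolding quotient_map_closedin by blast
qed

definition rincl :: "reflection \<Rightarrow> real^2 \<Rightarrow> (reflection \<times> toric_point) set" where
  "rincl \<epsilon> x = rpoint \<epsilon> polygon x"

lemma rincl_eq: "rincl \<epsilon> x = copy_gluing polygon `` {(\<epsilon>, toric_incl x)}"
  unfolding rincl_def rpoint_def toric_incl_tpoint ..

lemma rincl_in_rcell: "rincl \<epsilon>' x \<in> rcell \<epsilon> v \<longleftrightarrow> v \<in> M x \<and> \<epsilon>' = \<epsilon>"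
  unfolding rincl_def rpoint_in_rcell[OF polygon_face] face_terms_polygon perp_polygon
  by (auto simp: bit2_add_eq_iff bit2_add_self)

lemma rincl_in_topspace: "rincl \<epsilon> x \<in> topspace rsurface"
  unfolding rincl_def topspace_rsurface using polygon_face by blast

lemma continuous_slice: "continuous_map (trop_toric fan) rsurface (\<lambda>p. copy_gluing polygon `` {(\<epsilon>, p)})"
proof -
  have "continuous_map (trop_toric fan) (toric_copies polygon) (\<lambda>p. (\<epsilon>, p))"
    unfolding toric_copies_def by (rule continuous_map_component_injection) simp
  then show ?thesis
    using continuous_map_compose[OF _ quotient_imp_continuous_map[OF quotient_real_toric]] by (simp add: comp_def)
qed

lemma continuous_rincl: "continuous_map euclidean rsurface (rincl \<epsilon>)"
  using continuous_map_compose[OF continuous_toric_incl continuous_slice] by (simp add: comp_def rincl_eq[abs_def])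

lemma rpoint_in_closure:
  assumes \<Gamma>: "is_face \<Gamma>" and n: "outward_normal \<Gamma> n"
    and ev: "\<forall>\<^sub>F t in at_top. x + t *\<^sub>R n \<in> S"
  shows "rpoint \<epsilon> \<Gamma> x \<in> rsurface closure_of (rincl \<epsilon> ` S)"
  unfolding in_closure_of
proof (intro conjI allI impI)
  show "rpoint \<epsilon> \<Gamma> x \<in> topspace rsurface" unfolding topspace_rsurface using \<Gamma> by blast
  fix T assume T: "rpoint \<epsilon> \<Gamma> x \<in> T \<and> openin rsurface T"
  let ?U = "{p \<in> topspace (trop_toric fan). copy_gluing polygon `` {(\<epsilon>, p)} \<in> T}"
  have "openin (trop_toric fan) ?U" using T by (intro openin_continuous_map_preimage[OF continuous_slice]) auto
  moreover have "tpoint \<Gamma> x \<in> ?U"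
    using T \<Gamma> unfolding rpoint_def topspace_trop_toric toric_points_fan by blast
  ultimately have "\<forall>\<^sub>F t in at_top. toric_incl (x + t *\<^sub>R n) \<in> ?U" by (rule toric_incl_tends[OF \<Gamma> n])
  with ev have "\<forall>\<^sub>F t in at_top. x + t *\<^sub>R n \<in> S \<and> rincl \<epsilon> (x + t *\<^sub>R n) \<in> T"
    by eventually_elim (auto simp: rincl_eq)
  then obtain t where "x + t *\<^sub>R n \<in> S" "rincl \<epsilon> (x + t *\<^sub>R n) \<in> T"
    using eventually_happens'[of at_top] by force
  then show "\<exists>y. y \<in> rincl \<epsilon> ` S \<and> y \<in> T" by blast
qed

lemma fterms_far:
  assumes \<Gamma>: "is_face \<Gamma>" and n: "outward_normal \<Gamma> n"
  shows "\<forall>\<^sub>F t in at_top. M (x + t *\<^sub>R n) = fterms \<Gamma> x"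
proof (rule max_terms_towards[OF finite_support face_terms_subset])
  show "face_terms \<Gamma> \<noteq> {}" using \<Gamma> face_terms_nonempty unfolding is_face_def by blast
  show "pt p \<bullet> n = pt q \<bullet> n" if "p \<in> face_terms \<Gamma>" "q \<in> face_terms \<Gamma>" for p q
    using dual_cone_tie[OF \<Gamma> outward_normalD(1)[OF n], of "pt p" "pt q"] that unfolding face_terms_def by (simp add: inner_commute)
  show "pt q \<bullet> n < pt p \<bullet> n" if "p \<in> face_terms \<Gamma>" "q \<in> A - face_terms \<Gamma>" for p q
    using outward_normalD(2)[OF n, of "pt p" "pt q"] that pt_in_polygon unfolding face_terms_def by (simp add: inner_commute)
qed

text \<open>A boundary point is the limit of points of the plane with the same dominant terms.\<close>

lemma rpoint_in_closure_terms:
  assumes \<Gamma>: "is_face \<Gamma>" and S: "\<And>y. M y = fterms \<Gamma> x \<Longrightarrow> y \<in> S"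
  shows "rpoint \<epsilon> \<Gamma> x \<in> rsurface closure_of (rincl \<epsilon> ` S)"
proof -
  obtain n where n: "outward_normal \<Gamma> n" using outward_normal_exists[OF \<Gamma>] .
  have "\<forall>\<^sub>F t in at_top. x + t *\<^sub>R n \<in> S" using fterms_far[OF \<Gamma> n, of x] by eventually_elim (rule S)
  then show ?thesis by (rule rpoint_in_closure[OF \<Gamma> n])
qed

lemma fterms_are_terms:
  assumes \<Gamma>: "is_face \<Gamma>"
  obtains y where "M y = fterms \<Gamma> x"
proof -
  obtain n where n: "outward_normal \<Gamma> n" using outward_normal_exists[OF \<Gamma>] .
  show ?thesis using that fterms_far[OF \<Gamma> n, of x] eventually_happens'[of "at_top :: real filter"] by force
qed

lemma connected_rsurface: "connected_space rsurface"
proof -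
  obtain v where v: "v \<in> face_terms polygon" "pt v extreme_point_of polygon"
    using face_vertex polygon_face unfolding is_face_def by blast
  have f: "is_face {pt v}" using v(2) unfolding is_face_def by (simp add: face_of_singleton)
  define Q where "Q \<epsilon> = rsurface closure_of (range (rincl \<epsilon>))" for \<epsilon>
  have conn: "connectedin rsurface (Q \<epsilon>)" for \<epsilon>
    unfolding Q_def
    by (intro connectedin_closure_of connectedin_continuous_map_image[OF continuous_rincl])
      (simp add: convex_connected)
  have "rpoint 0 {pt v} 0 \<in> Q \<epsilon>" for \<epsilon>
  proof -
    have "rpoint 0 {pt v} 0 = rpoint \<epsilon> {pt v} 0" using rpoint_eq_iff[OF f f] perp_vertex by blast
    then show ?thesis unfolding Q_def using rpoint_in_closure_terms[OF f, of 0 UNIV] by simp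
  qed
  then have "connectedin rsurface (\<Union>\<epsilon>. Q \<epsilon>)" using conn by (intro connectedin_Union) auto
  moreover have "(\<Union>\<epsilon>. Q \<epsilon>) = topspace rsurface"
  proof
    show "(\<Union>\<epsilon>. Q \<epsilon>) \<subseteq> topspace rsurface" unfolding Q_def by (simp add: closure_of_subset_topspace UN_least)
    show "topspace rsurface \<subseteq> (\<Union>\<epsilon>. Q \<epsilon>)"
      unfolding topspace_rsurface Q_def using rpoint_in_closure_terms[of _ _ UNIV] by blast
  qed
  ultimately show ?thesis by (simp add: connectedin_topspace)
qed

definition active :: "(int^2) set" where "active = {v. \<exists>x. M x = {v}}"

end

context nonsingular_tropical_curve
begin

lemma active_terms: "v \<in> M x \<Longrightarrow> v \<in> active"
  unfolding active_def using exact_terms[of "{v}" x] by blast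

lemma active_fterms: "is_face \<Gamma> \<Longrightarrow> v \<in> fterms \<Gamma> x \<Longrightarrow> v \<in> active"
  using fterms_are_terms[of \<Gamma> x] active_terms by metis

lemma active_subset: "active \<subseteq> A"
  unfolding active_def using M_subset by blast

lemma exact_fterms:
  assumes \<Gamma>: "is_face \<Gamma>" and T: "T \<subseteq> fterms \<Gamma> x" "T \<noteq> {}"
  obtains x' where "fterms \<Gamma> x' = T"
proof -
  obtain y where y: "M y = fterms \<Gamma> x" using fterms_are_terms[OF \<Gamma>] .
  have "face_terms \<Gamma> \<noteq> {}" using \<Gamma> face_terms_nonempty unfolding is_face_def by blast
  then obtain d where "\<forall>\<^sub>F s in at_right 0. fterms \<Gamma> (x + s *\<^sub>R d) = T"
    using select_terms[OF finite_face_terms _ eq_refl[OF y[symmetric]] T] by blast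
  then show ?thesis using that eventually_happens'[OF trivial_limit_at_right_real] by blast
qed

text \<open>Boundary points of a cell are limits of points of the closed plane region, and these are
  limits of points of the open region.\<close>

lemma rcell_closure:
  assumes v: "v \<in> active"
  shows "rcell \<epsilon> v \<subseteq> rsurface closure_of (rincl \<epsilon> ` open_region v)"
proof
  fix p assume "p \<in> rcell \<epsilon> v"
  then obtain \<Gamma> x where \<Gamma>: "is_face \<Gamma>" "v \<in> fterms \<Gamma> x" and p: "p = rpoint \<epsilon> \<Gamma> x" unfolding rcell_def by blast
  obtain z where z: "M z = {v}" using v unfolding active_def by blast
  have "rincl \<epsilon> ` region v \<subseteq> rincl \<epsilon> ` closure (open_region v)"
    using region_subset_closure[OF z] by blast
  also have "\<dots> \<subseteq> rsurface closure_of (rincl \<epsilon> ` open_region v)"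
    using continuous_map_image_closure_subset[OF continuous_rincl, of \<epsilon> "open_region v"] by simp
  finally have "rincl \<epsilon> ` region v \<subseteq> rsurface closure_of (rincl \<epsilon> ` open_region v)" .
  then have "rsurface closure_of (rincl \<epsilon> ` region v) \<subseteq> rsurface closure_of (rincl \<epsilon> ` open_region v)"
    by (metis closure_of_closure_of closure_of_mono)
  moreover have "p \<in> rsurface closure_of (rincl \<epsilon> ` region v)"
    unfolding p using \<Gamma> by (intro rpoint_in_closure_terms) auto
  ultimately show "p \<in> rsurface closure_of (rincl \<epsilon> ` open_region v)" by blast
qed

lemma rsurface_cover: "topspace rsurface = (\<Union>i\<in>UNIV \<times> active. case i of (\<epsilon>, v) \<Rightarrow> rcell \<epsilon> v)"
proof
  show "topspace rsurface \<subseteq> (\<Union>i\<in>UNIV \<times> active. case i of (\<epsilon>, v) \<Rightarrow> rcell \<epsilon> v)"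
  proof
    fix p assume "p \<in> topspace rsurface"
    then obtain \<epsilon> \<Gamma> x where \<Gamma>: "is_face \<Gamma>" and p: "p = rpoint \<epsilon> \<Gamma> x" unfolding topspace_rsurface by blast
    obtain v where v: "v \<in> fterms \<Gamma> x" using fterms_nonempty[OF \<Gamma>] by blast
    then have "p \<in> rcell \<epsilon> v" "v \<in> active" using \<Gamma> active_fterms unfolding p rcell_def by blast+
    then show "p \<in> (\<Union>i\<in>UNIV \<times> active. case i of (\<epsilon>, v) \<Rightarrow> rcell \<epsilon> v)" by auto
  qed
  show "(\<Union>i\<in>UNIV \<times> active. case i of (\<epsilon>, v) \<Rightarrow> rcell \<epsilon> v) \<subseteq> topspace rsurface"
    using rcell_subset by auto
qed

end

section \<open>The real part as a wall\<close>

lemma finite_bit2: "finite (UNIV :: (bit^2) set)"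
proof -
  have b: "finite (UNIV :: bit set)"
  proof (rule finite_subset)
    show "(UNIV :: bit set) \<subseteq> {0, 1}"
    proof
      fix x :: bit show "x \<in> {0, 1}" by (cases x) auto
    qed
  qed simp
  show ?thesis
  proof (rule finite_imageD)
    show "finite ((\<lambda>x :: bit^2. (x $ 1, x $ 2)) ` UNIV)"
      by (rule finite_subset[OF subset_UNIV finite_Prod_UNIV[OF b b]])
    show "inj (\<lambda>x :: bit^2. (x $ 1, x $ 2))" by (rule injI) (auto intro: bit2_eqI)
  qed
qed

lemma bdot_add: "bdot (x + y) z = bdot x z + bdot y z"
  unfolding bdot_def by (simp only: vector_add_component) (simp only: algebra_simps)

text \<open>\<open>gluing_parity\<close> holds when the degree is even and \<open>v0\<close> is a vertex of the Newton polygon.\<close>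

locale even_real_curve = real_tropical_curve +
  assumes gluing_parity: "\<And>\<Gamma> \<eta> b. \<lbrakk>is_face \<Gamma>; perp \<Gamma> \<eta>; b \<in> face_terms \<Gamma>\<rbrakk> \<Longrightarrow> bdot \<eta> (cls b) = 0"
begin

lemma sign_at_glue:
  assumes "is_face \<Gamma>" "perp \<Gamma> (\<epsilon> + \<epsilon>')" "b \<in> face_terms \<Gamma>"
  shows "sign_at \<epsilon> b = sign_at \<epsilon>' b"
proof -
  have "bdot \<epsilon> (cls b) + bdot \<epsilon>' (cls b) = 0" using gluing_parity[OF assms] unfolding bdot_add .
  then have "bdot \<epsilon> (cls b) = bdot \<epsilon>' (cls b)" by (cases "bdot \<epsilon> (cls b)"; cases "bdot \<epsilon>' (cls b)") auto
  then show ?thesis unfolding sign_at_def by simp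
qed

sublocale cover: signed_cell_cover rsurface "UNIV \<times> active" "\<lambda>(\<epsilon>, v). rcell \<epsilon> v"
  "\<lambda>(\<epsilon>, v). rincl \<epsilon> ` open_region v" "\<lambda>(\<epsilon>, v). sign_at \<epsilon> v"
proof
  show "finite (UNIV \<times> active :: (reflection \<times> (int^2)) set)"
    using finite_bit2 finite_subset[OF active_subset finite_support] by simp
  show "topspace rsurface = (\<Union>i\<in>UNIV \<times> active. case i of (\<epsilon>, v) \<Rightarrow> rcell \<epsilon> v)" by (rule rsurface_cover)
  show "connected_space rsurface" by (rule connected_rsurface)
  fix i :: "reflection \<times> (int^2)" assume "i \<in> UNIV \<times> active"
  then obtain \<epsilon> v where i: "i = (\<epsilon>, v)" and v: "v \<in> active" by blast
  show "closedin rsurface (case i of (\<epsilon>, v) \<Rightarrow> rcell \<epsilon> v)"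
    unfolding i using closedin_rcell v active_subset by auto
  have "connected (open_region v)" using convex_open_region convex_connected by blast
  then show "connectedin rsurface (case i of (\<epsilon>, v) \<Rightarrow> rincl \<epsilon> ` open_region v)"
    unfolding i by (simp add: connectedin_continuous_map_image[OF continuous_rincl])
  show "(case i of (\<epsilon>, v) \<Rightarrow> rincl \<epsilon> ` open_region v) \<noteq> {}" unfolding i using v unfolding active_def by auto
  show "(case i of (\<epsilon>, v) \<Rightarrow> rincl \<epsilon> ` open_region v) \<subseteq> (case i of (\<epsilon>, v) \<Rightarrow> rcell \<epsilon> v)"
    unfolding i by (auto simp: rincl_in_rcell)
  show "(case i of (\<epsilon>, v) \<Rightarrow> rcell \<epsilon> v) \<subseteq> rsurface closure_of (case i of (\<epsilon>, v) \<Rightarrow> rincl \<epsilon> ` open_region v)"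
    unfolding i using rcell_closure[OF v] by simp
  fix j assume "j \<in> UNIV \<times> active" "i \<noteq> j"
  then obtain \<epsilon>' v' where "j = (\<epsilon>', v')" "(\<epsilon>, v) \<noteq> (\<epsilon>', v')" using i by blast
  then show "(case i of (\<epsilon>, v) \<Rightarrow> rincl \<epsilon> ` open_region v) \<inter> (case j of (\<epsilon>, v) \<Rightarrow> rcell \<epsilon> v) = {}"
    unfolding i by (auto simp: rincl_in_rcell)
qed

lemma rpoint_in_wall:
  assumes \<Gamma>: "is_face \<Gamma>"
  shows "rpoint \<epsilon> \<Gamma> x \<in> cover.wall \<longleftrightarrow> (\<exists>u\<in>fterms \<Gamma> x. \<exists>v\<in>fterms \<Gamma> x. sign_at \<epsilon> u \<noteq> sign_at \<epsilon> v)"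
proof
  assume "rpoint \<epsilon> \<Gamma> x \<in> cover.wall"
  then obtain \<epsilon>1 u \<epsilon>2 v where h: "rpoint \<epsilon> \<Gamma> x \<in> rcell \<epsilon>1 u" "rpoint \<epsilon> \<Gamma> x \<in> rcell \<epsilon>2 v" "sign_at \<epsilon>1 u \<noteq> sign_at \<epsilon>2 v"
    unfolding cover.wall_def by auto
  then have uv: "u \<in> fterms \<Gamma> x" "perp \<Gamma> (\<epsilon>1 + \<epsilon>)" "v \<in> fterms \<Gamma> x" "perp \<Gamma> (\<epsilon>2 + \<epsilon>)"
    unfolding rpoint_in_rcell[OF \<Gamma>] by auto
  then have "sign_at \<epsilon>1 u = sign_at \<epsilon> u" "sign_at \<epsilon>2 v = sign_at \<epsilon> v"
    using sign_at_glue[OF \<Gamma>] mem_fterms by blast+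
  then show "\<exists>u\<in>fterms \<Gamma> x. \<exists>v\<in>fterms \<Gamma> x. sign_at \<epsilon> u \<noteq> sign_at \<epsilon> v" using h uv by auto
next
  assume "\<exists>u\<in>fterms \<Gamma> x. \<exists>v\<in>fterms \<Gamma> x. sign_at \<epsilon> u \<noteq> sign_at \<epsilon> v"
  then obtain u v where uv: "u \<in> fterms \<Gamma> x" "v \<in> fterms \<Gamma> x" "sign_at \<epsilon> u \<noteq> sign_at \<epsilon> v" by blast
  then have "rpoint \<epsilon> \<Gamma> x \<in> rcell \<epsilon> u" "rpoint \<epsilon> \<Gamma> x \<in> rcell \<epsilon> v"
    unfolding rpoint_in_rcell[OF \<Gamma>] by (simp_all add: bit2_add_self perp_0)
  moreover have "u \<in> active" "v \<in> active" using active_fterms[OF \<Gamma>] uv by blast+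
  ultimately show "rpoint \<epsilon> \<Gamma> x \<in> cover.wall"
    unfolding cover.wall_def mem_Collect_eq using uv(3)
    by (intro bexI[of _ "(\<epsilon>, u)"] bexI[of _ "(\<epsilon>, v)"]) auto
qed

lemma rincl_in_wall: "rincl \<epsilon> x \<in> cover.wall \<longleftrightarrow> (\<exists>u\<in>M x. \<exists>v\<in>M x. sign_at \<epsilon> u \<noteq> sign_at \<epsilon> v)"
  unfolding rincl_def rpoint_in_wall[OF polygon_face] face_terms_polygon ..

lemma wall_point:
  assumes "p \<in> cover.wall"
  obtains \<epsilon> \<Gamma> x where "is_face \<Gamma>" "p = rpoint \<epsilon> \<Gamma> x"
proof -
  have "p \<in> topspace rsurface" using assms rcell_subset unfolding cover.wall_def by auto
  then show ?thesis using that unfolding topspace_rsurface by blast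
qed

lemma closedin_wall: "closedin rsurface cover.wall"
proof -
  let ?J = "{(i, j). i \<in> UNIV \<times> active \<and> j \<in> UNIV \<times> active \<and> (case i of (\<epsilon>, v) \<Rightarrow> sign_at \<epsilon> v) \<noteq> (case j of (\<epsilon>, v) \<Rightarrow> sign_at \<epsilon> v)}"
  have "finite ?J"
    by (rule finite_subset[of _ "(UNIV \<times> active) \<times> (UNIV \<times> active)"]) (use cover.finite_cells in auto)
  moreover have "cover.wall = (\<Union>k\<in>?J. (case fst k of (\<epsilon>, v) \<Rightarrow> rcell \<epsilon> v) \<inter> (case snd k of (\<epsilon>, v) \<Rightarrow> rcell \<epsilon> v))"
    unfolding cover.wall_def by fastforce
  moreover have "closedin rsurface ((case fst k of (\<epsilon>, v) \<Rightarrow> rcell \<epsilon> v) \<inter> (case snd k of (\<epsilon>, v) \<Rightarrow> rcell \<epsilon> v))"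
    if "k \<in> ?J" for k
    using that by (intro closedin_Int cover.closed_cell) auto
  ultimately show ?thesis by (simp only:) (intro closedin_Union, auto)
qed

text \<open>An edge with phase \<open>\<epsilon>\<close> borders two regions of opposite sign in \<open>\<epsilon>\<close>, and the wall is closed.
  Conversely a wall point with exponents \<open>u\<close>, \<open>v\<close> of opposite sign is a limit of points of the edge
  between the regions of \<open>u\<close> and \<open>v\<close>.\<close>

theorem real_part_eq_wall: "real_part A a \<delta> = cover.wall"
proof
  have nz: "\<And>v. v \<in> A \<Longrightarrow> \<delta> v \<noteq> 0" using signs by force
  let ?R = "\<Union>e\<in>edges A a. \<Union>\<epsilon>\<in>phase A a \<delta> e. rincl \<epsilon> ` e"
  have real: "real_part A a \<delta> = rsurface closure_of ?R" unfolding real_part_def rincl_eq ..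
  have "?R \<subseteq> cover.wall"
  proof
    fix p assume "p \<in> ?R"
    then obtain e \<epsilon> y where e: "e \<in> edges A a" "\<epsilon> \<in> phase A a \<delta> e" "y \<in> e" "p = rincl \<epsilon> y" by blast
    obtain x u v where x: "M x = {u, v}" "u \<noteq> v" "e = region u \<inter> region v" "copy_sign \<delta> \<epsilon> u = - copy_sign \<delta> \<epsilon> v"
      using edge_phase[OF e(1,2) nz] .
    have uv: "u \<in> M y" "v \<in> M y" using e(3) x(3) by auto
    then have "sign_at \<epsilon> u \<noteq> sign_at \<epsilon> v" using opposite_iff x(4) M_subset by blast
    then show "p \<in> cover.wall" unfolding e(4) rincl_in_wall using uv by blast
  qed
  then show "real_part A a \<delta> \<subseteq> cover.wall" unfolding real by (rule closure_of_minimal[OF _ closedin_wall])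
  show "cover.wall \<subseteq> real_part A a \<delta>"
  proof
    fix p assume p: "p \<in> cover.wall"
    obtain \<epsilon> \<Gamma> x where \<Gamma>: "is_face \<Gamma>" and px: "p = rpoint \<epsilon> \<Gamma> x" using wall_point[OF p] .
    obtain u v where uv: "u \<in> fterms \<Gamma> x" "v \<in> fterms \<Gamma> x" "sign_at \<epsilon> u \<noteq> sign_at \<epsilon> v"
      using p unfolding px rpoint_in_wall[OF \<Gamma>] by blast
    have ne: "u \<noteq> v" using uv by auto
    obtain y where y: "M y = fterms \<Gamma> x" using fterms_are_terms[OF \<Gamma>] .
    then obtain z where z: "M z = {u, v}" using exact_terms[of "{u, v}" y] uv by auto
    let ?e = "region u \<inter> region v"
    have e: "?e \<in> edges A a" by (rule edge_two_terms[OF z ne])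
    have "u \<in> A" "v \<in> A" using uv mem_fterms face_terms_subset by blast+
    then have "copy_sign \<delta> \<epsilon> u = - copy_sign \<delta> \<epsilon> v" using opposite_iff uv(3) by blast
    then have "\<epsilon> \<in> phase A a \<delta> ?e"
      unfolding phase_def using dual_face_two_terms[OF z] cell_two_terms[OF z] by auto
    then have "rincl \<epsilon> ` ?e \<subseteq> ?R" using e by blast
    moreover have "p \<in> rsurface closure_of (rincl \<epsilon> ` ?e)"
      unfolding px using uv by (intro rpoint_in_closure_terms[OF \<Gamma>]) auto
    ultimately show "p \<in> real_part A a \<delta>" unfolding real using closure_of_mono by blast
  qed
qed

text \<open>Move the point within its stratum until \<open>u\<close> and \<open>v\<close> are the only dominant terms.\<close>

lemma same_sign_cells_meet_off_wall:
  assumes "p \<in> cover.wall" "p \<in> rcell \<epsilon>1 u" "p \<in> rcell \<epsilon>2 v" "sign_at \<epsilon>1 u = sign_at \<epsilon>2 v"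
  shows "\<exists>q. q \<in> rcell \<epsilon>1 u \<and> q \<in> rcell \<epsilon>2 v \<and> q \<notin> cover.wall"
proof -
  obtain \<epsilon> \<Gamma> x where \<Gamma>: "is_face \<Gamma>" and p: "p = rpoint \<epsilon> \<Gamma> x" using wall_point[OF assms(1)] .
  have u: "u \<in> fterms \<Gamma> x" "perp \<Gamma> (\<epsilon>1 + \<epsilon>)" and v: "v \<in> fterms \<Gamma> x" "perp \<Gamma> (\<epsilon>2 + \<epsilon>)"
    using assms(2,3) unfolding p rpoint_in_rcell[OF \<Gamma>] by auto
  have eq: "sign_at \<epsilon> u = sign_at \<epsilon> v"
    using sign_at_glue[OF \<Gamma> u(2)] sign_at_glue[OF \<Gamma> v(2)] u(1) v(1) assms(4) mem_fterms by metis
  obtain x' where x': "fterms \<Gamma> x' = {u, v}" using exact_fterms[OF \<Gamma>, of "{u, v}" x] u(1) v(1) by auto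
  have "rpoint \<epsilon> \<Gamma> x' \<notin> cover.wall" unfolding rpoint_in_wall[OF \<Gamma>] x' using eq by auto
  then show ?thesis using rpoint_in_rcell[OF \<Gamma>] x' u(2) v(2) by blast
qed

lemma oval_criterion:
  assumes K: "K \<in> connected_components_of (subtopology rsurface cover.wall)"
    and col: "\<And>p \<epsilon>1 u \<epsilon>2 v. \<lbrakk>u \<in> active; v \<in> active; p \<in> rcell \<epsilon>1 u; p \<in> rcell \<epsilon>2 v; \<kappa> \<epsilon>1 u \<noteq> \<kappa> \<epsilon>2 v\<rbrakk> \<Longrightarrow> p \<in> K"
    and ab: "u \<in> active" "v \<in> active" "\<kappa> \<epsilon>1 u \<noteq> \<kappa> \<epsilon>2 v"
  shows "is_oval rsurface K"
proof (rule cover.is_oval_if_coloured[OF _ K, of "\<lambda>(\<epsilon>, v). \<kappa> \<epsilon> v" "(\<epsilon>1, u)" "(\<epsilon>2, v)"])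
  fix p and i j :: "reflection \<times> (int^2)"
  assume "p \<in> cover.wall" "i \<in> UNIV \<times> active" "j \<in> UNIV \<times> active" "p \<in> (case i of (\<epsilon>, v) \<Rightarrow> rcell \<epsilon> v)"
    "p \<in> (case j of (\<epsilon>, v) \<Rightarrow> rcell \<epsilon> v)" "(case i of (\<epsilon>, v) \<Rightarrow> sign_at \<epsilon> v) = (case j of (\<epsilon>, v) \<Rightarrow> sign_at \<epsilon> v)"
  then show "\<exists>q. q \<in> (case i of (\<epsilon>, v) \<Rightarrow> rcell \<epsilon> v) \<and> q \<in> (case j of (\<epsilon>, v) \<Rightarrow> rcell \<epsilon> v) \<and> q \<notin> cover.wall"
    using same_sign_cells_meet_off_wall[of p "fst i" "snd i" "fst j" "snd j"] by (simp add: case_prod_unfold)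
next
  fix i j :: "reflection \<times> (int^2)" and p
  assume "i \<in> UNIV \<times> active" "j \<in> UNIV \<times> active" "p \<in> (case i of (\<epsilon>, v) \<Rightarrow> rcell \<epsilon> v)"
    "p \<in> (case j of (\<epsilon>, v) \<Rightarrow> rcell \<epsilon> v)" "(case i of (\<epsilon>, v) \<Rightarrow> \<kappa> \<epsilon> v) \<noteq> (case j of (\<epsilon>, v) \<Rightarrow> \<kappa> \<epsilon> v)"
  then show "p \<in> K" using col[of "snd i" "snd j" p "fst i" "fst j"] by (auto simp: case_prod_unfold)
qed (use ab in auto)

lemma component_absorbs:
  assumes K: "K \<in> connected_components_of (subtopology rsurface cover.wall)"
    and S: "connectedin rsurface S" "S \<subseteq> cover.wall" "S \<inter> K \<noteq> {}"
  shows "rsurface closure_of S \<subseteq> K"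
proof -
  have "rsurface closure_of S \<subseteq> cover.wall" using closure_of_minimal[OF S(2) closedin_wall] .
  then have "connectedin (subtopology rsurface cover.wall) (rsurface closure_of S)"
    using connectedin_closure_of[OF S(1)] by (simp add: connectedin_subtopology)
  moreover have "S \<subseteq> rsurface closure_of S"
    using closure_of_subset connectedin_subset_topspace[OF S(1)] by blast
  ultimately show ?thesis using connected_components_of_maximal[OF K] S(3) unfolding disjnt_def by blast
qed

lemma outer_if_proper_face:
  assumes \<Gamma>: "is_face \<Gamma>" "\<Gamma> \<noteq> polygon" and v: "v \<in> face_terms \<Gamma>"
  shows "outer v"
proof -
  obtain n where n: "outward_normal \<Gamma> n" using outward_normal_exists[OF \<Gamma>(1)] .
  obtain q where q: "q \<in> polygon" "q \<notin> \<Gamma>" using \<Gamma> face_subset_polygon by blast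
  have pv: "pt v \<in> \<Gamma>" using v unfolding face_terms_def by blast
  have "n \<noteq> 0" using outward_normalD(2)[OF n pv q] by auto
  moreover have "pt u \<bullet> n \<le> pt v \<bullet> n" if "u \<in> A" for u
    using outward_normalD(1)[OF n] pt_in_polygon[OF that] pv unfolding dual_cone_def inner_commute[of _ n] by blast
  ultimately show ?thesis unfolding outer_def using v face_terms_subset by blast
qed

text \<open>The normal of the edge is the difference \<open>b' - b\<close> turned by a right angle, which modulo 2 amounts to
  exchanging the coordinates.\<close>

lemma perp_quarter_turn:
  assumes w: "w \<noteq> 0" and b: "b \<in> face_terms (max_face w)" "b' \<in> face_terms (max_face w)" "b \<noteq> b'"
  shows "perp (max_face w) (swap2 (mod2 b + mod2 b'))"
proof -
  define \<alpha> :: "int^2" where "\<alpha> = vector [- (b' $ 2 - b $ 2), b' $ 1 - b $ 1]"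
  have \<alpha>: "\<alpha> $ 1 = - (b' $ 2 - b $ 2)" "\<alpha> $ 2 = b' $ 1 - b $ 1" unfolding \<alpha>_def by (simp_all add: vector_2)
  have neg: "- x = x" "x - y = y + x" for x y :: bit by (cases x; cases y; simp)+
  have "mod2 \<alpha> = swap2 (mod2 b + mod2 b')"
  proof (rule bit2_eqI)
    show "mod2 \<alpha> $ 1 = swap2 (mod2 b + mod2 b') $ 1"
      unfolding swap2_nth vector_add_component mod2_def vec_lambda_beta \<alpha> by (simp only: of_int_minus of_int_diff neg)
    show "mod2 \<alpha> $ 2 = swap2 (mod2 b + mod2 b') $ 2"
      unfolding swap2_nth vector_add_component mod2_def vec_lambda_beta \<alpha> by (simp only: of_int_diff neg)
  qed
  moreover have "pt \<alpha> \<bullet> (p - q) = 0" if p: "p \<in> max_face w" and q: "q \<in> max_face w" for p q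
  proof -
    have tie: "w \<bullet> (r - s) = 0" if "r \<in> max_face w" "s \<in> max_face w" for r s
    proof -
      have "w \<bullet> r \<le> w \<bullet> s" "w \<bullet> s \<le> w \<bullet> r" using that unfolding max_face_def by blast+
      then show ?thesis by (simp add: inner_diff_right)
    qed
    have bb: "pt b \<in> max_face w" "pt b' \<in> max_face w" using b unfolding face_terms_def by blast+
    obtain c where c: "p - q = c *\<^sub>R (pt b' - pt b)"
      using perp_2_collinear[OF w tie[OF p q] tie[OF bb(2,1)]] b(3) by auto
    have "pt \<alpha> \<bullet> (pt b' - pt b) = 0" by (simp add: inner_2 \<alpha> algebra_simps)
    then show ?thesis unfolding c by simp
  qed
  ultimately show ?thesis unfolding perp_def by blast
qed

end

section \<open>The component along the toric boundary\<close>

text \<open>The conclusion of \<open>outer_minority\<close>: \<open>maj \<epsilon>\<close> is the majority sign near the toric boundary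
  in the quadrant \<open>\<epsilon>\<close>.\<close>

locale harnack_boundary = even_real_curve +
  fixes maj :: "reflection \<Rightarrow> bit" and \<epsilon>0 :: reflection
  assumes minority: "\<And>b x v \<epsilon>. \<lbrakk>outer b; b \<in> M x; v \<in> M x\<rbrakk> \<Longrightarrow>
     sign_at \<epsilon> v = (if \<epsilon> = \<epsilon>0 + swap2 (cls v) then maj \<epsilon> + 1 else maj \<epsilon>)"
begin

text \<open>The quadrant in which \<open>b\<close> is in the minority.\<close>

definition quadrant :: "int^2 \<Rightarrow> reflection" where "quadrant b = \<epsilon>0 + swap2 (cls b)"

definition arc :: "int^2 \<Rightarrow> (reflection \<times> toric_point) set set" where
  "arc b = rincl (quadrant b) ` {x. b \<in> M x \<and> M x \<noteq> {b}}"

lemma bit_plus1: "x + 1 \<noteq> x" "x \<noteq> x + 1" for x :: bit by (cases x; simp)+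

lemma quadrant_add: "quadrant b + quadrant b' = swap2 (mod2 b + mod2 b')"
proof (rule bit2_eqI)
  have e: "(e + (p + v)) + (e + (q + v)) = p + q" for e p q v :: bit
    by (simp only: ac_simps bit_add_self add_0_left add_0_right)
  show "(quadrant b + quadrant b') $ 1 = swap2 (mod2 b + mod2 b') $ 1"
    "(quadrant b + quadrant b') $ 2 = swap2 (mod2 b + mod2 b') $ 2"
    unfolding quadrant_def cls_def vector_add_component swap2_nth by (rule e)+
qed

lemma quadrant_distinct:
  assumes "u \<in> M x" "v \<in> M x" "u \<noteq> v"
  shows "quadrant u \<noteq> quadrant v"
proof
  assume "quadrant u = quadrant v"
  then have sw: "swap2 (mod2 u + mod2 v) = 0" using quadrant_add[of u v] bit2_add_self(1) by metis
  have eq: "x = y" if "x + y = 0" for x y :: bit using that by (cases x; cases y; simp)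
  have "mod2 u $ 2 = mod2 v $ 2"
    using arg_cong[OF sw, of "\<lambda>z. z $ 1"] unfolding swap2_nth vector_add_component zero_index by (rule eq)
  moreover have "mod2 u $ 1 = mod2 v $ 1"
    using arg_cong[OF sw, of "\<lambda>z. z $ 2"] unfolding swap2_nth vector_add_component zero_index by (rule eq)
  ultimately have "mod2 u = mod2 v" by (intro bit2_eqI)
  then show False using cls_distinct[OF assms] by simp
qed

lemma sign_at_outer: "\<lbrakk>outer b; b \<in> M x; v \<in> M x\<rbrakk> \<Longrightarrow> sign_at \<epsilon> v = (if \<epsilon> = quadrant v then maj \<epsilon> + 1 else maj \<epsilon>)"
  unfolding quadrant_def by (rule minority)

text \<open>The neighbours of \<open>b\<close> have other classes modulo 2, so in its quadrant they all have the majority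
  sign.\<close>

lemma arc_subset_wall:
  assumes "outer b"
  shows "arc b \<subseteq> cover.wall"
proof
  fix p assume "p \<in> arc b"
  then obtain x where x: "b \<in> M x" "M x \<noteq> {b}" "p = rincl (quadrant b) x" unfolding arc_def by blast
  then obtain u where u: "u \<in> M x" "u \<noteq> b" by blast
  have "sign_at (quadrant b) b \<noteq> sign_at (quadrant b) u"
    using sign_at_outer[OF assms x(1) x(1)] sign_at_outer[OF assms x(1) u(1)] quadrant_distinct[OF x(1) u(1)] u(2) bit_plus1
    by auto
  then show "p \<in> cover.wall" unfolding x(3) rincl_in_wall using x(1) u(1) by blast
qed

lemma connected_arc: "outer b \<Longrightarrow> connectedin rsurface (arc b)"
  unfolding arc_def
  by (intro connectedin_continuous_map_image[OF continuous_rincl]) (simp add: connected_region_boundary)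

lemma rpoint_in_arc_closure:
  assumes \<Gamma>: "is_face \<Gamma>" and b: "b \<in> fterms \<Gamma> x" "u \<in> fterms \<Gamma> x" "u \<noteq> b"
  shows "rpoint (quadrant b) \<Gamma> x \<in> rsurface closure_of arc b"
  unfolding arc_def using b by (intro rpoint_in_closure_terms[OF \<Gamma>]) auto

text \<open>If the regions of \<open>c\<close> and \<open>c'\<close> are adjacent along an unbounded edge with direction \<open>w\<close>, then
  \<open>quadrant c\<close> and \<open>quadrant c'\<close> differ by the normal of the face of \<open>w\<close>. The end point of the edge in
  the one quadrant is thus glued to its end point in the other, and it lies in the closures of both arcs.\<close>

lemma one_component_meets_arcs:
  assumes K: "K \<in> connected_components_of (subtopology rsurface cover.wall)"
    and b: "outer b" "b \<in> M x" "arc b \<inter> K \<noteq> {}" and b': "outer b'" "b' \<in> M x'"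
  shows "rsurface closure_of arc b' \<subseteq> K"
proof (rule far_propagation[of "\<lambda>b. rsurface closure_of arc b \<subseteq> K" b x b' x'])
  show "rsurface closure_of arc b \<subseteq> K"
    using component_absorbs[OF K connected_arc[OF b(1)] arc_subset_wall[OF b(1)] b(3)] .
  fix w y c c'
  assume w: "w \<noteq> 0" and c: "c \<in> M y" "c' \<in> M y" "\<And>v u. v \<in> M y \<Longrightarrow> u \<in> A \<Longrightarrow> pt u \<bullet> w \<le> pt v \<bullet> w"
    and cK: "rsurface closure_of arc c \<subseteq> K"
  show "rsurface closure_of arc c' \<subseteq> K"
  proof (cases "c = c'")
    case False
    let ?\<Gamma> = "max_face w"
    have \<Gamma>: "is_face ?\<Gamma>" using max_face unfolding is_face_def by blast
    have cA: "c \<in> A" "c' \<in> A" using c(1,2) M_subset by blast+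
    then have cf: "c \<in> face_terms ?\<Gamma>" "c' \<in> face_terms ?\<Gamma>" unfolding max_face_terms using c by blast+
    then have ct: "c \<in> fterms ?\<Gamma> y" "c' \<in> fterms ?\<Gamma> y"
      using c(1,2) face_terms_subset unfolding mem_fterms mem_M by blast+
    have "rpoint (quadrant c) ?\<Gamma> y = rpoint (quadrant c') ?\<Gamma> y"
      using rpoint_eq_iff[OF \<Gamma> \<Gamma>] perp_quarter_turn[OF w cf False] quadrant_add by simp
    moreover have "rpoint (quadrant c) ?\<Gamma> y \<in> K" using rpoint_in_arc_closure[OF \<Gamma> ct] False cK by blast
    moreover have "rpoint (quadrant c') ?\<Gamma> y \<in> rsurface closure_of arc c'"
      using rpoint_in_arc_closure[OF \<Gamma> ct(2,1)] False by blast
    ultimately have meet: "rsurface closure_of arc c' \<inter> K \<noteq> {}" by auto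
    have oc: "outer c'" unfolding outer_def using w c cA by blast
    have "rsurface closure_of (rsurface closure_of arc c') \<subseteq> K"
      by (rule component_absorbs[OF K connectedin_closure_of[OF connected_arc[OF oc]] _ meet])
        (rule closure_of_minimal[OF arc_subset_wall[OF oc] closedin_wall])
    then show ?thesis by simp
  qed (use cK in simp)
qed (use b b' in auto)

text \<open>Colour the regions of boundary points by their sign and all others by the majority sign of their
  quadrant. A change of colour at a point involves a boundary point \<open>u\<close> of minority sign, so the
  quadrant is that of \<open>u\<close> and the point lies in the closure of the arc of \<open>u\<close>.\<close>

lemma boundary_component_oval:
  assumes K: "K \<in> connected_components_of (subtopology rsurface cover.wall)"
    and b: "outer b" "b \<in> M x" "arc b \<inter> K \<noteq> {}"
  shows "is_oval rsurface K"
proof -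
  define \<kappa> where "\<kappa> \<epsilon> v = (if outer v then sign_at \<epsilon> v else maj \<epsilon>)" for \<epsilon> v
  have glue: "\<kappa> \<epsilon>1 u = \<kappa> \<epsilon> u" if \<Gamma>: "is_face \<Gamma>" and u: "u \<in> fterms \<Gamma> x" "perp \<Gamma> (\<epsilon>1 + \<epsilon>)" for \<Gamma> \<epsilon>1 \<epsilon> u x
  proof (cases "\<Gamma> = polygon")
    case True
    then show ?thesis using u(2) unfolding True perp_polygon by (simp add: bit2_add_eq_iff bit2_add_self)
  next
    case False
    have "u \<in> face_terms \<Gamma>" using u(1) mem_fterms by blast
    then show ?thesis using sign_at_glue[OF \<Gamma> u(2)] outer_if_proper_face[OF \<Gamma> False] unfolding \<kappa>_def by simp
  qed
  have minor: "rpoint \<epsilon> \<Gamma> y \<in> K"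
    if \<Gamma>: "is_face \<Gamma>" and u: "u \<in> fterms \<Gamma> y" "v \<in> fterms \<Gamma> y" "u \<noteq> v" "\<kappa> \<epsilon> u \<noteq> maj \<epsilon>" for \<Gamma> \<epsilon> u v y
  proof -
    obtain z where z: "M z = fterms \<Gamma> y" using fterms_are_terms[OF \<Gamma>] .
    have o: "outer u" and s: "sign_at \<epsilon> u \<noteq> maj \<epsilon>" using u(4) unfolding \<kappa>_def by (auto split: if_splits)
    have uz: "u \<in> M z" using u(1) z by simp
    have "\<epsilon> = quadrant u" using s sign_at_outer[OF o uz uz] by (auto split: if_splits)
    then have "rpoint \<epsilon> \<Gamma> y \<in> rsurface closure_of arc u" using rpoint_in_arc_closure[OF \<Gamma> u(1,2)] u(3) by simp
    then show ?thesis using one_component_meets_arcs[OF K b o uz] by blast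
  qed
  obtain p where "p \<in> arc b" using b(3) by blast
  then obtain y where y: "b \<in> M y" "M y \<noteq> {b}" unfolding arc_def by blast
  then obtain u where u: "u \<in> M y" "u \<noteq> b" by blast
  show ?thesis
  proof (rule oval_criterion[OF K, of \<kappa> b u "quadrant b" "quadrant b"])
    fix p \<epsilon>1 u \<epsilon>2 v assume h: "p \<in> rcell \<epsilon>1 u" "p \<in> rcell \<epsilon>2 v" "\<kappa> \<epsilon>1 u \<noteq> \<kappa> \<epsilon>2 v"
    obtain \<epsilon> \<Gamma> y where \<Gamma>: "is_face \<Gamma>" and p: "p = rpoint \<epsilon> \<Gamma> y"
      using h(1) rcell_subset topspace_rsurface by blast
    have u: "u \<in> fterms \<Gamma> y" "perp \<Gamma> (\<epsilon>1 + \<epsilon>)" and v: "v \<in> fterms \<Gamma> y" "perp \<Gamma> (\<epsilon>2 + \<epsilon>)"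
      using h(1,2) unfolding p rpoint_in_rcell[OF \<Gamma>] by auto
    have ne: "\<kappa> \<epsilon> u \<noteq> \<kappa> \<epsilon> v" using h(3) glue[OF \<Gamma> u] glue[OF \<Gamma> v] by simp
    then have "u \<noteq> v" by auto
    then show "p \<in> K" using minor[OF \<Gamma> u(1) v(1)] minor[OF \<Gamma> v(1) u(1)] ne unfolding p by metis
  next
    show "b \<in> active" "u \<in> active" using active_terms y u by blast+
    have "\<kappa> (quadrant b) b = maj (quadrant b) + 1" unfolding \<kappa>_def using b(1) sign_at_outer[OF b(1) y(1) y(1)] by simp
    moreover have "\<kappa> (quadrant b) u = maj (quadrant b)"
      unfolding \<kappa>_def using sign_at_outer[OF b(1) y(1) u(1)] quadrant_distinct[OF y(1) u(1)] u(2) by auto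
    ultimately show "\<kappa> (quadrant b) b \<noteq> \<kappa> (quadrant b) u" using bit_plus1 by simp
  qed
qed

section \<open>Components inside a quadrant\<close>

text \<open>If all dominant terms were boundary points, then one of them would be in the minority and the point
  would lie in the closure of its arc.\<close>

lemma inner_component_point:
  assumes K: "K \<in> connected_components_of (subtopology rsurface cover.wall)"
    and no: "\<forall>b x. outer b \<longrightarrow> b \<in> M x \<longrightarrow> arc b \<inter> K = {}"
    and p: "p \<in> K" "is_face \<Gamma>" "p = rpoint \<epsilon> \<Gamma> x"
  obtains u where "u \<in> fterms \<Gamma> x" "\<not> outer u"
proof -
  have "p \<in> cover.wall" using p(1) connected_components_of_subset[OF K] by auto
  then obtain u v where uv: "u \<in> fterms \<Gamma> x" "v \<in> fterms \<Gamma> x" "sign_at \<epsilon> u \<noteq> sign_at \<epsilon> v"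
    unfolding p(3) rpoint_in_wall[OF p(2)] by blast
  then have ne: "u \<noteq> v" by auto
  obtain z where z: "M z = fterms \<Gamma> x" using fterms_are_terms[OF p(2)] .
  have off: "\<epsilon> \<noteq> quadrant y" if y: "y \<in> fterms \<Gamma> x" "y' \<in> fterms \<Gamma> x" "y' \<noteq> y" "outer y" for y y'
  proof
    assume "\<epsilon> = quadrant y"
    then have "p \<in> rsurface closure_of arc y" using rpoint_in_arc_closure[OF p(2) y(1-3)] p(3) by simp
    then have "(rsurface closure_of arc y) \<inter> K \<noteq> {}" using p(1) by blast
    then have "rsurface closure_of (rsurface closure_of arc y) \<subseteq> K"
      by (rule component_absorbs[OF K connectedin_closure_of[OF connected_arc[OF y(4)]]
          closure_of_minimal[OF arc_subset_wall[OF y(4)] closedin_wall]])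
    moreover have "arc y \<subseteq> rsurface closure_of (rsurface closure_of arc y)"
      using closure_of_subset connectedin_subset_topspace[OF connected_arc[OF y(4)]] by (metis closure_of_closure_of)
    moreover obtain q where "q \<in> arc y" unfolding arc_def using y z by blast
    ultimately show False using no y(1,4) z by blast
  qed
  have "\<not> (outer u \<and> outer v)"
  proof
    assume o: "outer u \<and> outer v"
    have zz: "u \<in> M z" "v \<in> M z" using uv z by auto
    have "sign_at \<epsilon> u = maj \<epsilon>" using sign_at_outer[of u z u] off[OF uv(1,2)] ne o zz by auto
    moreover have "sign_at \<epsilon> v = maj \<epsilon>" using sign_at_outer[of v z v] off[OF uv(2,1)] ne o zz by auto
    ultimately show False using uv(3) by simp
  qed
  then show ?thesis using that uv by blast
qed

text \<open>By \<open>inner_component_point\<close> the component contains no points of the toric boundary and, seen in its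
  quadrant, is a closed bounded set \<open>L\<close>. It separates the open regions on its two sides at \<open>x0\<close>; at most
  one of these sides is unbounded. The colour class is the set of regions in a bounded side.\<close>

lemma inner_component_oval:
  assumes K: "K \<in> connected_components_of (subtopology rsurface cover.wall)"
    and no: "\<forall>b x. outer b \<longrightarrow> b \<in> M x \<longrightarrow> arc b \<inter> K = {}"
  shows "is_oval rsurface K"
proof -
  have KR: "K \<subseteq> cover.wall" using connected_components_of_subset[OF K] by auto
  have plane: "\<Gamma> = polygon" if h: "p \<in> K" "is_face \<Gamma>" "p = rpoint \<epsilon> \<Gamma> x" for p \<epsilon> \<Gamma> x
  proof (rule ccontr)
    assume ne: "\<Gamma> \<noteq> polygon"
    obtain u where "u \<in> fterms \<Gamma> x" "\<not> outer u" using inner_component_point[OF K no h] .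
    then show False using outer_if_proper_face[OF h(2) ne] mem_fterms by blast
  qed
  obtain p0 where p0: "p0 \<in> K" using nonempty_connected_components_of[OF K] by blast
  then obtain \<epsilon> \<Gamma> x0 where "is_face \<Gamma>" "p0 = rpoint \<epsilon> \<Gamma> x0" using wall_point KR by blast
  then have p0x: "p0 = rincl \<epsilon> x0" using plane[OF p0] unfolding rincl_def by simp
  define L where "L = {x. rincl \<epsilon> x \<in> K}"
  have Kclosed: "closedin rsurface K"
    using closedin_connected_components_of[OF K] closedin_wall by (simp add: closedin_closed_subtopology)
  have Lclosed: "closed L"
  proof -
    have "closedin euclidean {x \<in> topspace euclidean. rincl \<epsilon> x \<in> K}"
      by (rule closedin_continuous_map_preimage[OF continuous_rincl Kclosed])
    then show ?thesis unfolding L_def by simp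
  qed
  have Lbounded: "bounded L"
  proof -
    obtain R where R: "\<And>x. R < norm x \<Longrightarrow> \<exists>w. w \<noteq> 0 \<and> (\<forall>v\<in>M x. \<forall>u\<in>A. pt u \<bullet> w \<le> pt v \<bullet> w)"
      using far_direction by blast
    have "norm x \<le> R" if "x \<in> L" for x
    proof (rule ccontr)
      assume "\<not> norm x \<le> R"
      then obtain w where w: "w \<noteq> 0" "\<forall>v\<in>M x. \<forall>u\<in>A. pt u \<bullet> w \<le> pt v \<bullet> w" using R by force
      have "rincl \<epsilon> x \<in> K" using that unfolding L_def by simp
      then obtain u where "u \<in> fterms polygon x" "\<not> outer u"
        by (rule inner_component_point[OF K no _ polygon_face rincl_def])
      then have "u \<in> M x" "\<not> outer u" unfolding face_terms_polygon by simp_all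
      then show False using w M_subset unfolding outer_def by blast
    qed
    then show ?thesis unfolding bounded_iff by blast
  qed
  have L_open: "open_region v \<inter> L = {}" for v
    unfolding L_def using KR rincl_in_wall by fastforce
  have L_wall: "x \<in> L \<Longrightarrow> \<exists>u\<in>M x. \<exists>v\<in>M x. sign_at \<epsilon> u \<noteq> sign_at \<epsilon> v" for x
    unfolding L_def using KR rincl_in_wall by blast
  have join: "connected (insert x (open_region u) \<union> insert x (open_region v))"
    if "u \<in> M x" "v \<in> M x" for u v x
  proof -
    have "connected (insert x (open_region y))" if y: "y \<in> M x" for y
    proof -
      obtain z where "M z = {y}" using exact_terms[of "{y}" x] y by auto
      then have "x \<in> closure (open_region y)" using region_subset_closure y by blast
      then show ?thesis
        using connected_intermediate_closure[OF convex_connected[OF convex_open_region[of y]], of "insert x (open_region y)"]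
          closure_subset[of "open_region y"] by blast
    qed
    then show ?thesis using that by (intro connected_Un) auto
  qed
  obtain u v where uv: "u \<in> M x0" "v \<in> M x0" "sign_at \<epsilon> u \<noteq> sign_at \<epsilon> v"
    using L_wall[of x0] p0 p0x unfolding L_def by auto
  obtain zu where zu: "M zu = {u}" using exact_terms[of "{u}" x0] uv by auto
  obtain zv where zv: "M zv = {v}" using exact_terms[of "{v}" x0] uv by auto
  \<comment> \<open>\<open>W\<close> is the whole real part in this quadrant, which separates \<open>zu\<close> from \<open>zv\<close> because their regions
    have opposite signs. Some component \<open>C\<close> of \<open>W\<close> does so too; it must contain \<open>x0\<close>, through which the
    two regions are adjacent, and is therefore contained in \<open>L\<close>.\<close>
  define W where "W = {x. \<exists>u\<in>M x. \<exists>v\<in>M x. sign_at \<epsilon> u \<noteq> sign_at \<epsilon> v}"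
  have Wclosed: "closed W"
  proof -
    have "W = (\<Union>(u, v)\<in>{(u, v). u \<in> A \<and> v \<in> A \<and> sign_at \<epsilon> u \<noteq> sign_at \<epsilon> v}. region u \<inter> region v)"
      unfolding W_def using M_subset by fastforce
    moreover have "finite {(u, v). u \<in> A \<and> v \<in> A \<and> sign_at \<epsilon> u \<noteq> sign_at \<epsilon> v}"
      by (rule finite_subset[of _ "A \<times> A"]) (use finite_support in auto)
    ultimately show ?thesis
      by (simp only:) (intro closed_UN, auto intro!: closed_Int closed_region finite_support)
  qed
  have sepW: "\<not> connected_component (- W) zu zv"
  proof
    assume "connected_component (- W) zu zv"
    then obtain T where T: "connected T" "T \<subseteq> - W" "zu \<in> T" "zv \<in> T" unfolding connected_component_def by blast
    have "sign_at \<epsilon> v = sign_at \<epsilon> u"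
    proof (rule closed_cover_propagation_euclidean[OF T(1) finite_support, of region "\<lambda>y. sign_at \<epsilon> y = sign_at \<epsilon> u" u zu v zv])
      show "T \<subseteq> (\<Union>y\<in>A. region y)" using M_nonempty M_subset by blast
      show "u \<in> A" "v \<in> A" using uv M_subset by blast+
      fix i j x assume h: "x \<in> T" "x \<in> region i" "x \<in> region j" "sign_at \<epsilon> i = sign_at \<epsilon> u"
      then have "x \<notin> W" using T(2) by blast
      then have "sign_at \<epsilon> i = sign_at \<epsilon> j" using h(2,3) unfolding W_def by blast
      then show "sign_at \<epsilon> j = sign_at \<epsilon> u" using h(4) by simp
    qed (use T zu zv in \<open>auto simp: closed_region finite_support\<close>)
    then show False using uv(3) by simp
  qed
  obtain C where C: "C \<in> components W" "\<not> connected_component (- C) zu zv"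
    using separation_by_component_closed_pointwise[OF Wclosed sepW] .
  have CW: "C \<subseteq> W" using C(1) in_components_subset by blast
  have W_open: "open_region y \<inter> W = {}" for y unfolding W_def by fastforce
  have "x0 \<in> C"
  proof (rule ccontr)
    assume x0: "x0 \<notin> C"
    have "insert x0 (open_region u) \<union> insert x0 (open_region v) \<subseteq> - C" using x0 CW W_open by blast
    then have "connected_component (- C) zu zv"
      unfolding connected_component_def using join[OF uv(1,2)] zu zv
      by (intro exI[of _ "insert x0 (open_region u) \<union> insert x0 (open_region v)"]) auto
    then show False using C(2) by contradiction
  qed
  have "C \<subseteq> L"
  proof -
    have "connectedin rsurface (rincl \<epsilon> ` C)"
      using in_components_connected[OF C(1)] by (intro connectedin_continuous_map_image[OF continuous_rincl]) simp
    moreover have sub: "rincl \<epsilon> ` C \<subseteq> cover.wall" using CW rincl_in_wall unfolding W_def by blast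
    moreover have "rincl \<epsilon> ` C \<inter> K \<noteq> {}" using \<open>x0 \<in> C\<close> p0 p0x by blast
    ultimately have "rsurface closure_of (rincl \<epsilon> ` C) \<subseteq> K" using component_absorbs[OF K] by blast
    moreover have "rincl \<epsilon> ` C \<subseteq> rsurface closure_of (rincl \<epsilon> ` C)"
      by (rule closure_of_subset) (use rincl_in_topspace in blast)
    ultimately show ?thesis unfolding L_def by blast
  qed
  then have sepL: "\<not> connected_component (- L) zu zv"
    using C(2) connected_component_of_subset[of "- L" zu zv "- C"] by blast
  have inL: "zu \<notin> L" "zv \<notin> L" using L_open zu zv by blast+
  have "bounded (connected_component_set (- L) zu) \<or> bounded (connected_component_set (- L) zv)"
  proof (rule ccontr)
    assume "\<not> ?thesis"
    then have "connected_component_set (- L) zu = connected_component_set (- L) zv"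
      using cobounded_unique_unbounded_component[of "- L" zu zv] Lbounded by simp
    then show False using sepL inL by (metis ComplI connected_component_refl mem_Collect_eq)
  qed
  then obtain y z y' z' where yz: "M z = {y}" "M z' = {y'}" "bounded (connected_component_set (- L) z)"
    "\<not> connected_component (- L) z z'" "y \<in> active" "y' \<in> active"
    using zu zv sepL connected_component_sym active_terms[OF uv(1)] active_terms[OF uv(2)] by metis
  define Z where "Z = connected_component_set (- L) z"
  have zL: "z \<notin> L" using yz(1) L_open by blast
  have Z_max: "S \<subseteq> Z" if h: "connected S" "S \<subseteq> - L" "S \<inter> Z \<noteq> {}" for S
  proof -
    obtain s where s: "s \<in> S" "s \<in> Z" using h(3) by blast
    then have "connected_component_set (- L) s = Z" unfolding Z_def using connected_component_eq by metis
    then show ?thesis using connected_component_maximal[OF s(1) h(1,2)] by simp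
  qed
  define \<kappa> where "\<kappa> \<epsilon>' v \<longleftrightarrow> \<epsilon>' = \<epsilon> \<and> open_region v \<subseteq> Z" for \<epsilon>' v
  have half: "p \<in> K"
    if h: "u1 \<in> active" "p \<in> rcell \<epsilon>1 u1" "p \<in> rcell \<epsilon>2 v1" "\<kappa> \<epsilon>1 u1" "\<not> \<kappa> \<epsilon>2 v1" for p \<epsilon>1 u1 \<epsilon>2 v1
  proof (rule ccontr)
    assume pK: "p \<notin> K"
    obtain \<epsilon>' \<Gamma> x where \<Gamma>: "is_face \<Gamma>" and p: "p = rpoint \<epsilon>' \<Gamma> x"
      using h(2) rcell_subset topspace_rsurface by blast
    have u1: "u1 \<in> fterms \<Gamma> x" "perp \<Gamma> (\<epsilon>1 + \<epsilon>')" and v1: "v1 \<in> fterms \<Gamma> x" "perp \<Gamma> (\<epsilon>2 + \<epsilon>')"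
      using h(2,3) unfolding p rpoint_in_rcell[OF \<Gamma>] by auto
    have e1: "\<epsilon>1 = \<epsilon>" and uZ: "open_region u1 \<subseteq> Z" using h(4) unfolding \<kappa>_def by auto
    obtain r where r: "M r = {u1}" using h(1) unfolding active_def by blast
    have "bounded (open_region u1)" using uZ yz(3) bounded_subset unfolding Z_def by blast
    then have "\<not> outer u1" using unbounded_open_region r by blast
    then have poly: "\<Gamma> = polygon" using outer_if_proper_face[OF \<Gamma>] u1(1) mem_fterms by blast
    have ee: "\<epsilon>' = \<epsilon>" "\<epsilon>2 = \<epsilon>"
      using u1(2) v1(2) e1 unfolding poly perp_polygon by (simp_all add: bit2_add_eq_iff bit2_add_self)
    have px: "p = rincl \<epsilon> x" unfolding p rincl_def ee poly ..
    have M1: "u1 \<in> M x" "v1 \<in> M x" using u1(1) v1(1) unfolding poly face_terms_polygon by auto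
    have "x \<notin> L" using pK unfolding L_def px by simp
    then have "insert x (open_region u1) \<union> insert x (open_region v1) \<subseteq> Z"
      using r uZ L_open by (intro Z_max join M1) blast+
    then show False using h(5) ee unfolding \<kappa>_def by blast
  qed
  show ?thesis
  proof (rule oval_criterion[OF K, of \<kappa> y y' \<epsilon> \<epsilon>])
    show "p \<in> K" if "u1 \<in> active" "v1 \<in> active" "p \<in> rcell \<epsilon>1 u1" "p \<in> rcell \<epsilon>2 v1" "\<kappa> \<epsilon>1 u1 \<noteq> \<kappa> \<epsilon>2 v1"
      for p \<epsilon>1 u1 \<epsilon>2 v1
      using half[of u1 p \<epsilon>1 \<epsilon>2 v1] half[of v1 p \<epsilon>2 \<epsilon>1 u1] that by blast
    have "open_region y \<subseteq> Z"
    proof (rule Z_max)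
      show "connected (open_region y)" using convex_open_region convex_connected by blast
      show "open_region y \<subseteq> - L" using L_open by blast
      have "z \<in> Z" unfolding Z_def using zL by simp
      then show "open_region y \<inter> Z \<noteq> {}" using yz(1) by blast
    qed
    moreover have "\<not> open_region y' \<subseteq> Z" using yz(2,4) unfolding Z_def by blast
    ultimately show "\<kappa> \<epsilon> y \<noteq> \<kappa> \<epsilon> y'" unfolding \<kappa>_def by simp
  qed (use yz in auto)
qed

section \<open>All components are ovals\<close>

theorem components_are_ovals:
  assumes "K \<in> connected_components_of (subtopology rsurface cover.wall)"
  shows "is_oval rsurface K"
  using boundary_component_oval[OF assms] inner_component_oval[OF assms] by blast

end

theorem proposition5p10:
  fixes A :: "(int^2) set" and a :: "int^2 \<Rightarrow> real" and \<delta> :: "int^2 \<Rightarrow> int"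
  assumes "finite A" and "A \<noteq> {}" and "\<forall>v\<in>A. \<forall>i. 0 \<le> v $ i"
    and "nonsingular_curve A a"
    and "complete_fan (dual_fan (newton_polygon A))"
    and "unimodular_fan (dual_fan (newton_polygon A))"
    and "strict_even_degree A"
    and "sign_distribution A \<delta>"
    and "\<forall>e\<in>twisted_edges A a \<delta>. \<not> exposed_edge A a e"
  shows "\<forall>K\<in>connected_components_of
               (subtopology (real_toric (newton_polygon A)) (real_part A a \<delta>)).
           is_oval (real_toric (newton_polygon A)) K"
proof -
  interpret nonsingular_tropical_curve A a
    using assms(1,2,4) unimodular_fan_full_dim[OF assms(6,2)] by unfold_locales blast+
  obtain v0 where v0: "v0 \<in> face_terms polygon" "pt v0 extreme_point_of polygon"
    using face_vertex polygon_face unfolding is_face_def by blast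
  interpret real_tropical_curve A a \<delta> v0
    by unfold_locales (use assms(8,9) pt_in_polygon in \<open>auto simp: sign_distribution_def\<close>)
  interpret even_real_curve A a \<delta> v0
  proof
    fix \<Gamma> \<eta> b assume \<Gamma>: "is_face \<Gamma>" and "perp \<Gamma> \<eta>" and b: "b \<in> face_terms \<Gamma>"
    then obtain \<alpha> where \<alpha>: "mod2 \<alpha> = \<eta>" "\<forall>x\<in>\<Gamma>. \<forall>y\<in>\<Gamma>. pt \<alpha> \<bullet> (x - y) = 0" unfolding perp_def by blast
    show "bdot \<eta> (cls b) = 0"
      using orthogonal_parity[OF assms(7) _ v0(2) _ _ \<alpha>(2) b] v0(1) \<Gamma>
      unfolding cls_def \<alpha>(1) face_terms_polygon is_face_def by blast
  qed
  obtain maj \<epsilon>0 where minority: "\<forall>b x v \<epsilon>. outer b \<longrightarrow> b \<in> M x \<longrightarrow> v \<in> M x \<longrightarrow>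
     sign_at \<epsilon> v = (if \<epsilon> = \<epsilon>0 + swap2 (cls v) then maj \<epsilon> + 1 else maj \<epsilon>)"
    using outer_minority by (elim exE)
  interpret harnack_boundary A a \<delta> v0 maj \<epsilon>0
    by unfold_locales (use minority in blast)
  show ?thesis unfolding real_part_eq_wall using components_are_ovals by blast
qed

end
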